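(* Let $d,m\ge1$, let $F=(f_1,\dots,f_m):\mathbb{C}^d\to\mathbb{C}^m$ be an entire (holomorphic) map, and let $\Gamma_F=\{(z,F(z)):z\in\mathbb{C}^d\}\subset\mathbb{C}^{d+m}$ be its graph. The following are equivalent: (i) $F$ is polynomial; (ii) $\mathcal{H}^{2d}\bigl(\Sigma_\infty(\Gamma_F)\bigr)=0$; (iii) $\dim_H\Sigma_\infty(\Gamma_F)<2d$. If $F$ is nonpolynomial, then $\Sigma_\infty(\Gamma_F)$ meets every projective $(m-1)$-plane in $\mathbb{P}^{d+m-1}(\mathbb{C})$ and $\mathcal{H}^{2d}\bigl(\Sigma_\infty(\Gamma_F)\bigr)>0$. In particular, for an entire function $f:\mathbb{C}^d\to\mathbb{C}$ with graph $\Gamma_f\subset\mathbb{C}^{d+1}$, if $f$ is nonpolynomial then $\Sigma_\infty(\Gamma_f)=\mathbb{P}^d(\mathbb{C})$.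
   Context: $F$ is polynomial if each component $f_j$ is a polynomial, and nonpolynomial otherwise. For $A\subset\mathbb{C}^n$, the total tangent cone at infinity is $$C_\infty(A)=\{v\in\mathbb{C}^n:\exists\, x_j\in A,\ t_j>0,\ \|x_j\|\to\infty,\ t_j\to\infty,\ x_j/t_j\to v\}.$$ The projective asymptotic direction set is $\Sigma_\infty(A)=\{\mathbb{C}v: v\in C_\infty(A)\setminus\{0\}\}\subset\mathbb{P}^{n-1}(\mathbb{C})$, where $\mathbb{P}^{n-1}(\mathbb{C})$ is the space of complex lines through the origin in $\mathbb{C}^n$. A projective $(k-1)$-plane in $\mathbb{P}^{n-1}(\mathbb{C})$ is a set $\mathbb{P}(L)=\{\ell\in\mathbb{P}^{n-1}(\mathbb{C}):\ell\subset L\}$ with $L\subset\mathbb{C}^n$ a $k$-dimensional complex linear subspace. $\mathcal{H}^s$ is $s$-dimensional Hausdorff measure and $\dim_H$ is Hausdorff dimension, taken on $\mathbb{P}^{n-1}(\mathbb{C})$ with respect to a fixed smooth Riemannian metric. *)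

theory Defs
  imports "HOL-Analysis.Analysis"
begin

definition entire_fun :: "(complex^'d \<Rightarrow> complex) \<Rightarrow> bool" where
  "entire_fun f \<longleftrightarrow>
     (\<forall>z. \<exists>D. (f has_derivative D) (at z) \<and> Vector_Spaces.linear (*s) (*) D)"

definition entire_map :: "(complex^'d \<Rightarrow> complex^'m) \<Rightarrow> bool" where
  "entire_map F \<longleftrightarrow> (\<forall>j. entire_fun (\<lambda>z. F z $ j))"

definition polynomial_fun :: "(complex^'d \<Rightarrow> complex) \<Rightarrow> bool" where
  "polynomial_fun f \<longleftrightarrow>
     (\<exists>(S :: ('d \<Rightarrow> nat) set) (c :: ('d \<Rightarrow> nat) \<Rightarrow> complex).
        finite S \<and> (\<forall>z. f z = (\<Sum>\<alpha>\<in>S. c \<alpha> * (\<Prod>i\<in>UNIV. (z $ i) ^ \<alpha> i))))"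

definition polynomial_map :: "(complex^'d \<Rightarrow> complex^'m) \<Rightarrow> bool" where
  "polynomial_map F \<longleftrightarrow> (\<forall>j. polynomial_fun (\<lambda>z. F z $ j))"

text \<open>The space of dimension \<open>d + m\<close> is indexed by the sum type of the two index types.\<close>

definition graph_map :: "(complex^'d \<Rightarrow> complex^'m) \<Rightarrow> (complex^('d + 'm)) set" where
  "graph_map F = range (\<lambda>z. \<chi> i. case i of Inl k \<Rightarrow> z $ k | Inr j \<Rightarrow> F z $ j)"

definition graph_fun :: "(complex^'d \<Rightarrow> complex) \<Rightarrow> (complex^('d + 1)) set" where
  "graph_fun f = range (\<lambda>z. \<chi> i. case i of Inl k \<Rightarrow> z $ k | Inr _ \<Rightarrow> f z)"

text \<open>Points of the projective space are complex lines through the origin, as sets of vectors.\<close>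

definition proj_of :: "(complex^'n) set \<Rightarrow> (complex^'n) set set" where
  "proj_of L = {l. vec.subspace l \<and> vec.dim l = 1 \<and> l \<subseteq> L}"

abbreviation proj_space :: "(complex^'n) set set" where
  "proj_space \<equiv> proj_of UNIV"

definition proj_plane :: "nat \<Rightarrow> (complex^'n) set set \<Rightarrow> bool" where
  "proj_plane k Q \<longleftrightarrow> (\<exists>L. vec.subspace L \<and> vec.dim L = k + 1 \<and> Q = proj_of L)"

definition tangent_cone_inf :: "(complex^'n) set \<Rightarrow> (complex^'n) set" where
  "tangent_cone_inf A =
     {v. \<exists>(x :: nat \<Rightarrow> complex^'n) (t :: nat \<Rightarrow> real).
           (\<forall>j. x j \<in> A \<and> t j > 0) \<and>
           filterlim (\<lambda>j. norm (x j)) at_top sequentially \<and>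
           filterlim t at_top sequentially \<and>
           (\<lambda>j. x j /\<^sub>R t j) \<longlonglongrightarrow> v}"

definition asymp_dirs :: "(complex^'n) set \<Rightarrow> (complex^'n) set set" where
  "asymp_dirs A = {vec.span {v} | v. v \<in> tangent_cone_inf A - {0}}"

text \<open>The recursion describes the class \<open>C\<^sup>k\<close> on open sets only.\<close>

fun Ck_on :: "nat \<Rightarrow> ('a::euclidean_space \<Rightarrow> real) \<Rightarrow> 'a set \<Rightarrow> bool" where
  "Ck_on 0 f S \<longleftrightarrow> continuous_on S f"
| "Ck_on (Suc k) f S \<longleftrightarrow>
     (\<forall>x\<in>S. f differentiable (at x)) \<and>
     (\<forall>v. Ck_on k (\<lambda>x. frechet_derivative f (at x) v) S)"

text \<open>
  A Riemannian metric on projective space is encoded by its pullback \<open>g\<close> under the submersion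
  \<open>x \<mapsto> \<complex>x\<close> from the nonzero vectors. The tangent space at \<open>\<complex>x\<close> is the quotient of the ambient
  space by \<open>\<complex>x\<close>, where \<open>u\<close> at \<open>x\<close> and \<open>c u\<close> at \<open>c x\<close> represent the same tangent vector. So the
  pullbacks are exactly the smooth families of positive semidefinite real symmetric forms
  \<open>g x\<close>, \<open>x \<noteq> 0\<close>, with null space \<open>\<complex>x\<close> that are invariant under nonzero complex scalars. For
  example, the Fubini-Study metric is
  \<open>g x u v = Re \<langle>u,v\<rangle> / |x|\<^sup>2 - Re (\<langle>u,x\<rangle> \<langle>x,v\<rangle>) / |x|\<^sup>4\<close>. The value \<open>g 0\<close> is irrelevant.
\<close>

definition proj_riemannian_metric ::
    "(complex^'n \<Rightarrow> complex^'n \<Rightarrow> complex^'n \<Rightarrow> real) \<Rightarrow> bool" where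
  "proj_riemannian_metric g \<longleftrightarrow>
     (\<forall>u v k. Ck_on k (\<lambda>x. g x u v) (- {0})) \<and>
     (\<forall>x. x \<noteq> 0 \<longrightarrow>
        bilinear (g x) \<and>
        (\<forall>u v. g x u v = g x v u) \<and>
        (\<forall>u. 0 \<le> g x u u) \<and>
        (\<forall>u. g x u u = 0 \<longleftrightarrow> u \<in> vec.span {x}) \<and>
        (\<forall>c u v. c \<noteq> 0 \<longrightarrow> g (c *s x) (c *s u) (c *s v) = g x u v))"

definition riem_length ::
    "(complex^'n \<Rightarrow> complex^'n \<Rightarrow> complex^'n \<Rightarrow> real) \<Rightarrow> (real \<Rightarrow> complex^'n) \<Rightarrow> ennreal" where
  "riem_length g \<gamma> =
     (\<integral>\<^sup>+t\<in>{0..1}. ennreal (sqrt (g (\<gamma> t) (vector_derivative \<gamma> (at t))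
                                         (vector_derivative \<gamma> (at t)))) \<partial>lborel)"

text \<open>
  Every piecewise \<open>C\<^sup>1\<close> path in projective space lifts to a piecewise \<open>C\<^sup>1\<close> path of nonzero
  vectors, and the length does not depend on the lift.
\<close>

definition riem_dist ::
    "(complex^'n \<Rightarrow> complex^'n \<Rightarrow> complex^'n \<Rightarrow> real) \<Rightarrow>
       (complex^'n) set \<Rightarrow> (complex^'n) set \<Rightarrow> real" where
  "riem_dist g p q =
     enn2real (INF \<gamma>\<in>{\<gamma>. valid_path \<gamma> \<and> 0 \<notin> path_image \<gamma> \<and>
                          pathstart \<gamma> \<in> p \<and> pathfinish \<gamma> \<in> q}. riem_length g \<gamma>)"

text \<open>
  For a distance function \<open>d\<close> on a carrier \<open>M\<close>, without a normalising factor. The case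
  distinction implements \<open>diam {} ^ s = 0\<close> and \<open>0 ^ 0 = 1\<close>, unlike \<open>powr\<close>.
\<close>

definition dist_diam :: "('p \<Rightarrow> 'p \<Rightarrow> real) \<Rightarrow> 'p set \<Rightarrow> ennreal" where
  "dist_diam d U = (SUP x\<in>U. SUP y\<in>U. ennreal (d x y))"

definition diam_power :: "('p \<Rightarrow> 'p \<Rightarrow> real) \<Rightarrow> real \<Rightarrow> 'p set \<Rightarrow> ennreal" where
  "diam_power d s U =
     (if U = {} then 0 else if s = 0 then 1 else ennreal (enn2real (dist_diam d U) powr s))"

definition hausdorff_pre ::
    "'p set \<Rightarrow> ('p \<Rightarrow> 'p \<Rightarrow> real) \<Rightarrow> real \<Rightarrow> real \<Rightarrow> 'p set \<Rightarrow> ennreal" where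
  "hausdorff_pre M d s \<delta> A =
     (INF U\<in>{U :: nat \<Rightarrow> 'p set. A \<subseteq> (\<Union>i. U i) \<and>
                 (\<forall>i. U i \<subseteq> M \<and> dist_diam d (U i) \<le> ennreal \<delta>)}. \<Sum>i. diam_power d s (U i))"

definition hausdorff_measure ::
    "'p set \<Rightarrow> ('p \<Rightarrow> 'p \<Rightarrow> real) \<Rightarrow> real \<Rightarrow> 'p set \<Rightarrow> ennreal" where
  "hausdorff_measure M d s A = (SUP \<delta>\<in>{0<..}. hausdorff_pre M d s \<delta> A)"

definition hausdorff_dim :: "'p set \<Rightarrow> ('p \<Rightarrow> 'p \<Rightarrow> real) \<Rightarrow> 'p set \<Rightarrow> ennreal" where
  "hausdorff_dim M d A = (INF s\<in>{s. 0 \<le> s \<and> hausdorff_measure M d s A = 0}. ennreal s)"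

end

theory Submission
  imports
    Defs
    "HOL-Complex_Analysis.Conformal_Mappings"
    "HOL-Computational_Algebra.Fundamental_Theorem_Algebra"
begin

text \<open>
  Suppose that the cone at infinity of the graph meets an \<open>m\<close>-dimensional subspace
      \<open>L\<close> only in
  \<open>0\<close>. A linear projection with kernel \<open>L\<close> then gives an entire map
      \<open>\<phi>\<close> of the source with
  \<open>|z| + |F z| \<le> C (1 + |\<phi> z|)\<close>, and a small multiple of the identity added to
      \<open>\<phi>\<close> makes its Jacobian
  determinant \<open>J\<close> nonzero. An entire \<open>u\<close> with \<open>|u| = O((1 +
      |\<phi>|)^n)\<close> obeys a Bernstein-Walsh inequality
  \<open>|u| \<le> sup {|u| : |\<phi>| \<le> r} (|\<phi>| / r)^(n+1)\<close> on \<open>|\<phi>| \<ge>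
      r\<close>: maximise \<open>|u|^p |J| / |\<phi>|^((n+1) p)\<close> over a
  shell, note that \<open>J\<close> does not vanish at the maximum, and apply the maximum principle along the local
  preimage of a complex line through \<open>0\<close>. Together with Schwarz' lemma this bounds the dimension of
  the space of polynomials of degree \<open>k\<close> in \<open>(z, F\<^sub>j z)\<close> by
      \<open>O(k^d)\<close>, so that \<open>F\<^sub>j\<close> is algebraic, and an
  entire algebraic function is a polynomial.

  If the cone meets every \<open>m\<close>-dimensional subspace, project from a subspace of maximal dimension that
  misses it. The projection maps the asymptotic directions onto an affine chart of real dimension
  \<open>2d\<close> and is locally Lipschitz, so the directions are not \<open>2d\<close>-null.

  If \<open>F\<close> is polynomial, any \<open>d + 1\<close> coordinates of the graph are algebraically
      dependent, and the
  leading forms of the relations vanish on the cone. In an affine chart, every \<open>d\<close> coordinates thus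
  satisfy a nontrivial equation. Stratifying its zero set by the first nonvanishing derivative
  expresses one coordinate locally as a Lipschitz function of the others, and so the directions
  form a countable union of Lipschitz images of subsets of complex \<open>(d-1)\<close>-space.
\<close>

section \<open>Entire functions of several variables\<close>

text \<open>The dimension count balances exponents that are linear in the degree \<open>k\<close>. A
  combination of (k+1)^(d+1) monomials that vanishes to order \<open>m\<close> on a finite net gains
  2^(-m) by Schwarz' lemma and loses 2^(c0 (n+1)) with n = (d+1) k by the Bernstein-Walsh
  inequality, where the net and \<open>c0\<close> depend on \<phi> alone. So \<open>m\<close> may be
  a fixed multiple of \<open>k\<close>, the conditions number only O(k^d), and for large
  \<open>k\<close> a nontrivial combination satisfies them all and vanishes identically. The
  Riemannian distance is an infimum over all paths, which separates the two metric halves. Nullity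
  needs upper bounds, and one segment in a chart supplies them. Non-nullity needs lower bounds valid
  for every path, and these come from functions that are smooth on all of projective space. A
  relation among \<open>d\<close> chart coordinates controls only one of them. To control all
  coordinates by fewer than \<open>d\<close>, the relations for every choice of \<open>d\<close>
  coordinates must hold on the same piece, which is why the pieces are indexed by simultaneous
  choices.\<close>

definition pderiv_fun :: "'n \<Rightarrow> (complex^'n \<Rightarrow> complex) \<Rightarrow> complex^'n
    \<Rightarrow> complex" where
  "pderiv_fun i f z = frechet_derivative f (at z) (axis i 1)"

lemma axis_sum_expansion: "v = (\<Sum>i\<in>UNIV. v $ i *s axis i (1::complex))"
  by (simp add: vec_eq_iff axis_def if_distrib[where f="\<lambda>x. _ * x"] cong: if_cong)

lemma entire_fun_has_derivative:
  assumes "entire_fun f"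
  shows "(f has_derivative (\<lambda>v. \<Sum>i\<in>UNIV. v $ i * pderiv_fun i f z)) (at z)"
proof -
  obtain D where D: "(f has_derivative D) (at z)" and lin: "Vector_Spaces.linear (*s) (*) D"
    using assms unfolding entire_fun_def by blast
  interpret D: Vector_Spaces.linear "(*s)" "(*)" D by (rule lin)
  have eq: "D = frechet_derivative f (at z)"
    using D frechet_derivative_at by blast
  have "D v = (\<Sum>i\<in>UNIV. v $ i * pderiv_fun i f z)" for v
  proof -
    have "D v = D (\<Sum>i\<in>UNIV. v $ i *s axis i 1)"
      using axis_sum_expansion by metis
    also have "\<dots> = (\<Sum>i\<in>UNIV. v $ i * D (axis i 1))"
      by (simp only: D.sum D.scale)
    finally show ?thesis by (simp only: pderiv_fun_def eq)
  qed
  then have "D = (\<lambda>v. \<Sum>i\<in>UNIV. v $ i * pderiv_fun i f z)" by blast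
  with D show ?thesis by simp
qed

lemma entire_funI:
  assumes "\<And>z. (f has_derivative (\<lambda>v. \<Sum>i\<in>UNIV. v $ i * D i z)) (at z)"
  shows "entire_fun f"
  unfolding entire_fun_def
proof (intro allI exI conjI)
  fix z
  show "(f has_derivative (\<lambda>v. \<Sum>i\<in>UNIV. v $ i * D i z)) (at z)" by (rule assms)
  show "Vector_Spaces.linear (*s) (*) (\<lambda>v. \<Sum>i\<in>UNIV. v $ i * D i z)"
    by unfold_locales
       (auto simp: vec_eq_iff algebra_simps sum.distrib sum_distrib_left)
qed

lemma pderiv_fun_eq:
  assumes "(f has_derivative (\<lambda>v. \<Sum>i\<in>UNIV. v $ i * D i)) (at z)"
  shows "pderiv_fun j f z = D j"
proof -
  have "frechet_derivative f (at z) = (\<lambda>v. \<Sum>i\<in>UNIV. v $ i * D i)"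
    using assms frechet_derivative_at by metis
  then show ?thesis
    by (simp add: pderiv_fun_def axis_def if_distrib[where f="\<lambda>x. x * _"] cong: if_cong)
qed

lemma entire_fun_continuous_on: "entire_fun f \<Longrightarrow> continuous_on S f"
  using has_derivative_continuous[OF entire_fun_has_derivative]
  by (blast intro: continuous_at_imp_continuous_on)

lemma entire_fun_const [simp]: "entire_fun (\<lambda>z. c)"
  by (rule entire_funI[where D="\<lambda>_ _. 0"]) simp

lemma has_derivative_vec_nth_expansion:
  "((\<lambda>z::complex^'n. z $ k) has_derivative (\<lambda>v. \<Sum>i\<in>UNIV. v $ i * (if i = k then
      1 else 0))) (at z)"
proof -
  have "((\<lambda>z::complex^'n. z $ k) has_derivative (\<lambda>v. v $ k)) (at z)"
    by (intro bounded_linear_imp_has_derivative bounded_linear_vec_nth)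
  then show ?thesis
    by (simp add: if_distrib[where f="\<lambda>x. _ * x"] cong: if_cong)
qed

lemma entire_fun_nth [simp]: "entire_fun (\<lambda>z. z $ k)"
  by (rule entire_funI) (rule has_derivative_vec_nth_expansion)

lemma has_derivative_add_expansion:
  assumes "entire_fun f" "entire_fun g"
  shows "((\<lambda>z. f z + g z) has_derivative
          (\<lambda>v. \<Sum>i\<in>UNIV. v $ i * (pderiv_fun i f z + pderiv_fun i g z))) (at z)"
  using has_derivative_add[OF assms[THEN entire_fun_has_derivative]]
  by (simp add: algebra_simps sum.distrib)

lemma has_derivative_mult_expansion:
  assumes "entire_fun f" "entire_fun g"
  shows "((\<lambda>z. f z * g z) has_derivative
          (\<lambda>v. \<Sum>i\<in>UNIV. v $ i * (f z * pderiv_fun i g z + pderiv_fun i f z * g z))) (at z)"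
  using has_derivative_mult[OF assms[THEN entire_fun_has_derivative]]
  by (simp add: algebra_simps sum.distrib sum_distrib_left)

lemma entire_fun_add: "entire_fun f \<Longrightarrow> entire_fun g \<Longrightarrow> entire_fun
    (\<lambda>z. f z + g z)"
  by (rule entire_funI, rule has_derivative_add_expansion)

lemma entire_fun_mult: "entire_fun f \<Longrightarrow> entire_fun g \<Longrightarrow> entire_fun
    (\<lambda>z. f z * g z)"
  by (rule entire_funI, rule has_derivative_mult_expansion)

lemma pderiv_fun_add:
  "entire_fun f \<Longrightarrow> entire_fun g \<Longrightarrow>
   pderiv_fun i (\<lambda>z. f z + g z) z = pderiv_fun i f z + pderiv_fun i g z"
  using pderiv_fun_eq[OF has_derivative_add_expansion] .

lemma pderiv_fun_const [simp]: "pderiv_fun i (\<lambda>z. c) z = 0"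
proof -
  have "((\<lambda>z::complex^'a. c) has_derivative (\<lambda>v. \<Sum>i\<in>UNIV. v $ i * (\<lambda>_.
      0) i)) (at z)" by simp
  from pderiv_fun_eq[OF this, of i] show ?thesis by simp
qed

lemma pderiv_fun_nth: "pderiv_fun i (\<lambda>z. z $ k) z = (if i = k then 1 else 0)"
  using pderiv_fun_eq[OF has_derivative_vec_nth_expansion] .

lemma pderiv_fun_cmult:
  assumes "entire_fun f"
  shows "pderiv_fun i (\<lambda>z. c * f z) z = c * pderiv_fun i f z"
  using pderiv_fun_eq[OF has_derivative_mult_expansion[OF entire_fun_const assms], of i c] by simp

lemma entire_fun_sum:
  "(\<And>a. a \<in> A \<Longrightarrow> entire_fun (f a)) \<Longrightarrow> entire_fun (\<lambda>z.
      \<Sum>a\<in>A. f a z)"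
  by (induction A rule: infinite_finite_induct) (auto intro: entire_fun_add)

lemma entire_fun_prod:
  "(\<And>a. a \<in> A \<Longrightarrow> entire_fun (f a)) \<Longrightarrow> entire_fun (\<lambda>z.
      \<Prod>a\<in>A. f a z)"
  by (induction A rule: infinite_finite_induct) (auto intro: entire_fun_mult)

lemma entire_fun_power: "entire_fun f \<Longrightarrow> entire_fun (\<lambda>z. f z ^ n)"
  by (induction n) (auto intro: entire_fun_mult)

lemma pderiv_fun_sum:
  "(\<And>a. a \<in> A \<Longrightarrow> entire_fun (f a)) \<Longrightarrow>
   pderiv_fun i (\<lambda>z. \<Sum>a\<in>A. f a z) z = (\<Sum>a\<in>A. pderiv_fun i (f a) z)"
  by (induction A rule: infinite_finite_induct) (auto simp: pderiv_fun_add entire_fun_sum)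

lemma entire_fun_det:
  fixes M :: "complex^'n \<Rightarrow> complex^'k^'k"
  assumes "\<And>i j. entire_fun (\<lambda>z. M z $ i $ j)"
  shows "entire_fun (\<lambda>z. det (M z))"
  unfolding det_def
  by (intro entire_fun_sum entire_fun_mult entire_fun_const entire_fun_prod assms)

lemma bounded_linear_vector_scale_left: "bounded_linear (\<lambda>s::complex. s *s (b::complex^'n))"
proof -
  have "linear (\<lambda>s::complex. s *s b)"
    by (rule linearI) (auto simp: vec_eq_iff algebra_simps)
  then show ?thesis by (rule linear_conv_bounded_linear[THEN iffD1])
qed

lemma entire_fun_along_curve:
  fixes f :: "complex^'n \<Rightarrow> complex" and \<sigma> :: "complex \<Rightarrow> complex^'n"
  assumes f: "entire_fun f" and \<sigma>: "\<And>i. ((\<lambda>s. \<sigma> s $ i) has_field_derivative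
      \<sigma>' i) (at s)"
  shows "((\<lambda>s. f (\<sigma> s)) has_field_derivative (\<Sum>i\<in>UNIV. \<sigma>' i * pderiv_fun
      i f (\<sigma> s))) (at s)"
proof -
  have "(\<sigma> has_derivative (\<lambda>h. \<chi> i. \<sigma>' i * h)) (at s)"
    using \<sigma> unfolding has_field_derivative_def
    by (subst has_derivative_componentwise_within)
       (auto simp: Basis_vec_def inner_axis intro!: derivative_intros)
  from diff_chain_at[OF this entire_fun_has_derivative[OF f]]
  show ?thesis
    unfolding has_field_derivative_def o_def
    by (rule has_derivative_eq_rhs) (simp add: fun_eq_iff sum_distrib_right sum_distrib_left mult_ac)
qed

lemma entire_fun_along_line:
  assumes f: "entire_fun f"
  shows "((\<lambda>s. f (a + s *s b)) has_field_derivative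
           (\<Sum>i\<in>UNIV. b $ i * pderiv_fun i f (a + s *s b))) (at s)"
  by (rule entire_fun_along_curve[OF f]) (auto intro!: derivative_eq_intros)

lemma entire_fun_along_line_holomorphic:
  "entire_fun f \<Longrightarrow> (\<lambda>s. f (a + s *s b)) holomorphic_on S"
  unfolding holomorphic_on_def field_differentiable_def
  by (blast intro: has_field_derivative_at_within entire_fun_along_line)

lemma pderiv_fun_along_axis:
  assumes "entire_fun f"
  shows "pderiv_fun i f z = deriv (\<lambda>s. f (z + s *s axis i 1)) 0"
  using DERIV_imp_deriv[OF entire_fun_along_line[OF assms, of z "axis i 1" 0]]
  by (simp add: axis_def if_distrib[where f="\<lambda>x. x * _"] cong: if_cong)

section \<open>Cauchy integrals and smoothness of partial derivatives\<close>

definition unit_circle :: "real \<Rightarrow> complex" where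
  "unit_circle t = exp (2 * of_real pi * \<i> * of_real t)"

lemma unit_circle_nonzero [simp]: "unit_circle t \<noteq> 0"
  by (simp add: unit_circle_def)

lemma continuous_on_unit_circle [continuous_intros]:
  "continuous_on S f \<Longrightarrow> continuous_on S (\<lambda>x. unit_circle (f x))"
  unfolding unit_circle_def by (intro continuous_intros)

definition unit_circle_integrand :: "(complex^'n \<Rightarrow> complex) \<Rightarrow> 'n \<Rightarrow>
    complex^'n \<Rightarrow> real \<Rightarrow> complex" where
  "unit_circle_integrand f i z t = f (z + unit_circle t *s axis i 1) / unit_circle t"

text \<open>Cauchy's formula on the unit circle in the \<open>i\<close>-th coordinate line.
  \<open>entire_fun\<close> only grants differentiability at each point; writing a partial
  derivative as a parameter integral of \<open>f\<close> itself is what yields its continuity and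
  then its differentiability.\<close>

lemma pderiv_fun_integral:
  assumes f: "entire_fun f"
  shows "pderiv_fun i f z = integral (cbox 0 1) (unit_circle_integrand f i z)"
proof -
  define h where "h = (\<lambda>s. f (z + s *s axis i 1))"
  have hol: "h holomorphic_on S" for S
    unfolding h_def by (rule entire_fun_along_line_holomorphic[OF f])
  have "((\<lambda>u. h u / (u - 0) ^ Suc 1) has_contour_integral ((2 * pi * \<i>) / (fact 1) * (deriv ^^ 1) h 0))
           (circlepath 0 1)"
    by (rule Cauchy_has_contour_integral_higher_derivative_circlepath)
       (auto intro!: holomorphic_on_imp_continuous_on hol)
  then have "((\<lambda>u. h u / u\<^sup>2) has_contour_integral (2 * pi * \<i> * deriv h 0)) (circlepath 0 1)"
    by (simp add: power2_eq_square)
  then have "((\<lambda>t. h (circlepath 0 1 t) / (circlepath 0 1 t)\<^sup>2 *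
        vector_derivative (circlepath 0 1) (at t within {0..1})) has_integral 2 * pi * \<i> * deriv h 0) {0..1}"
    by (simp add: has_contour_integral_def)
  moreover have circlepath_eq: "circlepath 0 1 t = unit_circle t" for t
    by (simp add: circlepath unit_circle_def mult_ac)
  moreover have "vector_derivative (circlepath 0 1) (at t within {0..1}) = 2 * pi * \<i> * unit_circle t"
    if "t \<in> {0..1}" for t
    using that by (simp add: vector_derivative_circlepath01 unit_circle_def mult_ac)
  ultimately have "((\<lambda>t. h (unit_circle t) / (unit_circle t)\<^sup>2 * (2 * pi * \<i> * unit_circle t))
      has_integral 2 * pi * \<i> * deriv h 0) {0..1}"
    by (metis (no_types, lifting) has_integral_cong)
  then have "((\<lambda>t. 2 * pi * \<i> * unit_circle_integrand f i z t) has_integral 2 * pi * \<i> *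
      deriv h 0) {0..1}"
    by (rule has_integral_eq[rotated])
       (simp add: unit_circle_integrand_def h_def power2_eq_square)
  from has_integral_mult_right[OF this, of "1 / (2 * pi * \<i>)"]
  have "(unit_circle_integrand f i z has_integral deriv h 0) (cbox 0 1)"
    by (simp add: field_simps)
  moreover have "deriv h 0 = pderiv_fun i f z"
    by (simp add: h_def pderiv_fun_along_axis[OF f])
  ultimately show ?thesis by (simp add: integral_unique)
qed

lemma continuous_on_shifted_circle:
  assumes "continuous_on UNIV f"
  shows "continuous_on T (\<lambda>p. f (fst p + unit_circle (snd p) *s axis i (1::complex)))"
proof -

  have "continuous_on T (\<lambda>p. fst p + unit_circle (snd p) *s axis i (1::complex))"
    by (intro continuous_intros bounded_linear.continuous_on[OF bounded_linear_vector_scale_left])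
  then show ?thesis
    by (rule continuous_on_compose2[OF assms]) auto
qed

lemma pderiv_fun_continuous_on:
  assumes f: "entire_fun f"
  shows "continuous_on S (pderiv_fun i f)"
proof -
  have "continuous_on UNIV (\<lambda>z. integral (cbox 0 1) (unit_circle_integrand f i z))"
  proof (rule integral_continuous_on_param)
    show "continuous_on (UNIV \<times> cbox 0 1) (\<lambda>(z, t). unit_circle_integrand f i z t)"
      unfolding unit_circle_integrand_def case_prod_beta
      by (intro continuous_intros continuous_on_shifted_circle entire_fun_continuous_on f) auto
  qed
  then show ?thesis
    unfolding pderiv_fun_integral[OF f, symmetric] by (rule continuous_on_subset) simp
qed

text \<open>Differentiation under the integral sign. The Leibniz rule asks for a jointly continuous
  derivative of the integrand, so continuity of the partial derivatives has to come beforehand.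
  Complex linearity survives because the derivative is kept as a combination of the coordinates
  \<open>v $ j\<close>.\<close>

lemma entire_fun_pderiv_fun:
  assumes f: "entire_fun f"
  shows "entire_fun (pderiv_fun i f)"
proof -
  define c where "c j z t = pderiv_fun j f (z + unit_circle t *s axis i 1) / unit_circle t"
    for j z t
  define P where "P j = Blinfun (\<lambda>v::complex^'a. v $ j)" for j
  have P: "blinfun_apply (P j) = (\<lambda>v. v $ j)" for j
    unfolding P_def by (simp add: bounded_linear_Blinfun_apply bounded_linear_vec_nth)
  \<comment> \<open>Assembled from scalar coefficients, so that continuity in operator norm reduces
    to continuity of each \<open>c j\<close>.\<close>
  define fx where "fx z t = (\<Sum>j\<in>UNIV. blinfun_mult_right (c j z t) o\<^sub>L P j)" for z and t :: real
  have fx: "blinfun_apply (fx z t) = (\<lambda>v. \<Sum>j\<in>UNIV. v $ j * c j z t)" for z t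
    by (auto simp: fx_def P blinfun.sum_left mult.commute)
  have der: "((\<lambda>z. unit_circle_integrand f i z t) has_derivative blinfun_apply (fx z t)) (at z)" for z t
  proof -
    have "((\<lambda>z. z + unit_circle t *s axis i 1) has_derivative (\<lambda>v. v)) (at z)"
      by (auto intro!: derivative_eq_intros)
    from diff_chain_at[OF this entire_fun_has_derivative[OF f]]
    have "((\<lambda>z. f (z + unit_circle t *s axis i 1)) has_derivative
       (\<lambda>v. \<Sum>j\<in>UNIV. v $ j * pderiv_fun j f (z + unit_circle t *s axis i 1))) (at z)"
      by (simp add: o_def)
    from has_derivative_mult_left[OF this, of "1 / unit_circle t"]
    show ?thesis
      unfolding fx unit_circle_integrand_def c_def
      by (simp add: sum_distrib_right sum_divide_distrib)
  qed
  have contc: "continuous_on T (\<lambda>p. c j (fst p) (snd p))" for j T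
    unfolding c_def
    by (intro continuous_intros continuous_on_shifted_circle pderiv_fun_continuous_on f) auto
  have cont: "continuous_on (UNIV \<times> cbox 0 1) (\<lambda>(z, t). fx z t)"
    unfolding fx_def case_prod_beta
    by (intro continuous_intros bounded_linear.continuous_on[OF bounded_linear_blinfun_mult_right] contc)
  have int: "unit_circle_integrand f i z integrable_on cbox 0 1" for z
    unfolding unit_circle_integrand_def
    by (intro integrable_continuous continuous_intros
         continuous_on_compose2[OF continuous_on_shifted_circle[OF entire_fun_continuous_on[OF f], of
             UNIV i], of _ "\<lambda>t. (z, t)", simplified]) auto
  have intb: "fx z integrable_on cbox 0 1" for z
    by (intro integrable_continuous continuous_on_compose2[OF cont, of _ "\<lambda>t. (z, t)",
        simplified] continuous_intros) auto
  have intc: "c j z integrable_on cbox 0 1" for j z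
    by (intro integrable_continuous continuous_on_compose2[OF contc[of UNIV], of _ "\<lambda>t. (z, t)",
        simplified] continuous_intros)
  have D: "((\<lambda>z. integral (cbox 0 1) (unit_circle_integrand f i z)) has_derivative
           blinfun_apply (integral (cbox 0 1) (fx z))) (at z)" for z
    using leibniz_rule[of UNIV 0 1 "unit_circle_integrand f i" fx z] der cont int by simp
  have "blinfun_apply (integral (cbox 0 1) (fx z)) = (\<lambda>v. \<Sum>j\<in>UNIV. v $ j * integral
      (cbox 0 1) (c j z))" for z
  proof
    fix v
    have "blinfun_apply (integral (cbox 0 1) (fx z)) v = integral (cbox 0 1) (\<lambda>t. blinfun_apply
        (fx z t) v)"
      using blinfun_apply_integral[OF intb] by metis
    also have "\<dots> = (\<Sum>j\<in>UNIV. v $ j * integral (cbox 0 1) (c j z))"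
      unfolding fx using intc by (simp add: integral_sum integrable_on_mult_right)
    finally show "blinfun_apply (integral (cbox 0 1) (fx z)) v = (\<Sum>j\<in>UNIV. v $ j * integral
        (cbox 0 1) (c j z))" .
  qed
  with D have "((\<lambda>z. integral (cbox 0 1) (unit_circle_integrand f i z)) has_derivative
           (\<lambda>v. \<Sum>j\<in>UNIV. v $ j * integral (cbox 0 1) (c j z))) (at z)" for z
    by metis
  then show ?thesis
    using pderiv_fun_integral[OF f] by (intro entire_funI[where D="\<lambda>j z. integral (cbox 0 1) (c
        j z)"]) presburger
qed

text \<open>On the complex line through \<open>z\<close> and \<open>a\<close> the restriction is
  holomorphic and nonzero at parameter 1, so a zero at parameter 0 is isolated on that line. Closed
  conditions that hold off a zero set spread to the whole space in this way.\<close>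

lemma entire_fun_nonzero_dense:
  assumes f: "entire_fun f" and "f a \<noteq> 0"
  shows "closure {z. f z \<noteq> 0} = UNIV"
proof -
  have "z \<in> closure {z. f z \<noteq> 0}" for z
  proof (cases "f z = 0")
    case True
    define h where "h = (\<lambda>s. f (z + s *s (a - z)))"
    have h: "h holomorphic_on UNIV"
      unfolding h_def by (rule entire_fun_along_line_holomorphic[OF f])
    have h0: "h 0 = 0" "h 1 \<noteq> 0" using True assms by (auto simp: h_def)
    obtain r where r: "r > 0" "\<And>s. s \<in> ball 0 r - {0} \<Longrightarrow> h s \<noteq> 0"
      by (rule isolated_zeros[OF h, of 0 1]) (use h0 in \<open>auto simp: connected_UNIV\<close>)
    show ?thesis
    proof (rule closure_approachable[THEN iffD2], intro allI impI)
      fix e :: real assume "e > 0"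
      have "((\<lambda>s. z + s *s (a - z)) \<longlongrightarrow> z + 0 *s (a - z)) (at 0)"
        using bounded_linear_vector_scale_left
        by (intro tendsto_intros bounded_linear.tendsto[OF bounded_linear_vector_scale_left])
      then have "\<forall>\<^sub>F s in at 0. dist (z + s *s (a - z)) z < e"
        using \<open>e > 0\<close> tendstoD by fastforce
      moreover have "\<forall>\<^sub>F s in at 0. s \<in> ball 0 r - {0}"
        using r(1) by (intro eventually_at_in_open) auto
      ultimately have "\<forall>\<^sub>F s in at (0::complex). dist (z + s *s (a - z)) z < e \<and> h s \<noteq> 0"
        by eventually_elim (use r in auto)
      then show "\<exists>y\<in>{z. f z \<noteq> 0}. dist y z < e"
        by (auto simp: h_def dest!: eventually_happens)
    qed
  next
    case False
    then show ?thesis using closure_subset[of "{z. f z \<noteq> 0}"] by blast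
  qed
  then show ?thesis by blast
qed

section \<open>Polynomials and interpolation on grids\<close>

text \<open>Gaussian elimination on the equations. Both dimension counts use it in this form, with
  arbitrary index types for unknowns and equations.\<close>

lemma homogeneous_system_nontrivial:
  fixes a :: "'i \<Rightarrow> 'j \<Rightarrow> complex"
  assumes "finite J" "finite I" "card J < card I"
  shows "\<exists>c. (\<exists>i\<in>I. c i \<noteq> 0) \<and> (\<forall>j\<in>J. (\<Sum>i\<in>I. c i *
      a i j) = 0)"
  using assms
proof (induction J arbitrary: I a rule: finite_induct)
  case empty
  then have "I \<noteq> {}" by auto
  then show ?case by (auto intro!: exI[of _ "\<lambda>_. 1"])
next
  case (insert j J)
  show ?case
  proof (cases "\<forall>i\<in>I. a i j = 0")
    case True
    obtain c where "\<exists>i\<in>I. c i \<noteq> 0" "\<forall>j\<in>J. (\<Sum>i\<in>I. c i * a i j) = 0"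
      using insert.IH[of I a] insert.hyps insert.prems by auto
    with True show ?thesis by (intro exI[of _ c]) auto
  next
    case False
    then obtain i0 where i0: "i0 \<in> I" "a i0 j \<noteq> 0" by blast
    \<comment> \<open>The pivot unknown \<open>i0\<close> is eliminated by means of equation
      \<open>j\<close>; its value is recovered in \<open>c\<close>.\<close>
    define a' where "a' i l = a i l - a i j / a i0 j * a i0 l" for i l
    obtain c' where c': "\<exists>i\<in>I - {i0}. c' i \<noteq> 0" "\<And>l. l \<in> J \<Longrightarrow>
        (\<Sum>i\<in>I - {i0}. c' i * a' i l) = 0"
    proof -
      have "card J < card (I - {i0})"
        using insert.hyps insert.prems i0 by (simp add: card_Diff_singleton)
      from insert.IH[OF _ this, of a'] insert.prems(1) show ?thesis using that by auto
    qed
    define c where "c = c'(i0 := - (\<Sum>i\<in>I - {i0}. c' i * (a i j / a i0 j)))"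
    have split: "(\<Sum>i\<in>I. c i * a i l) = c i0 * a i0 l + (\<Sum>i\<in>I - {i0}. c' i * a i l)" for l
      using insert.prems i0 by (subst sum.remove[of _ i0]) (auto simp: c_def intro!: sum.cong)
    have "(\<Sum>i\<in>I. c i * a i l) = (\<Sum>i\<in>I - {i0}. c' i * a' i l)" for l
      unfolding split
      by (simp add: c_def a'_def sum_distrib_right sum_distrib_left right_diff_distrib sum_subtractf mult_ac)
    moreover have "(\<Sum>i\<in>I - {i0}. c' i * a' i j) = 0"
      using i0 by (simp add: a'_def)
    ultimately have "\<forall>l\<in>insert j J. (\<Sum>i\<in>I. c i * a i l) = 0"
      using c'(2) by auto
    moreover have "\<exists>i\<in>I. c i \<noteq> 0"
      using c'(1) by (auto simp: c_def)
    ultimately show ?thesis by blast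
  qed
qed

text \<open>With all variables but one fixed, the sum is a polynomial in that variable whose
  coefficients are sums of the same kind over fewer variables. Exponents are told apart by their
  values on \<open>S\<close> alone; this generality serves the dehomogenised leading forms, where
  one variable has been set to 1.\<close>

lemma monomials_independent:
  fixes c :: "('n::finite \<Rightarrow> nat) \<Rightarrow> complex"
  assumes "finite S" "finite B"
    and "\<And>\<beta> \<gamma>. \<beta> \<in> B \<Longrightarrow> \<gamma> \<in> B \<Longrightarrow>
        (\<forall>i\<in>S. \<beta> i = \<gamma> i) \<Longrightarrow> \<beta> = \<gamma>"
    and "\<And>x::complex^'n. (\<Sum>\<beta>\<in>B. c \<beta> * (\<Prod>i\<in>S. x $ i ^ \<beta> i)) = 0"
    and "\<beta> \<in> B"
  shows "c \<beta> = 0"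
  using assms
proof (induction S arbitrary: B rule: finite_induct)
  case empty
  then have "B = {\<beta>}" by auto
  with empty.prems(3) show ?case by auto
next
  case (insert i S)
  define B' where "B' = {\<gamma> \<in> B. \<gamma> i = \<beta> i}"
  show ?case
  proof (rule insert.IH)
    show "finite B'" "\<beta> \<in> B'" using insert.prems by (auto simp: B'_def)
    show "\<gamma> = \<delta>" if "\<gamma> \<in> B'" "\<delta> \<in> B'" "\<forall>i\<in>S. \<gamma> i
        = \<delta> i" for \<gamma> \<delta>
      using that insert.prems(2)[of \<gamma> \<delta>] by (auto simp: B'_def)
    fix x :: "complex^'n"
    define m where "m \<gamma> = c \<gamma> * (\<Prod>i\<in>S. x $ i ^ \<gamma> i)" for \<gamma>
    define P where "P = (\<Sum>\<gamma>\<in>B. monom (m \<gamma>) (\<gamma> i))"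
    have "poly P s = 0" for s
    proof -
      define y :: "complex^'n" where "y = (\<chi> j. if j = i then s else x $ j)"
      have "poly P s = (\<Sum>\<gamma>\<in>B. m \<gamma> * s ^ \<gamma> i)"
        by (simp add: P_def poly_sum poly_monom)
      also have "\<dots> = (\<Sum>\<gamma>\<in>B. c \<gamma> * (\<Prod>j\<in>insert i S. y $ j ^ \<gamma> j))"
      proof (intro sum.cong refl)
        fix \<gamma>
        have "(\<Prod>j\<in>S. y $ j ^ \<gamma> j) = (\<Prod>j\<in>S. x $ j ^ \<gamma> j)"
          using insert.hyps by (intro prod.cong) (auto simp: y_def)
        then show "m \<gamma> * s ^ \<gamma> i = c \<gamma> * (\<Prod>j\<in>insert i S. y $ j ^ \<gamma> j)"
          using insert.hyps by (simp add: m_def y_def)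
      qed
      also have "\<dots> = 0" by (rule insert.prems)
      finally show ?thesis .
    qed
    then have "coeff P (\<beta> i) = 0"
      by (metis coeff_0 poly_all_0_iff_0)
    then have "(\<Sum>\<gamma>\<in>B. if \<gamma> i = \<beta> i then m \<gamma> else 0) = 0"
      by (simp add: P_def coeff_sum)
    then show "(\<Sum>\<gamma>\<in>B'. c \<gamma> * (\<Prod>i\<in>S. x $ i ^ \<gamma> i)) = 0"
      using insert.prems(1) unfolding B'_def m_def by (simp only: sum.inter_filter)
  qed
qed

definition upd_coord :: "complex^'n \<Rightarrow> 'n \<Rightarrow> complex \<Rightarrow> complex^'n" where
  "upd_coord z i s = (\<chi> j. if j = i then s else z $ j)"

lemma upd_coord_self [simp]: "upd_coord z i (z $ i) = z"
  by (auto simp: upd_coord_def vec_eq_iff)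

text \<open>Degrees are bounded on each coordinate line separately: such bounds add under products,
  and the values on a grid with \<open>k + 1\<close> nodes in each coordinate then determine the
  function.\<close>

definition coordwise_poly :: "nat \<Rightarrow> (complex^'n \<Rightarrow> complex) \<Rightarrow> bool" where
  "coordwise_poly k f \<longleftrightarrow> (\<forall>z i. \<exists>p. degree p \<le> k \<and>
      (\<forall>s. f (upd_coord z i s) = poly p s))"

lemma coordwise_poly_mono: "coordwise_poly k f \<Longrightarrow> k \<le> l \<Longrightarrow> coordwise_poly l f"
  unfolding coordwise_poly_def by (meson order_trans)

lemma coordwise_poly_const [simp]: "coordwise_poly k (\<lambda>z. c)"
  unfolding coordwise_poly_def by (intro allI exI[of _ "[:c:]"]) auto

lemma coordwise_poly_nth: "coordwise_poly 1 (\<lambda>z. z $ j)"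
  unfolding coordwise_poly_def
proof (intro allI)
  fix z :: "complex^'a" and i
  show "\<exists>p. degree p \<le> 1 \<and> (\<forall>s. upd_coord z i s $ j = poly p s)"
    by (cases "i = j") (auto simp: upd_coord_def intro: exI[of _ "[:0, 1:]"] exI[of _ "[:z $ j:]"])
qed

lemma coordwise_poly_add:
  assumes "coordwise_poly k f" "coordwise_poly k g"
  shows "coordwise_poly k (\<lambda>z. f z + g z)"
  unfolding coordwise_poly_def
proof (intro allI)
  fix z i
  obtain p q where "degree p \<le> k" "\<forall>s. f (upd_coord z i s) = poly p s"
    "degree q \<le> k" "\<forall>s. g (upd_coord z i s) = poly q s"
    using assms unfolding coordwise_poly_def by meson
  then show "\<exists>p. degree p \<le> k \<and> (\<forall>s. f (upd_coord z i s) + g (upd_coord z i s)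
      = poly p s)"
    by (intro exI[of _ "p + q"]) (auto intro: degree_add_le)
qed

lemma coordwise_poly_mult:
  assumes "coordwise_poly k f" "coordwise_poly l g"
  shows "coordwise_poly (k + l) (\<lambda>z. f z * g z)"
  unfolding coordwise_poly_def
proof (intro allI)
  fix z i
  obtain p q where "degree p \<le> k" "\<forall>s. f (upd_coord z i s) = poly p s"
    "degree q \<le> l" "\<forall>s. g (upd_coord z i s) = poly q s"
    using assms unfolding coordwise_poly_def by meson
  then show "\<exists>p. degree p \<le> k + l \<and> (\<forall>s. f (upd_coord z i s) * g (upd_coord z i
      s) = poly p s)"
    by (intro exI[of _ "p * q"]) (auto intro: order_trans[OF degree_mult_le])
qed

lemma coordwise_poly_sum:
  "(\<And>a. a \<in> A \<Longrightarrow> coordwise_poly k (f a)) \<Longrightarrow> coordwise_poly k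
      (\<lambda>z. \<Sum>a\<in>A. f a z)"
  by (induction A rule: infinite_finite_induct) (auto intro: coordwise_poly_add)

lemma coordwise_poly_power: "coordwise_poly k f \<Longrightarrow> coordwise_poly (n * k) (\<lambda>z. f z ^ n)"
  by (induction n) (auto intro: coordwise_poly_mult)

lemma coordwise_poly_prod:
  "finite A \<Longrightarrow> (\<And>a. a \<in> A \<Longrightarrow> coordwise_poly (k a) (f a)) \<Longrightarrow>
   coordwise_poly (\<Sum>a\<in>A. k a) (\<lambda>z. \<Prod>a\<in>A. f a z)"
  by (induction A rule: finite_induct) (auto intro: coordwise_poly_mult)

definition lagrange_basis :: "nat \<Rightarrow> nat \<Rightarrow> complex \<Rightarrow> complex" where
  "lagrange_basis k l s = (\<Prod>j\<in>{..k} - {l}. (s - of_nat j) / (of_nat l - of_nat j))"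

text \<open>The difference of \<open>p\<close> and its interpolant has degree at most
  \<open>k\<close> and \<open>k + 1\<close> roots.\<close>

lemma lagrange_interpolation:
  assumes "degree p \<le> k"
  shows "poly p s = (\<Sum>l\<le>k. lagrange_basis k l s * poly p (of_nat l))"
proof -
  define b :: "nat \<Rightarrow> complex poly" where
    "b l = (\<Prod>j\<in>{..k} - {l}. smult (1 / (of_nat l - of_nat j)) [:- of_nat j, 1:])" for l
  define q where "q = (\<Sum>l\<le>k. smult (poly p (of_nat l)) (b l))"
  have b: "poly (b l) s = lagrange_basis k l s" for l s
    by (simp add: b_def lagrange_basis_def poly_prod diff_divide_distrib)
  have "degree (b l) \<le> k" if "l \<le> k" for l
  proof -
    have "degree (b l) \<le> (\<Sum>j\<in>{..k} - {l}. degree (smult (1 / (of_nat l - of_nat j)) [:-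
        of_nat j, 1::complex:]))"
      using degree_prod_sum_le[of "{..k} - {l}" "\<lambda>j. smult (1 / (of_nat l - of_nat j)) [:-
          of_nat j, 1::complex:]"]
      unfolding b_def o_def by (simp del: degree_smult_eq)
    also have "\<dots> \<le> (\<Sum>j\<in>{..k} - {l}. 1)"
      by (intro sum_mono) (auto intro: order_trans[OF degree_smult_le])
    also have "\<dots> = k" using that by (simp add: card_Diff_singleton)
    finally show ?thesis .
  qed
  then have dq: "degree q \<le> k"
    unfolding q_def by (intro degree_sum_le) (auto intro: order_trans[OF degree_smult_le])
  have kron: "lagrange_basis k l (of_nat m) = (if l = m then 1 else 0)" if "l \<le> k" "m \<le> k" for l m
  proof (cases "l = m")
    case True
    then show ?thesis by (auto simp: lagrange_basis_def intro!: prod.neutral)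
  next
    case False
    then have "m \<in> {..k} - {l}" using that by auto
    then show ?thesis using False by (auto simp: lagrange_basis_def intro!: prod_zero)
  qed
  have "p = q"
  proof (rule ccontr)
    assume "p \<noteq> q"
    then have "p - q \<noteq> 0" by simp
    have "poly (p - q) (of_nat m) = 0" if "m \<le> k" for m
    proof -
      have "(\<Sum>l\<le>k. poly p (of_nat l) * lagrange_basis k l (of_nat m)) = (\<Sum>l\<le>k. if l =
          m then poly p (of_nat m) else 0)"
        using that by (intro sum.cong) (auto simp: kron)
      then show ?thesis using that by (simp add: q_def poly_sum b)
    qed
    then have "of_nat ` {..k} \<subseteq> {x. poly (p - q) x = 0}" by auto
    moreover have "card (of_nat ` {..k} :: complex set) = Suc k"
      by (subst card_image) (auto simp: inj_on_def)
    ultimately have "Suc k \<le> card {x. poly (p - q) x = 0}"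
      by (metis card_mono poly_roots_finite[OF \<open>p - q \<noteq> 0\<close>])
    also have "\<dots> \<le> degree (p - q)" by (rule card_poly_roots_bound[OF \<open>p - q \<noteq> 0\<close>])
    also have "\<dots> \<le> k" using assms dq by (rule degree_diff_le)
    finally show False by simp
  qed
  then have "poly p s = (\<Sum>l\<le>k. poly (smult (poly p (of_nat l)) (b l)) s)"
    by (metis q_def poly_sum)
  then show ?thesis by (simp add: b mult.commute)
qed

text \<open>At a given point the equation involves only finitely many values of \<open>f\<close>, so
  for continuous \<open>f\<close> it is a closed condition and extends from a dense set. The
  existential form of \<open>coordwise_poly\<close> does not show this directly.\<close>

definition coord_interp :: "nat \<Rightarrow> (complex^'n \<Rightarrow> complex) \<Rightarrow> bool" where
  "coord_interp k f \<longleftrightarrow>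
     (\<forall>z i. f z = (\<Sum>l\<le>k. lagrange_basis k l (z $ i) * f (upd_coord z i (of_nat l))))"

lemma coordwise_poly_imp_interp:
  assumes "coordwise_poly k f"
  shows "coord_interp k f"
  unfolding coord_interp_def
proof (intro allI)
  fix z i
  obtain p where p: "degree p \<le> k" "\<And>s. f (upd_coord z i s) = poly p s"
    using assms unfolding coordwise_poly_def by meson
  show "f z = (\<Sum>l\<le>k. lagrange_basis k l (z $ i) * f (upd_coord z i (of_nat l)))"
    using lagrange_interpolation[OF p(1), of "z $ i"] by (simp flip: p(2))
qed

definition grid_upd :: "'n::finite set \<Rightarrow> ('n \<Rightarrow> nat) \<Rightarrow> complex^'n
    \<Rightarrow> complex^'n" where
  "grid_upd S \<nu> z = (\<chi> j. if j \<in> S then of_nat (\<nu> j) else z $ j)"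

text \<open>One coordinate after another is interpolated; \<open>S\<close> collects those already
  moved to grid nodes.\<close>

lemma grid_interpolation:
  assumes f: "coord_interp k f" and "finite S"
  shows "f z = (\<Sum>\<nu>\<in>S \<rightarrow>\<^sub>E {..k}. (\<Prod>i\<in>S. lagrange_basis k (\<nu>
      i) (z $ i)) * f (grid_upd S \<nu> z))"
  using \<open>finite S\<close>
proof (induction S rule: finite_induct)
  case empty
  have "grid_upd {} \<nu> z = z" for \<nu> by (simp add: grid_upd_def)
  then show ?case by simp
next
  case (insert i S)
  have upd: "upd_coord (grid_upd S \<nu> z) i (of_nat l) = grid_upd (insert i S) (\<nu>(i := l)) z" for \<nu> l
    using insert.hyps by (auto simp: upd_coord_def grid_upd_def vec_eq_iff)
  have nth: "grid_upd S \<nu> z $ i = z $ i" for \<nu>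
    using insert.hyps by (simp add: grid_upd_def)
  have "f z = (\<Sum>\<nu>\<in>S \<rightarrow>\<^sub>E {..k}. (\<Prod>i\<in>S. lagrange_basis k (\<nu>
      i) (z $ i)) * f (grid_upd S \<nu> z))"
    by (rule insert.IH)
  also have "\<dots> = (\<Sum>\<nu>\<in>S \<rightarrow>\<^sub>E {..k}. \<Sum>l\<le>k. (\<Prod>i\<in>S.
      lagrange_basis k (\<nu> i) (z $ i)) *
      (lagrange_basis k l (z $ i) * f (grid_upd (insert i S) (\<nu>(i := l)) z)))"
  proof (intro sum.cong refl)
    fix \<nu>
    have "f (grid_upd S \<nu> z) = (\<Sum>l\<le>k. lagrange_basis k l (z $ i) * f (grid_upd (insert i S)
        (\<nu>(i := l)) z))"
      using f[unfolded coord_interp_def, rule_format, of "grid_upd S \<nu> z" i] unfolding upd nth .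
    then show "(\<Prod>i\<in>S. lagrange_basis k (\<nu> i) (z $ i)) * f (grid_upd S \<nu> z) =
      (\<Sum>l\<le>k. (\<Prod>i\<in>S. lagrange_basis k (\<nu> i) (z $ i)) *
      (lagrange_basis k l (z $ i) * f (grid_upd (insert i S) (\<nu>(i := l)) z)))"
      by (simp add: sum_distrib_left)
  qed
  also have "\<dots> = (\<Sum>(l, \<nu>)\<in>{..k} \<times> (S \<rightarrow>\<^sub>E {..k}).
      (\<Prod>i\<in>S. lagrange_basis k (\<nu> i) (z $ i)) *
      (lagrange_basis k l (z $ i) * f (grid_upd (insert i S) (\<nu>(i := l)) z)))"
    by (subst sum.swap) (rule sum.cartesian_product)
  also have "\<dots> = (\<Sum>(l, \<nu>)\<in>{..k} \<times> (S \<rightarrow>\<^sub>E {..k}).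
      (\<Prod>j\<in>insert i S. lagrange_basis k ((\<nu>(i := l)) j) (z $ j)) * f (grid_upd (insert i S)
          (\<nu>(i := l)) z))"
  proof -
    have "(\<Prod>j\<in>S. lagrange_basis k ((\<nu>(i := l)) j) (z $ j)) = (\<Prod>i\<in>S.
        lagrange_basis k (\<nu> i) (z $ i))" for l \<nu>
      using insert.hyps by (intro prod.cong) auto
    then show ?thesis
      using insert.hyps by (intro sum.cong refl) (simp add: case_prod_beta mult_ac del: fun_upd_apply, simp)
  qed
  also have "\<dots> = (\<Sum>\<nu>\<in>insert i S \<rightarrow>\<^sub>E {..k}.
      (\<Prod>j\<in>insert i S. lagrange_basis k (\<nu> j) (z $ j)) * f (grid_upd (insert i S) \<nu> z))"
    unfolding PiE_insert_eq
    by (subst sum.reindex[OF inj_combinator[OF insert.hyps(2)]])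
       (simp only: o_def case_prod_unfold)
  finally show ?case .
qed

definition grid_point :: "('n::finite \<Rightarrow> nat) \<Rightarrow> complex^'n" where
  "grid_point \<nu> = (\<chi> j. of_nat (\<nu> j))"

lemma grid_interpolation_UNIV:
  assumes "coord_interp k f"
  shows "f z = (\<Sum>\<nu>\<in>UNIV \<rightarrow>\<^sub>E {..k}. (\<Prod>i\<in>UNIV. lagrange_basis k
      (\<nu> i) (z $ i)) * f (grid_point \<nu>))"
  using grid_interpolation[OF assms finite, of z UNIV] by (simp add: grid_upd_def grid_point_def)

text \<open>One linear condition per grid point suffices; this fixes the number of equations in both
  dimension counts.\<close>

lemma coordwise_poly_zero_on_grid:
  assumes "coordwise_poly k f" and "\<And>\<nu>. \<nu> \<in> UNIV \<rightarrow>\<^sub>E {..k}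
      \<Longrightarrow> f (grid_point \<nu>) = 0"
  shows "f z = 0"
  using grid_interpolation_UNIV[OF coordwise_poly_imp_interp[OF assms(1)], of z] assms(2) by simp

section \<open>Polynomial functions in terms of grid interpolation\<close>

lemma polynomial_fun_const [simp]: "polynomial_fun (\<lambda>z. c)"
  unfolding polynomial_fun_def by (intro exI[of _ "{\<lambda>_. 0}"] exI[of _ "\<lambda>_. c"]) simp

lemma polynomial_fun_add:
  assumes "polynomial_fun f" "polynomial_fun g"
  shows "polynomial_fun (\<lambda>z. f z + g z)"
proof -
  obtain S c where S: "finite S" "\<And>z. f z = (\<Sum>\<alpha>\<in>S. c \<alpha> * (\<Prod>i\<in>UNIV.
      (z $ i) ^ \<alpha> i))"
    using assms(1) unfolding polynomial_fun_def by blast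
  obtain T d where T: "finite T" "\<And>z. g z = (\<Sum>\<alpha>\<in>T. d \<alpha> * (\<Prod>i\<in>UNIV.
      (z $ i) ^ \<alpha> i))"
    using assms(2) unfolding polynomial_fun_def by blast
  define e where "e \<alpha> = (if \<alpha> \<in> S then c \<alpha> else 0) + (if \<alpha> \<in> T then
      d \<alpha> else 0)" for \<alpha>
  have "f z + g z = (\<Sum>\<alpha>\<in>S \<union> T. e \<alpha> * (\<Prod>i\<in>UNIV. (z $ i) ^
      \<alpha> i))" for z
  proof -
    have "f z = (\<Sum>\<alpha>\<in>S \<union> T. (if \<alpha> \<in> S then c \<alpha> else 0) *
        (\<Prod>i\<in>UNIV. (z $ i) ^ \<alpha> i))"
      unfolding S using S T by (intro sum.mono_neutral_cong_left) auto
    moreover have "g z = (\<Sum>\<alpha>\<in>S \<union> T. (if \<alpha> \<in> T then d \<alpha> else 0)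
        * (\<Prod>i\<in>UNIV. (z $ i) ^ \<alpha> i))"
      unfolding T using S T by (intro sum.mono_neutral_cong_left) auto
    ultimately show ?thesis
      by (simp only: e_def distrib_right sum.distrib)
  qed
  then show ?thesis using S T unfolding polynomial_fun_def by (intro exI[of _ "S \<union> T"] exI[of _ e]) auto
qed

lemma polynomial_fun_sum:
  "(\<And>a. a \<in> A \<Longrightarrow> polynomial_fun (f a)) \<Longrightarrow> polynomial_fun
      (\<lambda>z. \<Sum>a\<in>A. f a z)"
  by (induction A rule: infinite_finite_induct) (auto intro: polynomial_fun_add)

lemma polynomial_fun_monomial: "polynomial_fun (\<lambda>z. c * (\<Prod>i\<in>UNIV. (z $ i) ^ \<alpha> i))"
  unfolding polynomial_fun_def by (intro exI[of _ "{\<alpha>}"] exI[of _ "\<lambda>_. c"]) simp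

lemma polynomial_fun_mult:
  assumes "polynomial_fun f" "polynomial_fun g"
  shows "polynomial_fun (\<lambda>z. f z * g z)"
proof -
  obtain S c where S: "finite S" "\<And>z. f z = (\<Sum>\<alpha>\<in>S. c \<alpha> * (\<Prod>i\<in>UNIV.
      (z $ i) ^ \<alpha> i))"
    using assms(1) unfolding polynomial_fun_def by blast
  obtain T d where T: "finite T" "\<And>z. g z = (\<Sum>\<alpha>\<in>T. d \<alpha> * (\<Prod>i\<in>UNIV.
      (z $ i) ^ \<alpha> i))"
    using assms(2) unfolding polynomial_fun_def by blast
  have "f z * g z = (\<Sum>\<alpha>\<in>S. \<Sum>\<beta>\<in>T. (c \<alpha> * d \<beta>) *
      (\<Prod>i\<in>UNIV. (z $ i) ^ (\<lambda>i. \<alpha> i + \<beta> i) i))" for z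
    unfolding S T sum_product
    by (intro sum.cong refl) (simp add: power_add prod.distrib mult_ac)
  then show ?thesis
    by (simp only:) (intro polynomial_fun_sum polynomial_fun_monomial)
qed

lemma polynomial_fun_prod:
  "(\<And>a. a \<in> A \<Longrightarrow> polynomial_fun (f a)) \<Longrightarrow> polynomial_fun
      (\<lambda>z. \<Prod>a\<in>A. f a z)"
  by (induction A rule: infinite_finite_induct) (auto intro: polynomial_fun_mult)

lemma polynomial_fun_nth: "polynomial_fun (\<lambda>z. z $ j)"
proof -
  have "(\<Prod>i\<in>UNIV. (z $ i) ^ (if i = j then 1 else 0)) = z $ j" for z :: "complex^'a"
    by (simp add: if_distrib[where f="\<lambda>n. _ ^ n"] cong: if_cong)
  then show ?thesis
    using polynomial_fun_monomial[of 1 "\<lambda>i. if i = j then 1 else 0"] by simp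
qed

lemma polynomial_fun_lagrange_basis: "polynomial_fun (\<lambda>z. lagrange_basis k l (z $ i))"
proof -
  have "(s - of_nat j) / (of_nat l - of_nat j) = s * (1 / (of_nat l - of_nat j)) + - of_nat j / (of_nat
      l - of_nat j)"
    for s :: complex and j by (simp add: diff_divide_distrib)
  then show ?thesis
    unfolding lagrange_basis_def
    by (simp only:) (intro polynomial_fun_prod polynomial_fun_add polynomial_fun_mult polynomial_fun_nth
        polynomial_fun_const)
qed

lemma coord_interp_imp_polynomial_fun:
  assumes "coord_interp k f"
  shows "polynomial_fun f"
proof -
  have "polynomial_fun (\<lambda>z. \<Sum>\<nu>\<in>UNIV \<rightarrow>\<^sub>E {..k}.
      (\<Prod>i\<in>UNIV. lagrange_basis k (\<nu> i) (z $ i)) * f (grid_point \<nu>))"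
    by (intro polynomial_fun_sum polynomial_fun_mult polynomial_fun_prod polynomial_fun_lagrange_basis
        polynomial_fun_const)
  then show ?thesis
    by (simp only: grid_interpolation_UNIV[OF assms, symmetric])
qed

lemma polynomial_fun_imp_coordwise_poly:
  assumes "polynomial_fun f"
  obtains k where "coordwise_poly k f"
proof -
  obtain S c where S: "finite S" "\<And>z. f z = (\<Sum>\<alpha>\<in>S. c \<alpha> * (\<Prod>i\<in>UNIV.
      (z $ i) ^ \<alpha> i))"
    using assms unfolding polynomial_fun_def by blast
  \<comment> \<open>A crude bound: the sum of all exponents dominates the degree in any single
    variable.\<close>
  define k where "k = (\<Sum>\<alpha>\<in>S. \<Sum>i\<in>UNIV. \<alpha> i * 1)"
  have "coordwise_poly k (\<lambda>z. c \<alpha> * (\<Prod>i\<in>UNIV. (z $ i) ^ \<alpha> i))" if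
      "\<alpha> \<in> S" for \<alpha>
  proof (rule coordwise_poly_mono)
    show "coordwise_poly (0 + (\<Sum>i\<in>UNIV. \<alpha> i * 1)) (\<lambda>z. c \<alpha> *
        (\<Prod>i\<in>UNIV. (z $ i) ^ \<alpha> i))"
      by (intro coordwise_poly_mult coordwise_poly_prod coordwise_poly_power coordwise_poly_nth) auto
    show "0 + (\<Sum>i\<in>UNIV. \<alpha> i * 1) \<le> k"
      using that S(1) unfolding k_def by (auto intro!: member_le_sum)
  qed
  then have "coordwise_poly k (\<lambda>z. \<Sum>\<alpha>\<in>S. c \<alpha> * (\<Prod>i\<in>UNIV. (z $
      i) ^ \<alpha> i))"
    by (rule coordwise_poly_sum)
  with that show ?thesis by (simp only: S(2)[symmetric])
qed

section \<open>The Bernstein-Walsh inequality for proper entire maps\<close>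

lemma norm_vector_scale: "norm (c *s (x::complex^'n)) = norm c * norm x"
proof -
  have "norm (c *s x) = L2_set (\<lambda>i. norm c * norm (x $ i)) UNIV"
    by (simp add: norm_vec_def norm_mult)
  also have "\<dots> = norm c * norm x"
    unfolding norm_vec_def by (rule L2_set_right_distrib[symmetric]) simp
  finally show ?thesis .
qed

definition jacobian_matrix :: "(complex^'d \<Rightarrow> complex^'d) \<Rightarrow> complex^'d
    \<Rightarrow> complex^'d^'d" where
  "jacobian_matrix \<phi> z = (\<chi> i j. pderiv_fun j (\<lambda>z. \<phi> z $ i) z)"

lemma entire_fun_det_jacobian:
  assumes "entire_map \<phi>"
  shows "entire_fun (\<lambda>z. det (jacobian_matrix \<phi> z))"
  using assms by (intro entire_fun_det) (simp add: jacobian_matrix_def entire_map_def entire_fun_pderiv_fun)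

lemma entire_map_has_derivative:
  fixes \<phi> :: "complex^'d \<Rightarrow> complex^'d"
  assumes "entire_map \<phi>"
  shows "(\<phi> has_derivative (\<lambda>v. jacobian_matrix \<phi> z *v v)) (at z)"
proof (subst has_derivative_componentwise_within, intro ballI)
  fix b :: "complex^'d" assume "b \<in> Basis"
  then obtain i u where b: "b = axis i u" by (auto simp: Basis_vec_def)
  have "((\<lambda>z. \<phi> z $ i) has_derivative (\<lambda>v. (jacobian_matrix \<phi> z *v v) $ i)) (at z)"
    using entire_fun_has_derivative[of "\<lambda>z. \<phi> z $ i" z] assms
    by (simp add: entire_map_def jacobian_matrix_def matrix_vector_mult_def mult.commute)
  then show "((\<lambda>x. \<phi> x \<bullet> b) has_derivative (\<lambda>x. (jacobian_matrix \<phi> z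
      *v x) \<bullet> b)) (at z)"
    unfolding b inner_axis by (auto intro!: derivative_intros)
qed

lemma entire_map_continuous_on: "entire_map (\<phi> :: complex^'d \<Rightarrow> complex^'e)
    \<Longrightarrow> continuous_on S \<phi>"
  unfolding entire_map_def continuous_on_componentwise[of S \<phi>]
  by (auto simp: Basis_vec_def inner_axis intro!: continuous_intros entire_fun_continuous_on)

text \<open>The real inverse function theorem gives a local inverse whose derivative inverts a
  complex linear map and is therefore complex linear. So \<sigma>, a lift of a piece of the complex
  line through 0 and \<open>\<phi> z1\<close>, is holomorphic. The parameter is normalised so that
  \<open>z1\<close> sits at 1 and the norm of \<phi> scales like that of \<open>s\<close>.\<close>

lemma entire_map_local_inverse_disc:
  fixes \<phi> :: "complex^'d \<Rightarrow> complex^'d"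
  assumes \<phi>: "entire_map \<phi>" and det: "det (jacobian_matrix \<phi> z1) \<noteq> 0"
  obtains \<sigma> \<sigma>' r where "r > 0" "\<sigma> 1 = z1" "\<And>s. s \<in> ball 1 r
      \<Longrightarrow> \<phi> (\<sigma> s) = s *s \<phi> z1"
    "\<And>s i. s \<in> ball 1 r \<Longrightarrow> ((\<lambda>s. \<sigma> s $ i) has_field_derivative
        \<sigma>' i s) (at s)"
proof -
  define f' where "f' z = Blinfun (\<lambda>v. jacobian_matrix \<phi> z *v v)" for z
  have f': "blinfun_apply (f' z) = (\<lambda>v. jacobian_matrix \<phi> z *v v)" for z
    unfolding f'_def
    by (rule bounded_linear_Blinfun_apply) (use entire_map_has_derivative[OF \<phi>] in \<open>auto
        simp: has_derivative_def\<close>)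
  have cont: "continuous_on UNIV f'"
  proof (rule continuous_on_blinfun_componentwise)
    fix v :: "complex^'d"
    have "continuous_on UNIV (\<lambda>z. \<Sum>j\<in>UNIV. pderiv_fun j (\<lambda>z. \<phi> z $ i) z *
        v $ j)" for i
      using \<phi> by (intro continuous_intros pderiv_fun_continuous_on) (auto simp: entire_map_def)
    then show "continuous_on UNIV (\<lambda>z. blinfun_apply (f' z) v)"
      unfolding f' matrix_vector_mult_def jacobian_matrix_def
      by (subst continuous_on_componentwise)
        (auto simp: Basis_vec_def inner_axis intro!: continuous_on_inner continuous_on_const)
  qed
  obtain N where N: "N ** jacobian_matrix \<phi> z1 = mat 1"
    using det by (auto simp: invertible_det_nz[symmetric] invertible_def)
  define invf where "invf = Blinfun (\<lambda>v. N *v v)"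
  have blN: "bounded_linear (\<lambda>v. N *v v)"
  proof -
    have "linear (\<lambda>v. N *v v)"
      by (rule linearI)
         (auto simp: vec_eq_iff matrix_vector_mult_def scaleR_sum_right distrib_left sum.distrib)
    then show ?thesis by (rule linear_conv_bounded_linear[THEN iffD1])
  qed
  have inv: "invf o\<^sub>L f' z1 = id_blinfun"
    by (rule blinfun_eqI) (simp add: invf_def bounded_linear_Blinfun_apply[OF blN] f' matrix_vector_mul_assoc N)
  obtain U' V g g' where UV: "open U'" "z1 \<in> U'" "open V" "\<phi> z1 \<in> V" "homeomorphism U' V \<phi> g"
    and g: "\<And>y. y \<in> V \<Longrightarrow> (g has_derivative (g' y)) (at y)"
    and g': "\<And>y. y \<in> V \<Longrightarrow> g' y = inv (blinfun_apply (f'(g y)))"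
    and bij: "\<And>y. y \<in> V \<Longrightarrow> bij (blinfun_apply (f'(g y)))"
    by (rule inverse_function_theorem[of UNIV \<phi> f' z1 invf])
       (use entire_map_has_derivative[OF \<phi>] cont inv f' in auto)
  define \<sigma> where "\<sigma> s = g (s *s \<phi> z1)" for s
  define c where "c s = g' (s *s \<phi> z1) (\<phi> z1)" for s
  have "open ((\<lambda>s. s *s \<phi> z1) -` V)"
    by (intro open_vimage UV bounded_linear.continuous_on[OF bounded_linear_vector_scale_left] continuous_intros)
  moreover have "1 \<in> (\<lambda>s. s *s \<phi> z1) -` V" using UV by simp
  ultimately obtain r where r: "r > 0" "ball 1 r \<subseteq> (\<lambda>s. s *s \<phi> z1) -` V"
    using open_contains_ball by blast
  show ?thesis
  proof (rule that[of r \<sigma> "\<lambda>i s. c s $ i"])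
    show "r > 0" by fact
    show "\<sigma> 1 = z1" using UV by (simp add: \<sigma>_def homeomorphism_def)
    fix s :: complex assume s: "s \<in> ball 1 r"
    then have V: "s *s \<phi> z1 \<in> V" using r by auto
    show "\<phi> (\<sigma> s) = s *s \<phi> z1"
      using UV V by (simp add: \<sigma>_def homeomorphism_def)
    have lin: "g' (s *s \<phi> z1) (h *s w) = h *s g' (s *s \<phi> z1) w" for h w
    proof -
      let ?A = "blinfun_apply (f' (g (s *s \<phi> z1)))"
      have "?A (h *s inv ?A w) = h *s ?A (inv ?A w)"
        by (simp add: f' vec.scale)
      also have "?A (inv ?A w) = w"
        using bij[OF V] by (simp add: bij_is_surj surj_f_inv_f)
      finally have "inv ?A (h *s w) = h *s inv ?A w"
        using bij[OF V] by (metis bij_is_inj inv_f_f)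
      then show ?thesis by (simp add: g'[OF V])
    qed
    have "(\<sigma> has_derivative (\<lambda>h. g' (s *s \<phi> z1) (h *s \<phi> z1))) (at s)"
      unfolding \<sigma>_def
      using diff_chain_at[OF bounded_linear_imp_has_derivative[OF bounded_linear_vector_scale_left] g[OF V]]
      by (simp add: o_def)
    then have "((\<lambda>s. \<sigma> s $ i) has_derivative (\<lambda>h. (h *s c s) $ i)) (at s)" for i
      unfolding lin c_def by (rule bounded_linear.has_derivative[OF bounded_linear_vec_nth])
    then show "((\<lambda>s. \<sigma> s $ i) has_field_derivative c s $ i) (at s)" for i
      unfolding has_field_derivative_def by (simp add: mult_commute_abs)
  qed
qed

lemma proper_preimage_compact:
  assumes "continuous_on UNIV \<phi>" "\<And>z::complex^'d. norm z \<le> C * (1 + norm (\<phi> z ::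
      complex^'d))" "closed T" "bounded T"
  shows "compact (\<phi> -` T)"
proof -
  obtain R where R: "\<And>w. w \<in> T \<Longrightarrow> norm w \<le> R" using \<open>bounded T\<close>
      bounded_iff by blast
  have "norm z \<le> \<bar>C\<bar> * (1 + R)" if "\<phi> z \<in> T" for z
  proof -
    have "norm z \<le> C * (1 + norm (\<phi> z))" by (rule assms)
    also have "\<dots> \<le> \<bar>C\<bar> * (1 + norm (\<phi> z))" by (intro mult_right_mono) auto
    also have "\<dots> \<le> \<bar>C\<bar> * (1 + R)" using R[OF that] by (intro mult_left_mono) auto
    finally show ?thesis .
  qed
  then have "bounded (\<phi> -` T)" by (auto simp: bounded_iff)
  moreover have "closed (\<phi> -` T)" using assms by (intro closed_vimage)
  ultimately show ?thesis by (simp add: compact_eq_bounded_closed)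
qed

text \<open>The exponent exceeds the growth order by one, so that |u| / |\<phi>|^(n+1) tends to 0 at
  infinity and the outer boundary of a large shell cannot carry the maximum.\<close>

lemma bernstein_walsh_regular_point:
  fixes \<phi> :: "complex^'d \<Rightarrow> complex^'d"
  assumes \<phi>: "entire_map \<phi>" and proper: "\<And>z. norm z \<le> C * (1 + norm (\<phi> z))"
    and u: "entire_fun u" and growth: "\<And>z. norm (u z) \<le> B * (1 + norm (\<phi> z)) ^ n"
    and "r > 0" "S \<ge> 0" and S: "\<And>z. norm (\<phi> z) \<le> r \<Longrightarrow> norm (u z) \<le> S"
    and z0: "r \<le> norm (\<phi> z0)" and J0: "det (jacobian_matrix \<phi> z0) \<noteq> 0"
  shows "norm (u z0) \<le> S * (norm (\<phi> z0) / r) ^ (n + 1)"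
proof (rule ccontr)
  assume contra: "\<not> ?thesis"
  define b where "b = n + 1"
  define J where "J z = det (jacobian_matrix \<phi> z)" for z
  define \<tau> where "\<tau> = norm (u z0) / norm (\<phi> z0) ^ b"
  have \<phi>z0: "norm (\<phi> z0) > 0" using z0 \<open>r > 0\<close> by linarith
  have \<tau>S: "S / r ^ b < \<tau>"
    using contra \<phi>z0 \<open>r > 0\<close> by (simp add: \<tau>_def b_def field_simps power_divide
        del: power_Suc)
  have "S / r ^ b \<ge> 0" using \<open>S \<ge> 0\<close> \<open>r > 0\<close> by simp
  with \<tau>S have "\<tau> > 0" by linarith
  have "B \<ge> 0"
  proof (rule ccontr)
    assume "\<not> B \<ge> 0"
    moreover have "(1 + norm (\<phi> 0)) ^ n > 0" by (simp add: add_pos_nonneg)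
    ultimately have "B * (1 + norm (\<phi> 0)) ^ n < 0" by (simp add: mult_neg_pos)
    then show False using growth[of 0] norm_ge_zero[of "u 0"] by linarith
  qed
  \<comment> \<open>Large enough that for |\<phi>| = R the growth bound puts the quotient below B
    2^n / R < \<tau>; the factor 2^n comes from 1 + R \<le> 2 R.\<close>
  define R where "R = 1 + norm (\<phi> z0) + B * 2 ^ n / \<tau>"
  have R: "R \<ge> 1" "R > norm (\<phi> z0)" "B * 2 ^ n / R < \<tau>"
  proof -
    have "B * 2 ^ n / \<tau> \<ge> 0" using \<open>B \<ge> 0\<close> \<open>\<tau> > 0\<close> by simp
    then show 1: "R \<ge> 1" "R > norm (\<phi> z0)" by (auto simp: R_def add_nonneg_nonneg)
    have "B * 2 ^ n / \<tau> < R" using norm_ge_zero[of "\<phi> z0"] unfolding R_def by linarith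
    then show "B * 2 ^ n / R < \<tau>" using 1 \<open>\<tau> > 0\<close> by (simp add: field_simps)
  qed
  define \<tau>' where "\<tau>' = max (S / r ^ b) (B * 2 ^ n / R)"
  have \<tau>': "0 \<le> \<tau>'" "\<tau>' < \<tau>" using \<tau>S R \<open>S / r ^ b \<ge> 0\<close> by
      (auto simp: \<tau>'_def)
  define X where "X = \<phi> -` {w. r \<le> norm w \<and> norm w \<le> R}"
  have cont\<phi>: "continuous_on T \<phi>" for T by (rule entire_map_continuous_on[OF \<phi>])
  have entJ: "entire_fun J" unfolding J_def by (rule entire_fun_det_jacobian[OF \<phi>])
  have "compact X"
    unfolding X_def
  proof (rule proper_preimage_compact[OF cont\<phi> proper])
    have "{w. r \<le> norm w \<and> norm w \<le> R} = cball (0::complex^'d) R - ball 0 r" by (auto simp: dist_norm)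
    then show "closed {w::complex^'d. r \<le> norm w \<and> norm w \<le> R}" "bounded {w::complex^'d. r
        \<le> norm w \<and> norm w \<le> R}"
      by (auto intro: bounded_subset[OF bounded_cball] simp: closed_Diff)
  qed
  have z0X: "z0 \<in> X" using z0 R by (simp add: X_def)
  have nz: "\<phi> z \<noteq> 0" if "z \<in> X" for z using that \<open>r > 0\<close> by (auto simp: X_def)
  obtain Jm where Jm: "Jm > 0" "\<And>z. z \<in> X \<Longrightarrow> norm (J z) \<le> Jm"
  proof -
    have "bounded (J ` X)"
      by (intro compact_imp_bounded compact_continuous_image \<open>compact X\<close>
          entire_fun_continuous_on entJ)
    then show ?thesis using that unfolding bounded_pos by auto
  qed
  obtain p where p: "\<tau>' ^ p * Jm < \<tau> ^ p * norm (J z0)"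
  proof -
    have "norm (J z0) / Jm > 0" using J0 Jm by (simp add: J_def)
    moreover have "\<tau>' / \<tau> < 1" using \<tau>' by simp
    ultimately obtain p where "(\<tau>' / \<tau>) ^ p < norm (J z0) / Jm" using real_arch_pow_inv by blast
    then have "\<tau>' ^ p * Jm < \<tau> ^ p * norm (J z0)"
      using Jm(1) \<open>\<tau> > 0\<close> by (simp add: field_simps power_divide)
    then show ?thesis by (rule that)
  qed
  \<comment> \<open>The factor \<open>|J|\<close> keeps the maximum away from critical points of
      \<open>\<phi>\<close>; as \<open>p\<close> grows its
    influence on the comparison with the boundary disappears.\<close>
  define \<Psi> where "\<Psi> z = norm (u z) ^ p * norm (J z) / norm (\<phi> z) ^ (b * p)" for z
  have cont\<Psi>: "continuous_on X \<Psi>"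
    unfolding \<Psi>_def
    using nz by (intro continuous_intros cont\<phi> entire_fun_continuous_on[OF u]
        entire_fun_continuous_on[OF entJ]) auto
  obtain zm where zm: "zm \<in> X" "\<And>z. z \<in> X \<Longrightarrow> \<Psi> z \<le> \<Psi> zm"
    using continuous_attains_sup[OF \<open>compact X\<close> _ cont\<Psi>] z0X by blast
  \<comment> \<open>Among the maximum points take one with \<open>|\<phi>|\<close> largest: constancy
      along the disc below would
    yield another one with larger \<open>|\<phi>|\<close>.\<close>
  define Y where "Y = X \<inter> \<Psi> -` {\<Psi> zm}"
  have "compact Y"
  proof -
    have "closed Y" unfolding Y_def
      using cont\<Psi> compact_imp_closed[OF \<open>compact X\<close>] by (intro continuous_closed_preimage) auto
    then show ?thesis using \<open>compact X\<close> by (metis Y_def closed_Int_compact inf.right_idem inf_commute)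
  qed
  moreover have "Y \<noteq> {}" using zm by (auto simp: Y_def)
  ultimately obtain z1 where z1: "z1 \<in> Y" "\<And>z. z \<in> Y \<Longrightarrow> norm (\<phi> z)
      \<le> norm (\<phi> z1)"
    using continuous_attains_sup[of Y "\<lambda>z. norm (\<phi> z)"] by (metis continuous_on_norm cont\<phi>)
  have z1X: "z1 \<in> X" and z1max: "\<And>z. z \<in> X \<Longrightarrow> \<Psi> z \<le> \<Psi> z1"
      using z1 zm by (auto simp: Y_def)
  have \<Psi>_alt: "\<Psi> z = (norm (u z) / norm (\<phi> z) ^ b) ^ p * norm (J z)" for z
    by (simp add: \<Psi>_def power_divide power_mult)
  have "\<Psi> z1 \<ge> \<Psi> z0" using z1max z0X by blast
  moreover have "\<Psi> z0 = \<tau> ^ p * norm (J z0)" by (simp add: \<Psi>_alt \<tau>_def)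
  ultimately have big: "\<Psi> z1 > \<tau>' ^ p * Jm" using p by linarith
  have small: "\<Psi> z1 \<le> \<tau>' ^ p * Jm" if "norm (u z1) / norm (\<phi> z1) ^ b \<le> \<tau>'"
    unfolding \<Psi>_alt using that Jm z1X \<tau>' by (intro mult_mono power_mono) auto
  have "norm (\<phi> z1) \<noteq> r"
  proof
    assume eq: "norm (\<phi> z1) = r"
    have "norm (u z1) / norm (\<phi> z1) ^ b \<le> S / r ^ b"
      unfolding eq using S[of z1] eq \<open>r > 0\<close> by (intro divide_right_mono) auto
    also have "\<dots> \<le> \<tau>'" by (simp add: \<tau>'_def)
    finally show False using small big by simp
  qed
  moreover have "norm (\<phi> z1) \<noteq> R"
  proof
    assume eq: "norm (\<phi> z1) = R"
    have "norm (u z1) \<le> B * (1 + R) ^ n" using growth[of z1] eq by simp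
    also have "\<dots> \<le> B * (2 * R) ^ n" using R \<open>B \<ge> 0\<close> by (intro mult_left_mono
        power_mono) auto
    finally have "norm (u z1) / norm (\<phi> z1) ^ b \<le> B * (2 * R) ^ n / R ^ b"
      unfolding eq using R by (intro divide_right_mono) auto
    also have "\<dots> = B * 2 ^ n / R" using R by (simp add: b_def power_mult_distrib)
    also have "\<dots> \<le> \<tau>'" by (simp add: \<tau>'_def)
    finally show False using small big by simp
  qed
  ultimately have z1in: "r < norm (\<phi> z1)" "norm (\<phi> z1) < R" using z1X by (auto simp: X_def)
  have "\<tau>' ^ p * Jm \<ge> 0" using \<tau>' Jm by simp
  with big have "\<Psi> z1 > 0" by linarith
  then have "J z1 \<noteq> 0" by (auto simp: \<Psi>_def)
  then have J1: "det (jacobian_matrix \<phi> z1) \<noteq> 0" by (simp add: J_def)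
  obtain \<sigma> \<sigma>' \<rho> where \<sigma>: "\<rho> > 0" "\<sigma> 1 = z1" "\<And>s. s \<in> ball
      1 \<rho> \<Longrightarrow> \<phi> (\<sigma> s) = s *s \<phi> z1"
    "\<And>s i. s \<in> ball 1 \<rho> \<Longrightarrow> ((\<lambda>s. \<sigma> s $ i)
        has_field_derivative \<sigma>' i s) (at s)"
    by (rule entire_map_local_inverse_disc[OF \<phi> J1]) (rule that)
  define N where "N = norm (\<phi> z1)"
  have "N > 0" using z1in \<open>r > 0\<close> unfolding N_def by linarith
  \<comment> \<open>The disc must stay where \<sigma> is controlled, map into the shell, and avoid
    \<open>s = 0\<close>; the bound 1/2 serves the last purpose.\<close>
  define \<epsilon> where "\<epsilon> = min (min \<rho> (1/2)) (min ((R - N) / N) ((N - r) / N))"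
  have \<epsilon>: "\<epsilon> > 0" "\<epsilon> \<le> \<rho>" "\<epsilon> \<le> 1/2" "(1 + \<epsilon>) *
      N \<le> R" "r \<le> (1 - \<epsilon>) * N"
  proof -
    have "(R - N) / N > 0" "(N - r) / N > 0" using z1in \<open>N > 0\<close> by (auto simp: N_def)
    then show "\<epsilon> > 0" "\<epsilon> \<le> \<rho>" "\<epsilon> \<le> 1/2" using \<sigma>(1)
        unfolding \<epsilon>_def by linarith+
    have "\<epsilon> \<le> (R - N) / N" "\<epsilon> \<le> (N - r) / N" by (auto simp: \<epsilon>_def)
    then have "\<epsilon> * N \<le> R - N" "\<epsilon> * N \<le> N - r"
      using \<open>N > 0\<close> by (simp_all only: pos_le_divide_eq)
    then show "(1 + \<epsilon>) * N \<le> R" "r \<le> (1 - \<epsilon>) * N" by (simp_all add: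
        distrib_right left_diff_distrib)
  qed
  have ns: "1 - \<epsilon> < norm s" "norm s < 1 + \<epsilon>" if "s \<in> ball 1 \<epsilon>" for s :: complex
  proof -
    have "norm (1 - s) < \<epsilon>" using that by (simp add: dist_norm)
    then show "1 - \<epsilon> < norm s" "norm s < 1 + \<epsilon>"
      using norm_triangle_ineq2[of 1 s] norm_triangle_ineq2[of s 1] by (simp_all add: norm_minus_commute)
  qed
  have \<phi>\<sigma>: "norm (\<phi> (\<sigma> s)) = norm s * N" if "s \<in> ball 1 \<epsilon>" for s
    using \<sigma>(3)[of s] that \<epsilon> by (simp add: norm_vector_scale N_def)
  have \<sigma>X: "\<sigma> s \<in> X" if "s \<in> ball 1 \<epsilon>" for s
  proof -
    have "(1 - \<epsilon>) * N \<le> norm s * N" "norm s * N \<le> (1 + \<epsilon>) * N"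
      using ns[OF that] \<open>N > 0\<close> by (auto intro!: mult_right_mono)
    then show ?thesis using \<epsilon> \<phi>\<sigma>[OF that] by (simp add: X_def)
  qed
  \<comment> \<open>Along the disc |\<phi>| equals |s| N, so dividing by a power of \<open>s\<close>
    reproduces the non-holomorphic denominator of \<open>\<Psi>\<close> up to the constant
    \<open>N ^ (b * p)\<close>.\<close>
  define v where "v s = u (\<sigma> s) ^ p * J (\<sigma> s) / s ^ (b * p)" for s
  have s0: "s \<noteq> 0" if "s \<in> ball 1 \<epsilon>" for s :: complex using ns[OF that] \<epsilon> by auto
  have hol: "v holomorphic_on ball 1 \<epsilon>"
  proof -
    have "(\<lambda>s. g (\<sigma> s)) holomorphic_on ball 1 \<epsilon>" if "entire_fun g" for g
    proof (rule holomorphic_onI)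
      fix s assume "s \<in> ball (1::complex) \<epsilon>"
      then have "s \<in> ball 1 \<rho>" using \<epsilon> by auto
      from entire_fun_along_curve[OF that \<sigma>(4)[OF this]]
      show "(\<lambda>s. g (\<sigma> s)) field_differentiable at s within ball 1 \<epsilon>"
        by (metis field_differentiable_at_within field_differentiable_def)
    qed
    then show ?thesis unfolding v_def using u entJ s0 by (intro holomorphic_intros) auto
  qed
  have nv: "norm (v s) = \<Psi> (\<sigma> s) * N ^ (b * p)" if "s \<in> ball 1 \<epsilon>" for s
    using s0[OF that] \<open>N > 0\<close>
    by (simp add: v_def \<Psi>_def \<phi>\<sigma>[OF that] norm_divide norm_mult norm_power power_mult_distrib)
  have "v constant_on ball 1 \<epsilon>"
  proof (rule maximum_modulus_principle[OF hol, of "ball 1 \<epsilon>" 1])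
    fix s :: complex assume s: "s \<in> ball 1 \<epsilon>"
    have 1: "(1::complex) \<in> ball 1 \<epsilon>" using \<epsilon> by simp
    show "norm (v s) \<le> norm (v 1)"
      unfolding nv[OF s] nv[OF 1] \<sigma>(2) using z1max[OF \<sigma>X[OF s]] \<open>N > 0\<close> by
          (intro mult_right_mono) auto
  qed (use \<epsilon> in auto)
  \<comment> \<open>A point further out on the real ray, where |\<phi>| is larger by the factor 1 +
    \<epsilon>/2.\<close>
  moreover define s where "s = complex_of_real (1 + \<epsilon> / 2)"
  moreover have s: "s \<in> ball 1 \<epsilon>"
  proof -
    have "1 - s = - complex_of_real (\<epsilon> / 2)" by (simp add: s_def)
    then have "norm (1 - s) = \<epsilon> / 2" using \<epsilon> by (simp only: norm_minus_cancel norm_of_real)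
    then show ?thesis using \<epsilon> by (simp add: dist_norm)
  qed
  moreover have one: "(1::complex) \<in> ball 1 \<epsilon>" using \<epsilon> by simp
  ultimately have "v s = v 1" unfolding constant_on_def by force
  then have "\<Psi> (\<sigma> s) = \<Psi> z1"
    using nv[OF s] nv[OF one] \<sigma>(2) \<open>N > 0\<close> by simp
  then have "\<sigma> s \<in> Y" using \<sigma>X[OF s] z1 by (auto simp: Y_def)
  then have "norm s * N \<le> N" using z1(2)[of "\<sigma> s"] \<phi>\<sigma>[OF s] by (simp add: N_def)
  moreover have "norm s = 1 + \<epsilon> / 2" using \<epsilon> by (simp only: s_def norm_of_real)
  ultimately show False using \<open>N > 0\<close> \<epsilon> by simp
qed

text \<open>Both sides are continuous, so the estimate extends by density from the points with
  nonzero Jacobian determinant. The maximum with 1 lets one formula cover the region |\<phi>| \<le>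
  r as well.\<close>

lemma bernstein_walsh:
  fixes \<phi> :: "complex^'d \<Rightarrow> complex^'d"
  assumes \<phi>: "entire_map \<phi>" and proper: "\<And>z. norm z \<le> C * (1 + norm (\<phi> z))"
    and J: "det (jacobian_matrix \<phi> a) \<noteq> 0"
    and u: "entire_fun u" and growth: "\<And>z. norm (u z) \<le> B * (1 + norm (\<phi> z)) ^ n"
    and "r > 0" "S \<ge> 0" and S: "\<And>z. norm (\<phi> z) \<le> r \<Longrightarrow> norm (u z) \<le> S"
  shows "norm (u z) \<le> S * (max 1 (norm (\<phi> z) / r)) ^ (n + 1)"
proof -
  define T where "T = {z. norm (u z) \<le> S * (max 1 (norm (\<phi> z) / r)) ^ (n + 1)}"
  have "closed T"
    unfolding T_def
    using \<open>r > 0\<close> by (intro closed_Collect_le continuous_intros entire_fun_continuous_on[OF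
        u] entire_map_continuous_on[OF \<phi>]) auto
  have "z \<in> T" if "det (jacobian_matrix \<phi> z) \<noteq> 0" for z
  proof (cases "norm (\<phi> z) \<le> r")
    case True
    have "norm (u z) \<le> S * 1" using S[OF True] by simp
    also have "\<dots> \<le> S * (max 1 (norm (\<phi> z) / r)) ^ (n + 1)"
      using \<open>S \<ge> 0\<close> by (intro mult_left_mono one_le_power) auto
    finally show ?thesis by (simp add: T_def)
  next
    case False
    have "norm (u z) \<le> S * (norm (\<phi> z) / r) ^ (n + 1)"
      by (rule bernstein_walsh_regular_point[OF \<phi> proper u growth \<open>r > 0\<close> \<open>S
          \<ge> 0\<close> S _ that]) (use False in auto)
    also have "\<dots> \<le> S * (max 1 (norm (\<phi> z) / r)) ^ (n + 1)"
      using \<open>S \<ge> 0\<close> \<open>r > 0\<close> by (intro mult_left_mono power_mono) auto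
    finally show ?thesis by (simp add: T_def)
  qed
  then have "closure {z. det (jacobian_matrix \<phi> z) \<noteq> 0} \<subseteq> T"
    using \<open>closed T\<close> by (intro closure_minimal) auto
  then have "z \<in> T" using entire_fun_nonzero_dense[OF entire_fun_det_jacobian[OF \<phi>] J] by auto
  then show ?thesis by (simp add: T_def)
qed

section \<open>Algebraicity by counting dimensions\<close>

definition dir_deriv :: "complex^'d \<Rightarrow> (complex^'d \<Rightarrow> complex) \<Rightarrow>
    complex^'d \<Rightarrow> complex" where
  "dir_deriv b v z = (\<Sum>i\<in>UNIV. b $ i * pderiv_fun i v z)"

lemma entire_fun_dir_deriv: "entire_fun v \<Longrightarrow> entire_fun (dir_deriv b v)"
  unfolding dir_deriv_def
  by (intro entire_fun_sum entire_fun_mult entire_fun_const entire_fun_pderiv_fun)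

lemma higher_deriv_along_line:
  assumes "entire_fun v"
  shows "(deriv ^^ j) (\<lambda>s. v (a + s *s b)) = (\<lambda>s. (dir_deriv b ^^ j) v (a + s *s b))"
  using assms
proof (induction j arbitrary: v)
  case (Suc j)
  have "deriv (\<lambda>s. v (a + s *s b)) = (\<lambda>s. dir_deriv b v (a + s *s b))"
    unfolding dir_deriv_def using DERIV_imp_deriv[OF entire_fun_along_line[OF Suc.prems]] by blast
  then show ?case
    using Suc.IH[OF entire_fun_dir_deriv[OF Suc.prems]] by (simp only: funpow_Suc_right o_def)
qed simp

lemma dir_deriv_funpow_sum:
  assumes "\<And>a. a \<in> A \<Longrightarrow> entire_fun (v a)"
  shows "(dir_deriv b ^^ j) (\<lambda>z. \<Sum>a\<in>A. c a * v a z) = (\<lambda>z. \<Sum>a\<in>A. c a *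
      (dir_deriv b ^^ j) (v a) z)"
  using assms
proof (induction j arbitrary: v)
  case (Suc j)
  have "dir_deriv b (\<lambda>z. \<Sum>a\<in>A. c a * v a z) = (\<lambda>z. \<Sum>a\<in>A. c a *
      dir_deriv b (v a) z)"
  proof
    fix z
    have "pderiv_fun i (\<lambda>z. \<Sum>a\<in>A. c a * v a z) z = (\<Sum>a\<in>A. c a * pderiv_fun i
        (v a) z)" for i
      using Suc.prems by (subst pderiv_fun_sum) (auto simp: pderiv_fun_cmult intro!: entire_fun_mult)
    then have "dir_deriv b (\<lambda>z. \<Sum>a\<in>A. c a * v a z) z = (\<Sum>i\<in>UNIV.
        \<Sum>a\<in>A. b $ i * (c a * pderiv_fun i (v a) z))"
      by (simp add: dir_deriv_def sum_distrib_left)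
    also have "\<dots> = (\<Sum>a\<in>A. c a * dir_deriv b (v a) z)"
      by (subst sum.swap) (simp add: dir_deriv_def sum_distrib_left mult_ac)
    finally show "dir_deriv b (\<lambda>z. \<Sum>a\<in>A. c a * v a z) z = (\<Sum>a\<in>A. c a *
        dir_deriv b (v a) z)" .
  qed
  then show ?case
    using Suc.IH[of "\<lambda>a. dir_deriv b (v a)"] Suc.prems
    by (simp add: funpow_Suc_right entire_fun_dir_deriv del: funpow.simps)
qed simp

lemma dir_deriv_funpow_Suc:
  assumes "entire_fun v"
  shows "(dir_deriv b ^^ Suc j) v z = (\<Sum>i\<in>UNIV. b $ i * (dir_deriv b ^^ j) (pderiv_fun i v) z)"
proof -
  have "dir_deriv b v = (\<lambda>z. \<Sum>i\<in>UNIV. b $ i * pderiv_fun i v z)"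
    by (simp add: dir_deriv_def fun_eq_iff)
  then show ?thesis
    by (simp only: funpow_Suc_right o_def dir_deriv_funpow_sum[OF entire_fun_pderiv_fun[OF assms]])
qed

text \<open>Each differentiation contributes one factor that is linear in \<open>b\<close>.\<close>

lemma coordwise_poly_dir_deriv:
  assumes "entire_fun v"
  shows "coordwise_poly j (\<lambda>b. (dir_deriv b ^^ j) v a)"
  using assms
proof (induction j arbitrary: v)
  case (Suc j)
  have "coordwise_poly (1 + j) (\<lambda>b. \<Sum>i\<in>UNIV. b $ i * (dir_deriv b ^^ j) (pderiv_fun i v) a)"
    by (intro coordwise_poly_sum coordwise_poly_mult coordwise_poly_nth Suc.IH entire_fun_pderiv_fun Suc.prems)
  then show ?case by (simp add: dir_deriv_funpow_Suc[OF Suc.prems] del: funpow.simps)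
qed simp

lemma dir_deriv_scale:
  assumes "entire_fun v"
  shows "(dir_deriv (c *s b) ^^ j) v a = c ^ j * (dir_deriv b ^^ j) v a"
  using assms
proof (induction j arbitrary: v)
  case (Suc j)
  have "dir_deriv (c *s b) v = (\<lambda>z. \<Sum>a\<in>{()}. c * dir_deriv b v z)"
    by (simp add: dir_deriv_def fun_eq_iff sum_distrib_left mult_ac)
  then have "(dir_deriv (c *s b) ^^ Suc j) v a = (dir_deriv (c *s b) ^^ j) (\<lambda>z.
      \<Sum>a\<in>{()}. c * dir_deriv b v z) a"
    by (simp only: funpow_Suc_right o_def)
  also have "\<dots> = c * (dir_deriv (c *s b) ^^ j) (dir_deriv b v) a"
    by (subst dir_deriv_funpow_sum) (auto intro: entire_fun_dir_deriv Suc.prems)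
  also have "\<dots> = c ^ Suc j * (dir_deriv b ^^ Suc j) v a"
    by (simp add: Suc.IH[OF entire_fun_dir_deriv[OF Suc.prems]] funpow_Suc_right del: funpow.simps)
  finally show ?case .
qed simp

text \<open>
  Summing the homogeneous Taylor terms of all orders up to \<open>m\<close> before evaluating on the grid keeps the
  number of conditions at \<open>(m + 1)\<^sup>d\<close>; imposing them order by order would cost a
      further factor \<open>m\<close>,
  which the dimension count cannot afford.
\<close>

lemma vanishing_order_from_grid:
  assumes u: "entire_fun u"
    and grid: "\<And>\<nu>. \<nu> \<in> UNIV \<rightarrow>\<^sub>E {..m} \<Longrightarrow>
        (\<Sum>j\<le>m. (dir_deriv (grid_point \<nu>) ^^ j) u a) = 0"
    and "j \<le> m"
  shows "(dir_deriv b ^^ j) u a = 0"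
proof -
  have "coordwise_poly m (\<lambda>b. \<Sum>j\<le>m. (dir_deriv b ^^ j) u a)"
    by (rule coordwise_poly_sum) (rule coordwise_poly_mono[OF coordwise_poly_dir_deriv[OF u]], simp)
  from coordwise_poly_zero_on_grid[OF this grid]
  have "(\<Sum>j\<le>m. (dir_deriv (c *s b) ^^ j) u a) = 0" for c by simp
  \<comment> \<open>Scaling the direction by \<open>c\<close> multiplies the term of order
    \<open>j\<close> by \<open>c ^ j\<close>. A polynomial in \<open>c\<close> that vanishes for
    every \<open>c\<close> has zero coefficients, which separates the homogeneous terms
    again.\<close>
  then have "(\<Sum>j\<le>m. (dir_deriv b ^^ j) u a * c ^ j) = 0" for c
    by (simp add: dir_deriv_scale[OF u] mult.commute)
  then have "\<forall>j\<le>m. (dir_deriv b ^^ j) u a = 0"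
    by (subst polyfun_eq_0[symmetric]) simp
  with \<open>j \<le> m\<close> show ?thesis by blast
qed

text \<open>On the line from \<open>a\<close> through \<open>z\<close> the Taylor coefficient of
  order \<open>n\<close> is at most B / 2^n by Cauchy's inequality on radius 2, and those of order
  up to \<open>m\<close> vanish. The geometric tail starting at \<open>m + 1\<close> sums to B /
  2^m.\<close>

lemma schwarz_bound:
  assumes u: "entire_fun u"
    and van: "\<And>b j. j \<le> m \<Longrightarrow> (dir_deriv b ^^ j) u a = 0"
    and B: "\<And>z. z \<in> cball a 2 \<Longrightarrow> norm (u z) \<le> B"
    and z: "z \<in> cball a 1"
  shows "norm (u z) \<le> B / 2 ^ m"
proof -
  define h where "h s = u (a + s *s (z - a))" for s
  have hol: "h holomorphic_on T" for T
    unfolding h_def by (rule entire_fun_along_line_holomorphic[OF u])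
  have hB: "norm (h s) \<le> B" if "norm s \<le> 2" for s
    unfolding h_def
  proof (rule B)
    have "norm s * norm (z - a) \<le> 2 * 1"
      using that z by (intro mult_mono) (auto simp: dist_norm norm_minus_commute)
    then show "a + s *s (z - a) \<in> cball a 2"
      unfolding mem_cball dist_norm by (metis add_diff_cancel_left' mult_1_right norm_minus_commute
          norm_vector_scale)
  qed
  define t where "t n = (deriv ^^ n) h 0 / fact n" for n
  have tB: "norm (t n) \<le> B * (1/2) ^ n" for n
  proof -
    have "norm ((deriv ^^ n) h 0) \<le> fact n * B / 2 ^ n"
      by (rule Cauchy_inequality) (auto intro!: hol holomorphic_on_imp_continuous_on hB)
    then show ?thesis by (simp add: t_def norm_divide field_simps power_divide)
  qed
  have t0: "t n = 0" if "n \<le> m" for n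
  proof -
    have "(deriv ^^ n) h = (\<lambda>s. (dir_deriv (z - a) ^^ n) u (a + s *s (z - a)))"
      unfolding h_def by (rule higher_deriv_along_line[OF u])
    then show ?thesis using van[OF that] by (simp add: t_def)
  qed
  have "(\<lambda>n. (deriv ^^ n) h 0 / fact n * (1 - 0) ^ n) sums h 1"
    by (rule holomorphic_power_series[of h 0 2]) (auto intro: hol)
  then have sums: "t sums h 1" by (simp add: t_def[abs_def])
  then have "(\<lambda>n. t (n + Suc m)) sums (h 1 - (\<Sum>n<Suc m. t n))"
    by (rule sums_split_initial_segment)
  then have s1: "(\<lambda>n. t (n + Suc m)) sums h 1" using t0 by simp
  have s2: "(\<lambda>n. B * (1/2) ^ Suc m * (1/2) ^ n) sums (B * (1/2) ^ Suc m * 2)"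
    using sums_mult[OF geometric_sums[of "1/2::real"], of "B * (1/2) ^ Suc m"] by simp
  have "norm (h 1) \<le> B * (1/2) ^ Suc m * 2"
  proof (rule norm_sums_le[OF s1 s2])
    fix n
    show "norm (t (n + Suc m)) \<le> B * (1/2) ^ Suc m * (1/2) ^ n"
      using tB[of "n + Suc m"] by (simp add: power_add mult_ac)
  qed
  then show ?thesis by (simp add: h_def field_simps power_divide)
qed

text \<open>A combination of monomials in \<open>z\<close> and \<open>f z\<close>, with coefficients
  not all zero, is made to vanish to high order on a net of \<open>K\<close>. Its maximum
  \<open>S\<close> on \<open>K\<close> then satisfies S \<le> S / 2, so that the combination is zero
  as a function, which is the relation sought.\<close>

lemma entire_fun_algebraic_of_proper_bound:
  fixes \<phi> :: "complex^'d \<Rightarrow> complex^'d"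
  assumes \<phi>: "entire_map \<phi>" and proper: "\<And>z. norm z \<le> C * (1 + norm (\<phi> z))"
    and J: "det (jacobian_matrix \<phi> a0) \<noteq> 0"
    and f: "entire_fun f" and fC: "\<And>z. norm (f z) \<le> C * (1 + norm (\<phi> z))"
  obtains k p where "\<exists>\<beta>\<in>UNIV \<rightarrow>\<^sub>E {..k}. \<exists>l\<le>k. p \<beta>
      l \<noteq> 0"
    "\<And>z. (\<Sum>l\<le>k. (\<Sum>\<beta>\<in>UNIV \<rightarrow>\<^sub>E {..k}. p \<beta> l *
        (\<Prod>i\<in>UNIV. z $ i ^ \<beta> i)) * f z ^ l) = 0"
proof -
  define d where "d = CARD('d)"
  have "d \<ge> 1" by (simp add: d_def Suc_le_eq)
  define C' where "C' = max C 1"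
  have C': "C' \<ge> 1" "norm z \<le> C' * (1 + norm (\<phi> z))" "norm (f z) \<le> C' * (1 + norm
      (\<phi> z))" for z
  proof -
    have "C * (1 + norm (\<phi> z)) \<le> C' * (1 + norm (\<phi> z))"
      by (intro mult_right_mono) (auto simp: C'_def)
    with proper[of z] fC[of z] show "norm z \<le> C' * (1 + norm (\<phi> z))" "norm (f z) \<le> C' * (1
        + norm (\<phi> z))"
      by auto
  qed (simp add: C'_def)
  have cont\<phi>: "continuous_on T \<phi>" for T by (rule entire_map_continuous_on[OF \<phi>])
  \<comment> \<open>Puts \<open>0\<close> into the compact set \<open>K\<close>, which is therefore
    nonempty.\<close>
  define r where "r = norm (\<phi> 0) + 1"
  have "r > 0" by (simp add: r_def add_nonneg_pos)
  define K where "K = \<phi> -` cball 0 r"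
  have K: "compact K" unfolding K_def by (rule proper_preimage_compact[OF cont\<phi> proper]) auto
  have K0: "0 \<in> K" by (simp add: K_def r_def)
  obtain A where A: "finite A" "A \<subseteq> K" "K \<subseteq> (\<Union>a\<in>A. ball a 1)"
    using compactE_image[OF K, of K "\<lambda>a. ball a 1"] by (metis UN_I centre_in_ball open_ball
        subsetI zero_less_one)
  \<comment> \<open>Unit balls around the net cover \<open>K\<close>, but Schwarz' lemma needs a
    bound on the doubled balls. The Bernstein-Walsh inequality carries the bound from
    \<open>K\<close> to them at the cost of a factor 2^c0 per degree.\<close>
  define K' where "K' = (\<Union>a\<in>A. cball a 2)"
  have "compact K'" unfolding K'_def using A by (intro compact_UN) auto
  then have "bounded (\<phi> ` K')" by (intro compact_imp_bounded compact_continuous_image cont\<phi>)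
  then obtain R where R: "\<And>z. z \<in> K' \<Longrightarrow> norm (\<phi> z) \<le> R" unfolding
      bounded_iff by auto
  obtain c1 where c1: "R / r < 2 ^ c1" using real_arch_pow[of 2 "R / r"] by auto
  \<comment> \<open>The summand 2 gives \<open>c0 * d\<close> at least the value 2, which pays for
    the step from \<open>Suc m\<close> to \<open>m\<close> and leaves a factor 1/2 at the
    end.\<close>
  define c0 where "c0 = c1 + 2"
  have c0: "max 1 (norm (\<phi> z) / r) \<le> 2 ^ c0" if "z \<in> K'" for z
  proof -
    have "norm (\<phi> z) / r \<le> R / r" using R[OF that] \<open>r > 0\<close> by (intro divide_right_mono) auto
    also have "\<dots> \<le> 2 ^ c1" using c1 by simp
    also have "\<dots> \<le> 2 ^ c0" by (intro power_increasing) (auto simp: c0_def)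
    finally show ?thesis by simp
  qed
  \<comment> \<open>With m + 1 = c (k + 1) there are card A c^d (k+1)^d conditions, and
    \<open>k\<close> equals card A c^d. Hence k (k+1)^d conditions face (k+1)^(d+1) unknowns. The
    factor \<open>d + 1\<close> in \<open>c\<close> matches the growth order n = (d + 1) k.\<close>
  define c where "c = c0 * (d + 1)"
  define k where "k = card A * c ^ d"
  define m where "m = c * (k + 1) - 1"
  have "c \<ge> 1" by (simp add: c_def c0_def)
  then have Sm: "Suc m = c * (k + 1)" by (simp add: m_def)
  define E where "E = (UNIV::'d set) \<rightarrow>\<^sub>E {..k}"
  define e where "e q z = (\<Prod>i\<in>UNIV. z $ i ^ fst q i) * f z ^ snd q" for q z
  have ent_e: "entire_fun (e q)" for q
    unfolding e_def by (intro entire_fun_mult entire_fun_prod entire_fun_power entire_fun_nth f)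
  define I where "I = E \<times> {..k}"
  define Q where "Q = A \<times> ((UNIV::'d set) \<rightarrow>\<^sub>E {..m})"
  have finE: "finite E" by (simp add: E_def finite_PiE)
  have "card Q = card A * (Suc m) ^ d"
    by (simp add: Q_def card_PiE card_cartesian_product d_def)
  also have "\<dots> = k * (k + 1) ^ d" by (simp only: Sm power_mult_distrib k_def mult.assoc)
  also have "\<dots> < (k + 1) * (k + 1) ^ d" by simp
  also have "\<dots> = card I" by (simp add: I_def E_def card_PiE card_cartesian_product d_def)
  finally have card: "card Q < card I" .
  obtain p where p: "\<exists>q\<in>I. p q \<noteq> 0"
    "\<And>a \<nu>. (a, \<nu>) \<in> Q \<Longrightarrow> (\<Sum>q\<in>I. p q * (\<Sum>j\<le>m.
        (dir_deriv (grid_point \<nu>) ^^ j) (e q) a)) = 0"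
    using homogeneous_system_nontrivial[OF _ _ card, of "\<lambda>q (a, \<nu>). \<Sum>j\<le>m.
        (dir_deriv (grid_point \<nu>) ^^ j) (e q) a"]
      A finE by (force simp: Q_def I_def finite_PiE)
  define u where "u z = (\<Sum>q\<in>I. p q * e q z)" for z
  have ent_u: "entire_fun u" unfolding u_def by (intro entire_fun_sum entire_fun_mult ent_e entire_fun_const)
  have van: "(dir_deriv b ^^ j) u a = 0" if "a \<in> A" "j \<le> m" for a b j
  proof (rule vanishing_order_from_grid[OF ent_u _ \<open>j \<le> m\<close>])
    fix \<nu> :: "'d \<Rightarrow> nat" assume "\<nu> \<in> UNIV \<rightarrow>\<^sub>E {..m}"
    then have "(\<Sum>q\<in>I. p q * (\<Sum>j\<le>m. (dir_deriv (grid_point \<nu>) ^^ j) (e q) a)) = 0"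
      using that by (intro p) (simp add: Q_def)
    moreover have "u = (\<lambda>z. \<Sum>q\<in>I. p q * e q z)" by (simp add: u_def fun_eq_iff)
    ultimately show "(\<Sum>j\<le>m. (dir_deriv (grid_point \<nu>) ^^ j) u a) = 0"
      by (simp add: dir_deriv_funpow_sum ent_e sum_distrib_left) (subst sum.swap, simp)
  qed
  define n where "n = (d + 1) * k"
  define B where "B = (\<Sum>q\<in>I. norm (p q)) * C' ^ n"
  have growth: "norm (u z) \<le> B * (1 + norm (\<phi> z)) ^ n" for z
  proof -
    define t where "t = C' * (1 + norm (\<phi> z))"
    have "t \<ge> 1" using C'(1) mult_mono[of 1 C' 1 "1 + norm (\<phi> z)"] by (simp add: t_def)
    have "norm (e q z) \<le> t ^ n" if "q \<in> I" for q
    proof -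
      have le: "fst q i \<le> k" "snd q \<le> k" for i using that by (auto simp: I_def E_def PiE_iff)
      have "norm (e q z) = (\<Prod>i\<in>UNIV. norm (z $ i) ^ fst q i) * norm (f z) ^ snd q"
        by (simp add: e_def norm_mult norm_power flip: prod_norm)
      also have "\<dots> \<le> (\<Prod>i\<in>(UNIV::'d set). t ^ k) * t ^ k"
      proof (intro mult_mono prod_mono conjI)
        fix i
        have "norm (z $ i) \<le> t" using C'(2)[of z] Finite_Cartesian_Product.norm_nth_le[of z i] by
            (simp add: t_def)
        then have "norm (z $ i) ^ fst q i \<le> t ^ fst q i" by (intro power_mono) auto
        also have "\<dots> \<le> t ^ k" using \<open>t \<ge> 1\<close> le by (intro power_increasing) auto
        finally show "norm (z $ i) ^ fst q i \<le> t ^ k" .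
      next
        have "norm (f z) ^ snd q \<le> t ^ snd q" using C'(3)[of z] by (intro power_mono) (auto simp: t_def)
        also have "\<dots> \<le> t ^ k" using \<open>t \<ge> 1\<close> le by (intro power_increasing) auto
        finally show "norm (f z) ^ snd q \<le> t ^ k" .
      qed (use \<open>t \<ge> 1\<close> in \<open>auto intro!: prod_nonneg\<close>)
      also have "\<dots> = t ^ n" by (simp add: n_def d_def power_mult[symmetric] power_add[symmetric]
          algebra_simps)
      finally show ?thesis .
    qed
    then have "norm (u z) \<le> (\<Sum>q\<in>I. norm (p q) * t ^ n)"
      unfolding u_def by (intro order_trans[OF norm_sum] sum_mono) (auto simp: norm_mult intro: mult_left_mono)
    also have "\<dots> = B * (1 + norm (\<phi> z)) ^ n"
      by (simp add: B_def t_def power_mult_distrib sum_distrib_right sum_distrib_left mult_ac)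
    finally show ?thesis .
  qed
  obtain zs where zs: "zs \<in> K" "\<And>z. z \<in> K \<Longrightarrow> norm (u z) \<le> norm (u zs)"
    using continuous_attains_sup[OF K, of "\<lambda>z. norm (u z)"] K0
    by (metis continuous_on_norm empty_iff entire_fun_continuous_on[OF ent_u])
  define S where "S = norm (u zs)"
  have BW: "norm (u z) \<le> S * (max 1 (norm (\<phi> z) / r)) ^ (n + 1)" for z
    by (rule bernstein_walsh[OF \<phi> proper J ent_u growth \<open>r > 0\<close>]) (use zs in
        \<open>auto simp: S_def K_def\<close>)
  have "S \<ge> 0" by (simp add: S_def)
  have bd: "norm (u z) \<le> S * (2 ^ c0) ^ (n + 1)" if "z \<in> K'" for z
    by (rule order_trans[OF BW]) (use c0[OF that] \<open>S \<ge> 0\<close> in \<open>auto intro!: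
        mult_left_mono power_mono simp del: power_Suc\<close>)
  obtain a where a: "a \<in> A" "zs \<in> ball a 1" using A zs by blast
  have "S \<le> S * (2 ^ c0) ^ (n + 1) / 2 ^ m"
    unfolding S_def[of]
  proof (rule schwarz_bound[OF ent_u van[OF a(1)]])
    show "zs \<in> cball a 1" using a by auto
    fix z assume "z \<in> cball a 2"
    then have "z \<in> K'" using a by (auto simp: K'_def)
    then show "norm (u z) \<le> norm (u zs) * (2 ^ c0) ^ (n + 1)" using bd by (simp add: S_def)
  qed
  also have "\<dots> = S * (2 ^ (c0 * (n + 1)) / 2 ^ m)" by (simp only: power_mult times_divide_eq_right)
  also have "\<dots> \<le> S * (1 / 2)"
  proof (rule mult_left_mono)
    have "c0 * (n + 1) + 1 \<le> m"
    proof -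
      have "Suc m = c0 * (n + 1) + c0 * d" by (simp add: Sm c_def n_def algebra_simps)
      moreover have "c0 * d \<ge> 2 * 1" using \<open>d \<ge> 1\<close> by (intro mult_le_mono) (auto simp: c0_def)
      ultimately show ?thesis by linarith
    qed
    then have "(2::real) ^ (c0 * (n + 1) + 1) \<le> 2 ^ m" by (rule power_increasing) simp
    then show "2 ^ (c0 * (n + 1)) / 2 ^ m \<le> (1 / 2 :: real)" by (simp add: field_simps)
  qed (fact \<open>S \<ge> 0\<close>)
  finally have "S = 0" using \<open>S \<ge> 0\<close> by simp
  \<comment> \<open>The Bernstein-Walsh bound is a multiple of \<open>S\<close>, so vanishing on
    \<open>K\<close> propagates to the whole space.\<close>
  then have u0: "u z = 0" for z using BW[of z] by simp
  show ?thesis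
  proof (rule that[of k "\<lambda>\<beta> l. p (\<beta>, l)"])
    show "\<exists>\<beta>\<in>UNIV \<rightarrow>\<^sub>E {..k}. \<exists>l\<le>k. p (\<beta>, l) \<noteq> 0"
      using p(1) by (auto simp: I_def E_def)
    fix z
    have "(\<Sum>l\<le>k. (\<Sum>\<beta>\<in>E. p (\<beta>, l) * (\<Prod>i\<in>UNIV. z $ i ^ \<beta> i))
        * f z ^ l) =
       (\<Sum>l\<le>k. \<Sum>\<beta>\<in>E. p (\<beta>, l) * e (\<beta>, l) z)"
      by (simp add: sum_distrib_left sum_distrib_right e_def mult_ac)
    also have "\<dots> = u z"
      unfolding u_def I_def by (subst sum.swap) (simp add: sum.cartesian_product)
    finally show "(\<Sum>l\<le>k. (\<Sum>\<beta>\<in>UNIV \<rightarrow>\<^sub>E {..k}. p (\<beta>, l) *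
        (\<Prod>i\<in>UNIV. z $ i ^ \<beta> i)) * f z ^ l) = 0"
      using u0 by (simp add: E_def)
  qed
qed

section \<open>Entire algebraic functions\<close>

lemma poly_nonzero_lower_bound:
  fixes q :: "complex poly"
  assumes "q \<noteq> 0"
  obtains c R where "c > 0" "\<And>s. R \<le> norm s \<Longrightarrow> c \<le> norm (poly q s)"
proof (cases q)
  case (pCons a p)
  show ?thesis
  proof (cases "p = 0")
    case True
    with pCons assms show ?thesis by (intro that[of "norm a" 0]) auto
  next
    case False
    from poly_infinity[OF this, of 1 a] obtain R where "\<forall>z. R \<le> norm z \<longrightarrow> 1
        \<le> norm (poly (pCons a p) z)" by blast
    with pCons show ?thesis by (intro that[of 1 R]) auto
  qed
qed

lemma poly_upper_bound:
  fixes q :: "complex poly"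
  assumes "degree q \<le> k" "norm s \<ge> 1"
  shows "norm (poly q s) \<le> (\<Sum>i\<le>degree q. norm (coeff q i)) * norm s ^ k"
proof -
  have "norm (poly q s) \<le> (\<Sum>i\<le>degree q. norm (coeff q i) * norm s ^ i)"
    unfolding poly_altdef by (rule order_trans[OF norm_sum]) (simp add: norm_mult norm_power)
  also have "\<dots> \<le> (\<Sum>i\<le>degree q. norm (coeff q i) * norm s ^ k)"
    using assms by (intro sum_mono mult_left_mono power_increasing) auto
  finally show ?thesis by (simp add: sum_distrib_right)
qed

text \<open>Where |h| > 1, the top coefficient, bounded below near infinity, forces |h| to be at
  most a multiple of |s|^k, and Liouville's theorem applies. The degree bound depends on the
  coefficients of the relation alone, so it is uniform over all coordinate lines.\<close>

lemma algebraic_holomorphic_is_poly: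
  assumes h: "h holomorphic_on UNIV" and deg: "\<And>l. l \<le> r \<Longrightarrow> degree (q l) \<le>
      k" and "q r \<noteq> 0"
    and eq: "\<And>s. (\<Sum>l\<le>r. poly (q l) s * h s ^ l) = 0"
  obtains P where "degree P \<le> k" "\<And>s. h s = poly P s"
proof -
  have "r \<noteq> 0"
  proof
    assume "r = 0"
    then have "poly (q r) s = 0" for s using eq[of s] by simp
    with \<open>q r \<noteq> 0\<close> show False using poly_all_0_iff_0 by blast
  qed
  then obtain r' where r': "r = Suc r'" by (cases r) auto
  obtain c R where c: "c > 0" "\<And>s. R \<le> norm s \<Longrightarrow> c \<le> norm (poly (q r) s)"
    using poly_nonzero_lower_bound[OF \<open>q r \<noteq> 0\<close>] by blast
  define D where "D = (\<Sum>l\<le>r'. \<Sum>i\<le>degree (q l). norm (coeff (q l) i))"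
  have "D \<ge> 0" by (auto simp: D_def intro!: sum_nonneg)
  have bound: "norm (h s) \<le> (1 + D / c) * norm s ^ k" if s: "max 1 R \<le> norm s" for s
  proof (cases "norm (h s) \<le> 1")
    case True
    have "1 \<le> (1 + D / c) * norm s ^ k"
      using \<open>D \<ge> 0\<close> c(1) s mult_mono[of 1 "1 + D / c" 1 "norm s ^ k"] by (simp add: one_le_power)
    with True show ?thesis by linarith
  next
    case False
    define H where "H = norm (h s)"
    have "H > 1" using False by (simp add: H_def)
    have "poly (q r) s * h s ^ r = - (\<Sum>l\<le>r'. poly (q l) s * h s ^ l)"
      using eq[of s] by (simp add: r' add_eq_0_iff del: power_Suc)
    then have "norm (poly (q r) s) * H ^ r = norm (\<Sum>l\<le>r'. poly (q l) s * h s ^ l)"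
      by (metis H_def norm_minus_cancel norm_mult norm_power)
    also have "\<dots> \<le> (\<Sum>l\<le>r'. norm (poly (q l) s) * H ^ l)"
      by (rule order_trans[OF norm_sum]) (simp add: norm_mult norm_power H_def)
    also have "\<dots> \<le> (\<Sum>l\<le>r'. ((\<Sum>i\<le>degree (q l). norm (coeff (q l) i)) * norm s
        ^ k) * H ^ r')"
      using \<open>H > 1\<close> s deg by (intro sum_mono mult_mono poly_upper_bound power_increasing)
        (auto simp: r' intro!: mult_nonneg_nonneg sum_nonneg)
    also have "\<dots> = D * norm s ^ k * H ^ r'"
      by (simp add: D_def sum_distrib_right)
    finally have "norm (poly (q r) s) * H * H ^ r' \<le> D * norm s ^ k * H ^ r'"
      by (simp add: r' mult_ac)
    then have "norm (poly (q r) s) * H \<le> D * norm s ^ k"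
      using \<open>H > 1\<close> by (simp add: mult_le_cancel_right)
    moreover have "c * H \<le> norm (poly (q r) s) * H"
      using c(2)[of s] s \<open>H > 1\<close> by (intro mult_right_mono) auto
    ultimately have "H \<le> D / c * norm s ^ k" using c(1) by (simp add: field_simps)
    also have "\<dots> \<le> (1 + D / c) * norm s ^ k" by (intro mult_right_mono) auto
    finally show ?thesis by (simp add: H_def)
  qed
  define P where "P = (\<Sum>i\<le>k. monom ((deriv ^^ i) h 0 / fact i) i)"
  show ?thesis
  proof (rule that[of P])
    show "degree P \<le> k" unfolding P_def
      by (intro degree_sum_le) (auto intro: order_trans[OF degree_monom_le])
    show "h s = poly P s" for s
      using Liouville_polynomial[OF h, of "max 1 R" "1 + D / c" k s] bound
      by (simp add: P_def poly_sum poly_monom)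
  qed
qed

lemma upd_coord_line: "upd_coord z i s = upd_coord z i 0 + s *s axis i 1"
  by (simp add: upd_coord_def vec_eq_iff axis_def)

lemma continuous_on_upd_coord: "continuous_on S (\<lambda>z. upd_coord z i s)"
proof (subst continuous_on_componentwise, intro ballI)
  fix b :: "complex^'a" assume "b \<in> Basis"
  then obtain j u where "b = axis j u" by (auto simp: Basis_vec_def)
  then show "continuous_on S (\<lambda>z. upd_coord z i s \<bullet> b)"
    by (cases "j = i") (auto simp: upd_coord_def inner_axis intro!: continuous_intros)
qed

text \<open>On coordinate lines where the leading coefficient is not identically zero, the
  restriction is a polynomial of degree at most \<open>K\<close>. The resulting interpolation
  identities hold on a dense set and are closed, so they also hold on the lines where the relation
  degenerates.\<close>

lemma entire_algebraic_imp_polynomial: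
  fixes f :: "complex^'d \<Rightarrow> complex"
  assumes f: "entire_fun f" and nz: "\<exists>\<beta>\<in>UNIV \<rightarrow>\<^sub>E {..k}.
      \<exists>l\<le>k. p \<beta> l \<noteq> 0"
    and eq: "\<And>z. (\<Sum>l\<le>k. (\<Sum>\<beta>\<in>UNIV \<rightarrow>\<^sub>E {..k}. p \<beta> l *
        (\<Prod>i\<in>UNIV. z $ i ^ \<beta> i)) * f z ^ l) = 0"
  shows "polynomial_fun f"
proof -
  define E where "E = (UNIV::'d set) \<rightarrow>\<^sub>E {..k}"
  have finE: "finite E" by (simp add: E_def finite_PiE)
  define a where "a l z = (\<Sum>\<beta>\<in>E. p \<beta> l * (\<Prod>i\<in>UNIV. z $ i ^ \<beta> i))" for l z
  have a_ent: "entire_fun (a l)" for l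
    unfolding a_def by (intro entire_fun_sum entire_fun_mult entire_fun_prod entire_fun_power) auto
  have a_poly: "coordwise_poly (CARD('d) * k) (a l)" for l
    unfolding a_def
  proof (intro coordwise_poly_sum)
    fix \<beta> assume "\<beta> \<in> E"
    have "coordwise_poly (0 + (\<Sum>i\<in>UNIV. \<beta> i * 1)) (\<lambda>z. p \<beta> l *
        (\<Prod>i\<in>UNIV. z $ i ^ \<beta> i))"
      by (intro coordwise_poly_mult coordwise_poly_prod coordwise_poly_power coordwise_poly_nth) auto
    moreover have "0 + (\<Sum>i\<in>UNIV. \<beta> i * 1) \<le> CARD('d) * k"
      using \<open>\<beta> \<in> E\<close> sum_bounded_above[of UNIV \<beta> k] by (auto simp: E_def PiE_iff)
    ultimately show "coordwise_poly (CARD('d) * k) (\<lambda>z. p \<beta> l * (\<Prod>i\<in>UNIV. z $ i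
        ^ \<beta> i))"
      by (rule coordwise_poly_mono)
  qed
  have ex: "\<exists>l\<le>k. \<exists>z. a l z \<noteq> 0"
  proof (rule ccontr)
    assume "\<not> ?thesis"
    then have "p \<beta> l = 0" if "\<beta> \<in> E" "l \<le> k" for \<beta> l
      using that by (intro monomials_independent[of UNIV E "\<lambda>\<beta>. p \<beta> l"]) (auto simp:
          finE a_def)
    with nz show False by (auto simp: E_def)
  qed
  \<comment> \<open>Coefficients of higher powers vanish identically, so the relation can be
    truncated to one whose leading coefficient is somewhere nonzero.\<close>
  define r where "r = Max {l. l \<le> k \<and> (\<exists>z. a l z \<noteq> 0)}"
  have fin: "finite {l. l \<le> k \<and> (\<exists>z. a l z \<noteq> 0)}" by simp
  have "r \<in> {l. l \<le> k \<and> (\<exists>z. a l z \<noteq> 0)}"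
    unfolding r_def using ex by (intro Max_in fin) auto
  then obtain z0 where r: "r \<le> k" "a r z0 \<noteq> 0" by auto
  have above: "a l z = 0" if "r < l" "l \<le> k" for l z
  proof (rule ccontr)
    assume "a l z \<noteq> 0"
    then have "l \<le> r" unfolding r_def using that by (intro Max_ge[OF fin]) auto
    with that show False by simp
  qed
  have eq': "(\<Sum>l\<le>r. a l z * f z ^ l) = 0" for z
  proof -
    have "(\<Sum>l\<le>r. a l z * f z ^ l) = (\<Sum>l\<le>k. a l z * f z ^ l)"
      using r above by (intro sum.mono_neutral_left) auto
    then show ?thesis using eq[of z] by (simp add: a_def E_def)
  qed
  define K where "K = CARD('d) * k"
  define T where "T i = {z. f z = (\<Sum>l\<le>K. lagrange_basis K l (z $ i) * f (upd_coord z i (of_nat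
      l)))}" for i
  have "closed (T i)" for i
    unfolding T_def lagrange_basis_def
    by (intro closed_Collect_eq continuous_intros entire_fun_continuous_on[OF f]
         continuous_on_compose2[OF entire_fun_continuous_on[OF f] continuous_on_upd_coord]) auto
  moreover have "{z. a r z \<noteq> 0} \<subseteq> T i" for i
  proof
    fix z assume "z \<in> {z. a r z \<noteq> 0}"
    then have az: "a r z \<noteq> 0" by simp
    obtain q where q: "\<And>l. degree (q l) \<le> K" "\<And>l s. a l (upd_coord z i s) = poly (q l) s"
    proof -
      have "\<forall>l. \<exists>p. degree p \<le> K \<and> (\<forall>s. a l (upd_coord z i s) = poly p s)"
        using a_poly unfolding coordwise_poly_def K_def by blast
      then show ?thesis using that by metis
    qed
    have "poly (q r) (z $ i) \<noteq> 0" using az q(2)[of r "z $ i"] by simp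
    then have "q r \<noteq> 0" by auto
    define h where "h s = f (upd_coord z i s)" for s
    have "h holomorphic_on UNIV"
    proof -
      have "h = (\<lambda>s. f (upd_coord z i 0 + s *s axis i 1))"
        unfolding h_def by (simp flip: upd_coord_line)
      then show ?thesis using entire_fun_along_line_holomorphic[OF f] by simp
    qed
    moreover have "(\<Sum>l\<le>r. poly (q l) s * h s ^ l) = 0" for s
      using eq'[of "upd_coord z i s"] by (simp add: h_def q(2))
    ultimately obtain P where P: "degree P \<le> K" "\<And>s. h s = poly P s"
      using algebraic_holomorphic_is_poly[of h r q K] q(1) \<open>q r \<noteq> 0\<close> by metis
    show "z \<in> T i"
      using lagrange_interpolation[OF P(1), of "z $ i"] by (simp add: T_def h_def flip: P(2))
  qed
  ultimately have "closure {z. a r z \<noteq> 0} \<subseteq> T i" for i by (simp add: closure_minimal)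
  then have "T i = UNIV" for i using entire_fun_nonzero_dense[OF a_ent r(2)] by auto
  then have "coord_interp K f" unfolding coord_interp_def T_def by blast
  then show ?thesis by (rule coord_interp_imp_polynomial_fun)
qed

section \<open>Graphs whose cone at infinity avoids a plane\<close>

text \<open>A basis of \<open>L\<close> is extended to the whole space; \<Lambda> sends CARD('k) of
  the new basis vectors to the unit vectors and all other basis vectors to 0. The vectors
  \<open>e i\<close> encode a right inverse. For complementary dimensions every new vector is used
  up, so the kernel is \<open>L\<close> itself.\<close>

lemma linear_map_killing_subspace:
  fixes L :: "(complex^'n) set"
  assumes L: "vec.subspace L" and dim: "vec.dim L + CARD('k::finite) \<le> CARD('n)"
  obtains \<Lambda> :: "complex^'n \<Rightarrow> complex^'k" and e :: "'k \<Rightarrow> complex^'n" where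
    "Vector_Spaces.linear (*s) (*s) \<Lambda>" "\<And>x. x \<in> L \<Longrightarrow> \<Lambda> x = 0"
        "\<And>i. \<Lambda> (e i) = axis i 1"
    "\<And>x. vec.dim L + CARD('k) = CARD('n) \<Longrightarrow> \<Lambda> x = 0 \<Longrightarrow> x \<in> L"
proof -
  obtain B0 where B0: "B0 \<subseteq> L" "vec.independent B0" "L \<subseteq> vec.span B0" "card B0 = vec.dim L"
    using vec.basis_exists by blast
  have spanB0: "vec.span B0 = L"
    using B0 L by (metis vec.span_mono vec.span_eq_iff subset_antisym)
  define B where "B = vec.extend_basis B0"
  have B: "vec.independent B" "vec.span B = UNIV" "B0 \<subseteq> B"
    using vec.extend_basis_superset[OF B0(2)] vec.independent_extend_basis[OF B0(2)]
        vec.span_extend_basis[OF B0(2)]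
    by (auto simp: B_def)
  have finB: "finite B" using B vec.independent_bound_general by blast
  have "card B = CARD('n)"
    using B vec.dim_eq_card_independent[of B] vec.dim_span[of B] vec_dim_card[where 'a=complex and 'n='n]
    by (simp del: vec.dim_UNIV)
  then have cardD: "card (B - B0) = CARD('n) - vec.dim L"
    using B B0 finB by (simp add: card_Diff_subset finite_subset)
  obtain e :: "'k \<Rightarrow> complex^'n" where e: "range e \<subseteq> B - B0" "inj e"
  proof -
    have "CARD('k) \<le> card (B - B0)" using dim cardD by linarith
    then show ?thesis using card_le_inj[of "UNIV::'k set" "B - B0"] finB that by auto
  qed
  obtain \<Lambda> :: "complex^'n \<Rightarrow> complex^'k" where \<Lambda>: "Vector_Spaces.linear (*s)
      (*s) \<Lambda>"
    "\<And>b. b \<in> B \<Longrightarrow> \<Lambda> b = (if b \<in> range e then axis (inv e b) 1 else 0)"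
    using vec.linear_independent_extend[OF B(1), of "\<lambda>b. if b \<in> range e then axis (inv e b)
        1 else 0"] by blast
  interpret \<Lambda>: Vector_Spaces.linear "(*s)" "(*s)" \<Lambda> by (rule \<Lambda>)
  have \<Lambda>0: "\<Lambda> x = 0" if "x \<in> L" for x
  proof (rule \<Lambda>.eq_0_on_span)
    show "x \<in> vec.span B0" using that spanB0 by simp
    show "\<Lambda> b = 0" if "b \<in> B0" for b
    proof -
      have "b \<in> B" "b \<notin> range e" using that e B by blast+
      then show ?thesis by (simp add: \<Lambda>(2))
    qed
  qed
  have \<Lambda>e: "\<Lambda> (e i) = axis i 1" for i
    using e \<Lambda>(2)[of "e i"] by auto
  have ker: "x \<in> L" if eq: "vec.dim L + CARD('k) = CARD('n)" and "\<Lambda> x = 0" for x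
  proof -
    have "card (range e) = card (B - B0)" using e eq cardD by (simp add: card_image)
    then have "range e = B - B0" using e finB by (intro card_subset_eq) auto
    then have "x \<in> vec.span (B0 \<union> range e)" using B by (simp add: Un_absorb1)
    then obtain y w where yw: "x = y + w" "y \<in> L" "w \<in> vec.span (range e)"
      unfolding vec.span_Un spanB0 by auto
    obtain u where "w = (\<Sum>a\<in>range e. u a *s a)"
      using yw(3) vec.span_finite[of "range e"] by auto
    then have w: "w = (\<Sum>i\<in>UNIV. u (e i) *s e i)" using e(2) by (simp add: sum.reindex)
    have "\<Lambda> x = \<Lambda> w" using yw \<Lambda>0 by (simp add: \<Lambda>.add)
    also have "\<dots> = (\<Sum>i\<in>UNIV. u (e i) *s axis i 1)"
      unfolding w by (simp only: \<Lambda>.sum \<Lambda>.scale \<Lambda>e)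
    finally have z: "(\<Sum>i\<in>UNIV. u (e i) *s axis i (1::complex)) = 0" using \<open>\<Lambda> x =
        0\<close> by simp
    have "u (e j) = 0" for j
    proof -
      have "(\<Sum>i\<in>UNIV. u (e i) *s axis i (1::complex)) $ j = u (e j)"
        by (simp add: axis_def if_distrib[where f="\<lambda>x. _ * x"] cong: if_cong)
      then show ?thesis using z by simp
    qed
    then have "w = 0" by (simp add: w)
    with yw show ?thesis by simp
  qed
  show ?thesis by (rule that[OF \<Lambda>(1) \<Lambda>0 \<Lambda>e ker])
qed

lemma scaleR_eq_vector_scale: "c *\<^sub>R x = complex_of_real c *s (x::complex^'n)"
  unfolding vec_eq_iff vector_scaleR_component vector_smult_component
  by (simp add: scaleR_conv_of_real[where 'a=complex])

lemma vec_linear_imp_bounded_linear: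
  fixes \<Lambda> :: "complex^'n \<Rightarrow> complex^'k"
  assumes "Vector_Spaces.linear (*s) (*s) \<Lambda>"
  shows "bounded_linear \<Lambda>"
proof -
  interpret \<Lambda>: Vector_Spaces.linear "(*s)" "(*s)" \<Lambda> by (rule assms)

  have "linear \<Lambda>"
    by (rule linearI) (auto simp: \<Lambda>.add scaleR_eq_vector_scale \<Lambda>.scale)
  then show ?thesis by (rule linear_conv_bounded_linear[THEN iffD1])
qed

text \<open>Otherwise points violating the bound with constants \<open>j + 1\<close>, divided by
  their norms, accumulate at a unit vector of the cone inside the kernel: the violation forces the
  norms to infinity and the normalised images to 0.\<close>

lemma cone_avoiding_kernel_bound:
  fixes \<Lambda> :: "complex^'n \<Rightarrow> complex^'k"
  assumes bl: "bounded_linear \<Lambda>" and avoid: "\<And>v. v \<in> tangent_cone_inf A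
      \<Longrightarrow> \<Lambda> v = 0 \<Longrightarrow> v = 0"
  obtains C where "C \<ge> 1" "\<And>x. x \<in> A \<Longrightarrow> norm x \<le> C * (1 + norm (\<Lambda> x))"
proof (rule ccontr)
  assume "\<not> thesis"
  then have "\<exists>x\<in>A. norm x > (real j + 1) * (1 + norm (\<Lambda> x))" for j
    using that[of "real j + 1"] by force
  then obtain x where x: "\<And>j. x j \<in> A" "\<And>j. norm (x j) > (real j + 1) * (1 + norm
      (\<Lambda> (x j)))" by metis
  define t where "t j = norm (x j)" for j
  have t: "t j > real j + 1" for j
  proof -
    have "(real j + 1) * 1 \<le> (real j + 1) * (1 + norm (\<Lambda> (x j)))" by (intro mult_left_mono) auto
    also have "\<dots> < t j" using x(2)[of j] by (simp add: t_def)
    finally show ?thesis by simp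
  qed
  have t0: "t j > 0" for j using t[of j] by linarith
  have tinf: "filterlim t at_top sequentially"
  proof (rule filterlim_at_top_mono[OF filterlim_real_sequentially])
    show "\<forall>\<^sub>F j in sequentially. real j \<le> t j"
      by (rule always_eventually) (use t in \<open>auto intro: less_imp_le simp:
          less_eq_real_def\<close>, metis t less_add_one less_trans)
  qed
  define y where "y j = x j /\<^sub>R t j" for j
  have "y j \<in> sphere 0 1" for j using t0[of j] by (simp add: y_def t_def)
  then obtain l r where l: "l \<in> sphere 0 1" "strict_mono r" "(y \<circ> r) \<longlonglongrightarrow> l"
    using compact_sphere[of "0::complex^'n" 1] unfolding compact_def by metis
  have "l \<in> tangent_cone_inf A"
    unfolding tangent_cone_inf_def
  proof (intro CollectI exI[of _ "x \<circ> r"] exI[of _ "t \<circ> r"] conjI allI)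
    show "(x \<circ> r) j \<in> A" "(t \<circ> r) j > 0" for j using x t0 by auto
    have tr: "filterlim (\<lambda>j. t (r j)) at_top sequentially"
      using filterlim_compose[OF tinf filterlim_subseq[OF l(2)]] .
    then show "filterlim (t \<circ> r) at_top sequentially" by (simp add: o_def)
    show "filterlim (\<lambda>j. norm ((x \<circ> r) j)) at_top sequentially" using tr by (simp add: o_def t_def)
    show "(\<lambda>j. (x \<circ> r) j /\<^sub>R (t \<circ> r) j) \<longlonglongrightarrow> l" using
        l(3) by (simp add: o_def y_def)
  qed
  moreover have "\<Lambda> l = 0"
  proof -
    have "(\<lambda>j. \<Lambda> ((y \<circ> r) j)) \<longlonglongrightarrow> \<Lambda> l" by (rule
        bounded_linear.tendsto[OF bl l(3)])
    moreover have "(\<lambda>j. \<Lambda> (y j)) \<longlonglongrightarrow> 0"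
    proof (rule tendsto_norm_zero_cancel, rule tendsto_sandwich[OF _ _ tendsto_const LIMSEQ_inverse_real_of_nat])
      have "norm (\<Lambda> (y j)) \<le> inverse (real (Suc j))" for j
      proof -
        have "norm (\<Lambda> (y j)) = norm (\<Lambda> (x j)) / t j"
          using t0[of j] by (simp add: y_def linear_simps(5)[OF bl] field_simps)
        also have "\<dots> \<le> 1 / (real j + 1)"
        proof -
          have "(real j + 1) * norm (\<Lambda> (x j)) \<le> t j"
            using x(2)[of j] by (simp add: t_def algebra_simps)
          then show ?thesis using t0[of j] by (simp add: field_simps)
        qed
        finally show ?thesis by (simp add: field_simps)
      qed
      then show "\<forall>\<^sub>F j in sequentially. norm (\<Lambda> (y j)) \<le> inverse (real (Suc j))" by simp
    qed simp
    then have "(\<lambda>j. \<Lambda> ((y \<circ> r) j)) \<longlonglongrightarrow> 0"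
      using LIMSEQ_subseq_LIMSEQ[OF _ l(2)] by (fastforce simp: o_def)
    ultimately show ?thesis using LIMSEQ_unique by blast
  qed
  ultimately have "l = 0" by (rule avoid)
  then show False using l(1) by simp
qed

text \<open>The determinant is holomorphic in \<epsilon> and nonzero at \<open>K + 1\<close>,
  because \<open>K\<close> bounds the operator norm of \<open>A\<close>; so a zero at 0 is
  isolated.\<close>

lemma perturbed_det_nonzero:
  fixes A :: "complex^'d^'d"
  assumes "\<delta> > 0"
  obtains \<epsilon> where "norm \<epsilon> < \<delta>" "det (A + mat \<epsilon>) \<noteq> 0"
proof -
  define D where "D \<epsilon> = det (A + mat \<epsilon>)" for \<epsilon>
  have hol: "D holomorphic_on UNIV"
  proof -
    have "(\<lambda>\<epsilon>. (A + mat \<epsilon>) $ i $ j) holomorphic_on UNIV" for i j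
      by (cases "i = j") (auto simp: mat_def intro!: holomorphic_intros)
    then show ?thesis unfolding D_def det_def by (intro holomorphic_intros)
  qed
  obtain K where K: "\<And>v. norm (A *v v) \<le> norm v * K" "K > 0"
    using bounded_linear.pos_bounded[OF vec_linear_imp_bounded_linear[OF matrix_vector_mul_linear_gen[of
        A]]] by blast
  have "D (of_real (K + 1)) \<noteq> 0"
  proof
    assume "D (of_real (K + 1)) = 0"
    then have "\<not> invertible (A + mat (of_real (K + 1)))" by (simp add: D_def invertible_det_nz)
    then obtain v where v: "v \<noteq> 0" "(A + mat (of_real (K + 1))) *v v = 0"
      using matrix_left_invertible_ker invertible_left_inverse by metis
    have "mat c *v v = c *s v" for c
      by (simp add: vec_eq_iff matrix_vector_mult_def mat_def if_distrib[where f="\<lambda>x. x * _"]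
          cong: if_cong)
    then have "A *v v = - (complex_of_real (K + 1) *s v)"
      using v(2) by (simp add: matrix_vector_mult_add_rdistrib eq_neg_iff_add_eq_0 del: of_real_add)
    then have "norm (A *v v) = \<bar>K + 1\<bar> * norm v"
      by (simp only: norm_minus_cancel norm_vector_scale norm_of_real)
    then have "norm (A *v v) = (K + 1) * norm v" using K by simp
    with K(1)[of v] v(1) show False by (simp add: algebra_simps)
  qed
  show ?thesis
  proof (cases "D 0 = 0")
    case False
    then show ?thesis using assms by (intro that[of 0]) (auto simp: D_def)
  next
    case True
    obtain r where r: "r > 0" "\<And>s. s \<in> ball 0 r - {0} \<Longrightarrow> D s \<noteq> 0"
      by (rule isolated_zeros[OF hol, of 0 "of_real (K + 1)"])
         (use True \<open>D (of_real (K + 1)) \<noteq> 0\<close> in auto)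
    define m where "m = min r \<delta> / 2"
    have "m > 0" "m < r" "m < \<delta>" using r assms by (auto simp: m_def)
    then show ?thesis using r(2)[of "of_real m"] by (intro that[of "of_real m"]) (auto simp: D_def)
  qed
qed

definition graph_point :: "(complex^'d \<Rightarrow> complex^'m) \<Rightarrow> complex^'d \<Rightarrow>
    complex^('d + 'm)" where
  "graph_point F z = (\<chi> i. case i of Inl k \<Rightarrow> z $ k | Inr j \<Rightarrow> F z $ j)"

lemma graph_map_eq: "graph_map F = range (graph_point F)"
  unfolding graph_map_def graph_point_def ..

lemma polynomial_map_if_avoids_plane:
  fixes F :: "complex^'d \<Rightarrow> complex^'m"
  assumes F: "entire_map F" and L: "vec.subspace L" "vec.dim L = CARD('m)"
    and avoid: "\<And>v. v \<in> tangent_cone_inf (graph_map F) \<Longrightarrow> v \<in> L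
        \<Longrightarrow> v = 0"
  shows "polynomial_map F"
proof -
  have dims: "vec.dim L + CARD('d) = CARD('d + 'm)" using L by simp
  obtain \<Lambda> :: "complex^('d + 'm) \<Rightarrow> complex^'d" where \<Lambda>:
      "Vector_Spaces.linear (*s) (*s) \<Lambda>"
    and ker: "\<And>x. \<Lambda> x = 0 \<Longrightarrow> x \<in> L"
    using linear_map_killing_subspace[OF L(1), where 'k='d] dims by (metis order_refl)
  interpret \<Lambda>: Vector_Spaces.linear "(*s)" "(*s)" \<Lambda> by (rule \<Lambda>)
  obtain C where C: "C \<ge> 1" "\<And>x. x \<in> graph_map F \<Longrightarrow> norm x \<le> C * (1 +
      norm (\<Lambda> x))"
    using cone_avoiding_kernel_bound[OF vec_linear_imp_bounded_linear[OF \<Lambda>], of "graph_map F"]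
        avoid ker by metis
  define \<phi>0 where "\<phi>0 z = \<Lambda> (graph_point F z)" for z
  have g: "norm (graph_point F z) \<le> C * (1 + norm (\<phi>0 z))" for z
    unfolding \<phi>0_def by (rule C) (simp add: graph_map_eq)
  \<comment> \<open>The factor CARD('d) pays for bounding |z| by the sum of its coordinates.\<close>
  define C1 where "C1 = real CARD('d) * C"
  have "real CARD('d) \<ge> 1" by (simp add: Suc_le_eq)
  then have CC1: "C \<le> C1" using C(1) unfolding C1_def by (metis mult_1 mult_right_mono order_trans zero_le_one)
  then have "C1 \<ge> 1" using C by simp
  have zb: "norm z \<le> C1 * (1 + norm (\<phi>0 z))" for z
  proof -
    have "norm z \<le> (\<Sum>k\<in>UNIV. norm (z $ k))" unfolding norm_vec_def by (rule L2_set_le_sum) simp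
    also have "\<dots> \<le> (\<Sum>k\<in>(UNIV::'d set). norm (graph_point F z))"
    proof (rule sum_mono)
      fix k show "norm (z $ k) \<le> norm (graph_point F z)"
        using Finite_Cartesian_Product.norm_nth_le[of "graph_point F z" "Inl k"] by (simp add: graph_point_def)
    qed
    also have "\<dots> \<le> C1 * (1 + norm (\<phi>0 z))" using g[of z] by (simp add: C1_def
        mult_left_mono mult.assoc)
    finally show ?thesis .
  qed
  have Fb: "norm (F z $ j) \<le> C1 * (1 + norm (\<phi>0 z))" for z j
  proof -
    have "norm (F z $ j) \<le> norm (graph_point F z)"
      using Finite_Cartesian_Product.norm_nth_le[of "graph_point F z" "Inr j"] by (simp add: graph_point_def)
    also have "\<dots> \<le> C1 * (1 + norm (\<phi>0 z))"
      by (rule order_trans[OF g]) (use CC1 in \<open>auto intro!: mult_right_mono\<close>)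
    finally show ?thesis .
  qed
  have ent_gp: "entire_fun (\<lambda>z. graph_point F z $ q)" for q
    using F by (cases q) (auto simp: graph_point_def entire_map_def)
  have ent0: "entire_fun (\<lambda>z. \<phi>0 z $ i)" for i
  proof -
    have expand: "\<Lambda> x = (\<Sum>q\<in>UNIV. x $ q *s \<Lambda> (axis q 1))" for x
    proof -
      have "\<Lambda> x = \<Lambda> (\<Sum>q\<in>UNIV. x $ q *s axis q 1)" using axis_sum_expansion by metis
      then show ?thesis by (simp only: \<Lambda>.sum \<Lambda>.scale)
    qed
    have "\<phi>0 z $ i = (\<Sum>q\<in>UNIV. graph_point F z $ q * \<Lambda> (axis q 1) $ i)" for z
      unfolding \<phi>0_def by (subst expand) simp
    then show ?thesis
      by (simp only:) (intro entire_fun_sum entire_fun_mult entire_fun_const ent_gp)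
  qed
  \<comment> \<open>Below this threshold the perturbation \<epsilon> z costs at most half of |z|,
    which is absorbed on the left; hence the constant \<open>2 * C1\<close> in the bounds for
    \<phi>.\<close>
  obtain \<epsilon> where \<epsilon>: "norm \<epsilon> < 1 / (2 * C1)" "det (jacobian_matrix \<phi>0 0 +
      mat \<epsilon>) \<noteq> 0"
    using perturbed_det_nonzero[of "1 / (2 * C1)"] \<open>C1 \<ge> 1\<close> by auto
  define \<phi> where "\<phi> z = \<phi>0 z + \<epsilon> *s z" for z
  have \<phi>: "entire_map \<phi>"
    unfolding entire_map_def \<phi>_def by (auto intro!: entire_fun_add entire_fun_mult ent0)
  have "jacobian_matrix \<phi> 0 = jacobian_matrix \<phi>0 0 + mat \<epsilon>"
  proof -
    have "pderiv_fun j (\<lambda>z. \<phi> z $ i) 0 = pderiv_fun j (\<lambda>z. \<phi>0 z $ i) 0 +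
        \<epsilon> * (if j = i then 1 else 0)" for i j
      by (simp add: \<phi>_def pderiv_fun_add ent0 entire_fun_mult pderiv_fun_cmult pderiv_fun_nth)
    then show ?thesis by (simp add: jacobian_matrix_def mat_def vec_eq_iff)
  qed
  then have J: "det (jacobian_matrix \<phi> 0) \<noteq> 0" using \<epsilon> by simp
  have small: "C1 * (1 + norm (\<phi>0 z)) \<le> C1 * (1 + norm (\<phi> z)) + norm z / 2" for z
  proof -
    have "norm (\<phi>0 z) \<le> norm (\<phi> z) + norm (\<epsilon> *s z)"
      using norm_triangle_ineq4[of "\<phi> z" "\<epsilon> *s z"] by (simp add: \<phi>_def)
    then have "C1 * (1 + norm (\<phi>0 z)) \<le> C1 * (1 + norm (\<phi> z) + norm \<epsilon> * norm z)"
      using \<open>C1 \<ge> 1\<close> by (intro mult_left_mono) (auto simp: norm_vector_scale)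
    also have "\<dots> = C1 * (1 + norm (\<phi> z)) + (C1 * norm \<epsilon>) * norm z" by (simp add: algebra_simps)
    also have "\<dots> \<le> C1 * (1 + norm (\<phi> z)) + (1/2) * norm z"
      using \<epsilon>(1) \<open>C1 \<ge> 1\<close> by (intro add_left_mono mult_right_mono) (auto simp:
          field_simps)
    finally show ?thesis by simp
  qed
  have zb': "norm z \<le> (2 * C1) * (1 + norm (\<phi> z))" for z
    using zb[of z] small[of z] by linarith
  have Fb': "norm (F z $ j) \<le> (2 * C1) * (1 + norm (\<phi> z))" for z j
    using Fb[of z j] small[of z] zb'[of z] by linarith
  have "polynomial_fun (\<lambda>z. F z $ j)" for j
  proof -
    have Fj: "entire_fun (\<lambda>z. F z $ j)" using F by (simp add: entire_map_def)
    obtain k p where "\<exists>\<beta>\<in>UNIV \<rightarrow>\<^sub>E {..k}. \<exists>l\<le>k. p \<beta>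
        l \<noteq> 0"
      "\<And>z. (\<Sum>l\<le>k. (\<Sum>\<beta>\<in>UNIV \<rightarrow>\<^sub>E {..k}. p \<beta> l *
          (\<Prod>i\<in>UNIV. z $ i ^ \<beta> i)) * (F z $ j) ^ l) = 0"
      by (rule entire_fun_algebraic_of_proper_bound[OF \<phi> zb' J Fj Fb']) (rule that)
    then show ?thesis by (rule entire_algebraic_imp_polynomial[OF Fj])
  qed
  then show ?thesis by (simp add: polynomial_map_def)
qed

section \<open>Hausdorff null sets\<close>

lemma hausdorff_measure_eq_0_iff:
  "hausdorff_measure M d s A = 0 \<longleftrightarrow>
     (\<forall>\<delta>>0. \<forall>\<eta>>0. \<exists>U. A \<subseteq> (\<Union>i. U i) \<and>
         (\<forall>i. U i \<subseteq> M \<and> dist_diam d (U i) \<le> ennreal \<delta>) \<and>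
        (\<Sum>i. diam_power d s (U i)) < ennreal \<eta>)"
proof -
  have "hausdorff_measure M d s A = 0 \<longleftrightarrow> (\<forall>\<delta>>0. hausdorff_pre M d s
      \<delta> A = 0)"
    unfolding hausdorff_measure_def bot_ennreal[symmetric] SUP_eq_iff by (auto simp: SUP_bot_conv)
  also have "\<dots> \<longleftrightarrow> (\<forall>\<delta>>0. \<forall>\<eta>>0. hausdorff_pre M d s
      \<delta> A < ennreal \<eta>)"
  proof (intro all_cong1 imp_cong refl iffI allI impI)
    fix \<delta> :: real
    assume *: "\<forall>\<eta>>0. hausdorff_pre M d s \<delta> A < ennreal \<eta>"
    have "hausdorff_pre M d s \<delta> A \<le> 0 + ennreal e" if "e > 0" for e
      unfolding add_0 by (rule less_imp_le) (use * that in blast)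
    then have "hausdorff_pre M d s \<delta> A \<le> 0" by (rule ennreal_le_epsilon)
    then show "hausdorff_pre M d s \<delta> A = 0" by simp
  qed simp
  also have "\<dots> \<longleftrightarrow> (\<forall>\<delta>>0. \<forall>\<eta>>0. \<exists>U. A
      \<subseteq> (\<Union>i. U i) \<and> (\<forall>i. U i \<subseteq> M \<and> dist_diam d (U i) \<le>
          ennreal \<delta>) \<and>
        (\<Sum>i. diam_power d s (U i)) < ennreal \<eta>)"
    unfolding hausdorff_pre_def INF_less_iff by (simp add: Bex_def conj_assoc)
  finally show ?thesis .
qed

lemma hausdorff_null_subset:
  assumes "hausdorff_measure M d s B = 0" "A \<subseteq> B"
  shows "hausdorff_measure M d s A = 0"
  using assms unfolding hausdorff_measure_eq_0_iff by (meson subset_trans)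

text \<open>For diameters at most 1 the larger exponent gives the smaller power, so covers are taken
  at scale \<open>min \<delta> 1\<close>. The exponent 0 fits in because every nonempty set then
  counts as 1.\<close>

lemma hausdorff_null_mono_exponent:
  assumes null: "hausdorff_measure M d s A = 0" and s: "0 \<le> s" "s < s'"
  shows "hausdorff_measure M d s' A = 0"
  unfolding hausdorff_measure_eq_0_iff
proof (intro allI impI)
  fix \<delta> \<eta> :: real assume "\<delta> > 0" "\<eta> > 0"
  then have "min \<delta> 1 > 0" by simp
  then obtain U where U: "A \<subseteq> (\<Union>i. U i)" "\<And>i. U i \<subseteq> M" "\<And>i.
      dist_diam d (U i) \<le> ennreal (min \<delta> 1)"
    "(\<Sum>i. diam_power d s (U i)) < ennreal \<eta>"
    using null \<open>\<eta> > 0\<close> unfolding hausdorff_measure_eq_0_iff by meson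
  have "diam_power d s' (U i) \<le> diam_power d s (U i)" for i
  proof -
    have "enn2real (dist_diam d (U i)) \<le> min \<delta> 1"
      using U(3)[of i] \<open>min \<delta> 1 > 0\<close> by (intro enn2real_leI) auto
    then have le1: "enn2real (dist_diam d (U i)) \<le> 1" by simp
    have "enn2real (dist_diam d (U i)) powr s' \<le> enn2real (dist_diam d (U i)) powr s"
    proof (cases "enn2real (dist_diam d (U i)) = 0")
      case False
      then have "enn2real (dist_diam d (U i)) > 0" using enn2real_nonneg less_eq_real_def by metis
      then show ?thesis using le1 s by (simp add: powr_mono')
    qed simp
    moreover have "enn2real (dist_diam d (U i)) powr s' \<le> 1"
      using le1 s by (intro powr_le1) auto
    ultimately show ?thesis using s by (auto simp: diam_power_def ennreal_leI)
  qed
  then have "(\<Sum>i. diam_power d s' (U i)) \<le> (\<Sum>i. diam_power d s (U i))" by (intro suminf_le) auto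
  also have "\<dots> < ennreal \<eta>" by (rule U)
  finally have "(\<Sum>i. diam_power d s' (U i)) < ennreal \<eta>" .
  moreover have "dist_diam d (U i) \<le> ennreal \<delta>" for i
    using U(3)[of i] by (rule order_trans) (simp add: ennreal_leI)
  ultimately show "\<exists>U. A \<subseteq> (\<Union>i. U i) \<and> (\<forall>i. U i \<subseteq> M
      \<and> dist_diam d (U i) \<le> ennreal \<delta>) \<and>
        (\<Sum>i. diam_power d s' (U i)) < ennreal \<eta>"
    using U by blast
qed

lemma hausdorff_null_UN_nat:
  assumes "\<And>n::nat. hausdorff_measure M d s (A n) = 0"
  shows "hausdorff_measure M d s (\<Union>n. A n) = 0"
  unfolding hausdorff_measure_eq_0_iff
proof (intro allI impI)
  fix \<delta> \<eta> :: real assume "\<delta> > 0" "\<eta> > 0"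
  \<comment> \<open>The weights sum to \<eta>/2, which keeps the total strictly below
    \<eta>.\<close>
  define e where "e n = \<eta> / 2 * (1/2) ^ Suc n" for n
  have "\<exists>U. A n \<subseteq> (\<Union>i. U i) \<and> (\<forall>i. U i \<subseteq> M \<and>
      dist_diam d (U i) \<le> ennreal \<delta>) \<and>
        (\<Sum>i. diam_power d s (U i)) < ennreal (e n)" for n
    using assms[of n] \<open>\<delta> > 0\<close> \<open>\<eta> > 0\<close> unfolding
        hausdorff_measure_eq_0_iff by (simp add: e_def)
  then obtain U where U: "\<And>n. A n \<subseteq> (\<Union>i. U n i)" "\<And>n i. U n i \<subseteq> M"
      "\<And>n i. dist_diam d (U n i) \<le> ennreal \<delta>"
     "\<And>n. (\<Sum>i. diam_power d s (U n i)) < ennreal (e n)"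
    by metis
  define V where "V k = (case prod_decode k of (n, i) \<Rightarrow> U n i)" for k
  have "(\<Sum>k. diam_power d s (V k)) = (\<Sum>k. (\<lambda>(n, i). diam_power d s (U n i)) (prod_decode k))"
    by (simp add: V_def case_prod_beta)
  also have "\<dots> = (\<Sum>n. \<Sum>i. diam_power d s (U n i))"
    by (rule suminf_ennreal_2dimen) simp
  also have "\<dots> \<le> (\<Sum>n. ennreal (e n))" using U(4) by (intro suminf_le) (auto simp: less_imp_le)
  also have "\<dots> = ennreal (\<eta> / 2)"
  proof (rule suminf_ennreal_eq)
    show "e sums (\<eta> / 2)" using sums_mult[OF power_half_series, of "\<eta> / 2"] by (simp add: e_def[abs_def])
  qed (use \<open>\<eta> > 0\<close> in \<open>simp add: e_def\<close>)
  also have "\<dots> < ennreal \<eta>" using \<open>\<eta> > 0\<close> by (simp add: ennreal_less_iff)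
  finally have "(\<Sum>k. diam_power d s (V k)) < ennreal \<eta>" .
  moreover have "(\<Union>n. A n) \<subseteq> (\<Union>k. V k)"
  proof
    fix x assume "x \<in> (\<Union>n. A n)"
    then obtain n i where "x \<in> U n i" using U(1) by blast
    then have "x \<in> V (prod_encode (n, i))" by (simp add: V_def)
    then show "x \<in> (\<Union>k. V k)" by blast
  qed
  moreover have "V k \<subseteq> M \<and> dist_diam d (V k) \<le> ennreal \<delta>" for k
    using U(2,3) by (simp add: V_def case_prod_beta)
  ultimately show "\<exists>V. (\<Union>n. A n) \<subseteq> (\<Union>i. V i) \<and> (\<forall>i. V i
      \<subseteq> M \<and> dist_diam d (V i) \<le> ennreal \<delta>) \<and>
        (\<Sum>i. diam_power d s (V i)) < ennreal \<eta>"
    by blast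
qed

lemma hausdorff_null_UN:
  assumes "countable I" "\<And>i. i \<in> I \<Longrightarrow> hausdorff_measure M d s (A i) = 0"
  shows "hausdorff_measure M d s (\<Union>i\<in>I. A i) = 0"
proof (cases "I = {}")
  case True
  have "hausdorff_measure M d s {} = 0"
    unfolding hausdorff_measure_eq_0_iff
    by (intro allI impI exI[of _ "\<lambda>_. {}"]) (auto simp: dist_diam_def diam_power_def bot_ennreal)
  with True show ?thesis by simp
next
  case False
  then have "(\<Union>i\<in>I. A i) = (\<Union>n. A (from_nat_into I n))"
    using range_from_nat_into[OF False assms(1)] by (metis image_image)
  then show ?thesis using assms(2) from_nat_into[OF False] by (simp add: hausdorff_null_UN_nat)
qed

lemma dist_diam_le:
  assumes "\<And>x y. x \<in> U \<Longrightarrow> y \<in> U \<Longrightarrow> d x y \<le> \<rho>"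
  shows "dist_diam d U \<le> ennreal \<rho>"
  unfolding dist_diam_def using assms by (intro SUP_least ennreal_leI)

text \<open>Finiteness of the diameter enters because \<open>enn2real\<close> sends an infinite
  value to 0.\<close>

lemma dist_le_dist_diam:
  assumes "dist_diam d U \<le> ennreal \<delta>" "x \<in> U" "y \<in> U"
  shows "d x y \<le> enn2real (dist_diam d U)"
proof -
  have "ennreal (d x y) \<le> dist_diam d U"
    unfolding dist_diam_def using assms(2,3) by (meson SUP_upper2 order_refl)
  moreover have "dist_diam d U \<noteq> top" using assms(1) by (auto simp: top_unique)
  ultimately show ?thesis
    by (metis enn2real_ennreal enn2real_mono enn2real_nonneg less_top linear order_trans)
qed

text \<open>Finite families are padded to sequences by the empty set, whose
  \<open>diam_power\<close> is 0.\<close>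

lemma hausdorff_nullI_finite_cover:
  assumes "s > 0"
    and cover: "\<And>\<delta> \<eta>. \<delta> > 0 \<Longrightarrow> \<eta> > 0 \<Longrightarrow>
      \<exists>\<U> \<rho>. finite \<U> \<and> A \<subseteq> \<Union>\<U> \<and> 0 \<le> \<rho> \<and>
          \<rho> \<le> \<delta> \<and> real (card \<U>) * \<rho> powr s < \<eta> \<and>
        (\<forall>U\<in>\<U>. U \<subseteq> M \<and> (\<forall>x\<in>U. \<forall>y\<in>U. d x y \<le> \<rho>))"
  shows "hausdorff_measure M d s A = 0"
  unfolding hausdorff_measure_eq_0_iff
proof (intro allI impI)
  fix \<delta> \<eta> :: real assume "\<delta> > 0" "\<eta> > 0"
  obtain \<U> \<rho> where U: "finite \<U>" "A \<subseteq> \<Union>\<U>" "0 \<le> \<rho>" "\<rho> \<le>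
      \<delta>" "real (card \<U>) * \<rho> powr s < \<eta>"
    "\<And>U. U \<in> \<U> \<Longrightarrow> U \<subseteq> M" "\<And>U x y. U \<in> \<U>
        \<Longrightarrow> x \<in> U \<Longrightarrow> y \<in> U \<Longrightarrow> d x y \<le> \<rho>"
    using cover[OF \<open>\<delta> > 0\<close> \<open>\<eta> > 0\<close>] by metis
  obtain us where us: "set us = \<U>" "length us = card \<U>"
    using finite_distinct_list[OF U(1)] distinct_card by metis
  define V where "V i = (if i < length us then us ! i else {})" for i
  have V: "V i \<in> \<U>" if "i < length us" for i using that us by (auto simp: V_def)
  have diam: "dist_diam d (V i) \<le> ennreal \<rho>" for i
  proof (rule dist_diam_le)
    show "d x y \<le> \<rho>" if "x \<in> V i" "y \<in> V i" for x y
      using that V[of i] U(7) by (cases "i < length us") (auto simp: V_def)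
  qed
  have "diam_power d s (V i) \<le> (if i < length us then ennreal (\<rho> powr s) else 0)" for i
  proof -
    have "enn2real (dist_diam d (V i)) \<le> \<rho>" using diam[of i] U(3) by (intro enn2real_leI) auto
    then have "enn2real (dist_diam d (V i)) powr s \<le> \<rho> powr s" using \<open>s > 0\<close> by
        (intro powr_mono2) auto
    then show ?thesis using \<open>s > 0\<close> by (auto simp: diam_power_def V_def ennreal_leI)
  qed
  then have "(\<Sum>i. diam_power d s (V i)) \<le> (\<Sum>i. if i < length us then ennreal (\<rho> powr s) else 0)"
    by (intro suminf_le) auto
  also have "\<dots> = (\<Sum>i<length us. ennreal (\<rho> powr s))"
    by (subst suminf_finite[of "{..<length us}"]) (auto intro!: sum.cong)
  also have "\<dots> = ennreal (real (card \<U>) * \<rho> powr s)"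
    using us by (simp add: ennreal_of_nat_eq_real_of_nat ennreal_mult)
  also have "\<dots> < ennreal \<eta>" using U(5) \<open>\<eta> > 0\<close> by (simp add: ennreal_lessI)
  finally have "(\<Sum>i. diam_power d s (V i)) < ennreal \<eta>" .
  moreover have "A \<subseteq> (\<Union>i. V i)"
  proof
    fix x assume "x \<in> A"
    then obtain W where "W \<in> \<U>" "x \<in> W" using U(2) by blast
    then obtain i where "i < length us" "us ! i = W" using us by (metis in_set_conv_nth)
    with \<open>x \<in> W\<close> show "x \<in> (\<Union>i. V i)" by (auto simp: V_def intro!: exI[of _ i])
  qed
  moreover have "V i \<subseteq> M" for i using V[of i] U(6) by (cases "i < length us") (auto simp: V_def)
  moreover have "dist_diam d (V i) \<le> ennreal \<delta>" for i
    using diam[of i] U(4) by (meson ennreal_leI order_trans)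
  ultimately show "\<exists>U. A \<subseteq> (\<Union>i. U i) \<and> (\<forall>i. U i \<subseteq> M
      \<and> dist_diam d (U i) \<le> ennreal \<delta>) \<and>
        (\<Sum>i. diam_power d s (U i)) < ennreal \<eta>"
    by blast
qed

section \<open>The Riemannian distance on projective space\<close>

context
  fixes g :: "complex^'n \<Rightarrow> complex^'n \<Rightarrow> complex^'n \<Rightarrow> real"
  assumes g: "proj_riemannian_metric g"
begin

lemma metric_bilinear: "x \<noteq> 0 \<Longrightarrow> bilinear (g x)"
  and metric_sym: "x \<noteq> 0 \<Longrightarrow> g x u v = g x v u"
  and metric_nonneg: "x \<noteq> 0 \<Longrightarrow> 0 \<le> g x u u"
  and metric_zero_iff: "x \<noteq> 0 \<Longrightarrow> g x u u = 0 \<longleftrightarrow> u \<in> vec.span {x}"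
  and metric_scale: "x \<noteq> 0 \<Longrightarrow> c \<noteq> 0 \<Longrightarrow> g (c *s x) (c *s u)
      (c *s v) = g x u v"
  using g unfolding proj_riemannian_metric_def by auto

lemma metric_continuous: "continuous_on (- {0}) (\<lambda>x. g x u v)"
proof -
  have "Ck_on 0 (\<lambda>x. g x u v) (- {0})" using g unfolding proj_riemannian_metric_def by blast
  then show ?thesis by simp
qed

text \<open>Smoothness of the metric is given for fixed vectors only. Expansion in a real basis
  turns it into joint continuity in point and vector, as compactness arguments require.\<close>

lemma metric_expand:
  assumes "x \<noteq> 0"
  shows "g x u v = (\<Sum>b\<in>Basis. \<Sum>c\<in>Basis. (u \<bullet> b) * (v \<bullet> c) * g x b c)"
proof -
  have "g x u v = g x (\<Sum>b\<in>Basis. (u \<bullet> b) *\<^sub>R b) (\<Sum>c\<in>Basis. (v \<bullet>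
      c) *\<^sub>R c)"
    by (simp add: euclidean_representation)
  also have "\<dots> = (\<Sum>(b, c)\<in>Basis \<times> Basis. g x ((u \<bullet> b) *\<^sub>R b) ((v
      \<bullet> c) *\<^sub>R c))"
    by (rule bilinear_sum[OF metric_bilinear[OF assms]])
  also have "\<dots> = (\<Sum>b\<in>Basis. \<Sum>c\<in>Basis. (u \<bullet> b) * (v \<bullet> c) * g x b c)"
    unfolding sum.cartesian_product
    using metric_bilinear[OF assms] by (intro sum.cong) (auto simp: bilinear_lmul bilinear_rmul)
  finally show ?thesis .
qed

lemma metric_continuous_joint: "continuous_on ((- {0}) \<times> UNIV) (\<lambda>p. g (fst p) (snd p) (snd p))"
proof -
  have "continuous_on ((- {0}) \<times> UNIV) (\<lambda>p. g (fst p) b c)" for b c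
    by (rule continuous_on_compose2[OF metric_continuous[of b c] continuous_on_fst[OF continuous_on_id]]) auto
  then have "continuous_on ((- {0}) \<times> UNIV) (\<lambda>p. \<Sum>b\<in>Basis. \<Sum>c\<in>Basis.
      (snd p \<bullet> b) * (snd p \<bullet> c) * g (fst p) b c)"
    by (intro continuous_intros)
  then show ?thesis
    by (subst continuous_on_cong[OF refl metric_expand]) auto
qed

lemma metric_upper_bound:
  assumes "compact K" "0 \<notin> K"
  obtains C where "C \<ge> 0" "\<And>x u. x \<in> K \<Longrightarrow> sqrt (g x u u) \<le> C * norm u"
proof -
  have "compact ((\<lambda>p. g (fst p) (snd p) (snd p)) ` (K \<times> sphere 0 1))"
    using assms
    by (intro compact_continuous_image compact_Times continuous_on_subset[OF metric_continuous_joint]) auto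
  then obtain M where M: "M > 0" "\<And>x u. x \<in> K \<Longrightarrow> norm u = 1 \<Longrightarrow>
      \<bar>g x u u\<bar> \<le> M"
    using compact_imp_bounded[THEN bounded_pos[THEN iffD1]] by force
  have "sqrt (g x u u) \<le> sqrt M * norm u" if x: "x \<in> K" for x u
  proof (cases "u = 0")
    case True
    have "x \<noteq> 0" using assms x by auto
    then show ?thesis using True bilinear_lzero[OF metric_bilinear] by simp
  next
    case False
    have x0: "x \<noteq> 0" using assms x by auto
    define w where "w = u /\<^sub>R norm u"
    have "norm w = 1" and u: "u = norm u *\<^sub>R w" using False by (auto simp: w_def)
    have "g x u u = (norm u)\<^sup>2 * g x w w"
      by (subst (1 2) u) (simp add: bilinear_lmul[OF metric_bilinear[OF x0]] bilinear_rmul[OF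
          metric_bilinear[OF x0]] power2_eq_square)
    also have "\<dots> \<le> (norm u)\<^sup>2 * M" using M(2)[OF x \<open>norm w = 1\<close>] by (intro
        mult_left_mono) auto
    finally have "sqrt (g x u u) \<le> sqrt ((norm u)\<^sup>2 * M)" by simp
    then show ?thesis by (simp add: real_sqrt_mult mult.commute)
  qed
  with M(1) show ?thesis by (intro that[of "sqrt M"]) auto
qed

lemma riem_length_linepath_le:
  assumes "\<And>z u. z \<in> closed_segment x y \<Longrightarrow> sqrt (g z u u) \<le> C * norm u"
  shows "riem_length g (linepath x y) \<le> ennreal (C * norm (y - x))"
proof -
  have "riem_length g (linepath x y) \<le> (\<integral>\<^sup>+t\<in>{0..1::real}. ennreal (C * norm (y
      - x)) \<partial>lborel)"
    unfolding riem_length_def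
  proof (rule nn_integral_mono)
    fix t :: real
    show "ennreal (sqrt (g (linepath x y t) (vector_derivative (linepath x y) (at t)) (vector_derivative
        (linepath x y) (at t)))) * indicator {0..1} t
      \<le> ennreal (C * norm (y - x)) * indicator {0..1} t"
      using assms[of "linepath x y t" "y - x"] linepath_in_path[of t x y]
      by (cases "t \<in> {0..1}") (auto intro: ennreal_leI)
  qed
  also have "\<dots> = ennreal (C * norm (y - x))" by (simp add: nn_integral_cmult)
  finally show ?thesis .
qed

lemma riem_dist_INF_le:
  assumes "0 \<notin> closed_segment x y" and "\<And>z u. z \<in> closed_segment x y \<Longrightarrow>
      sqrt (g z u u) \<le> C * norm u"
  shows "(INF \<gamma>\<in>{\<gamma>. valid_path \<gamma> \<and> 0 \<notin> path_image \<gamma> \<and>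
            pathstart \<gamma> \<in> vec.span {x} \<and> pathfinish \<gamma> \<in> vec.span {y}}.
                riem_length g \<gamma>) \<le> ennreal (C * norm (y - x))"
  using riem_length_linepath_le[OF assms(2)] assms(1)
  by (intro INF_lower2[of "linepath x y"]) (auto simp: vec.span_base)

text \<open>Straight segments in a convex compact set off the origin are admissible paths and bound
  the distance from above. In the application \<open>K\<close> is a bounded slice of an affine
  chart.\<close>

lemma riem_dist_le:
  assumes "compact K" "convex K" "0 \<notin> K"
  obtains C where "C \<ge> 0" "\<And>x y. x \<in> K \<Longrightarrow> y \<in> K \<Longrightarrow>
      riem_dist g (vec.span {x}) (vec.span {y}) \<le> C * norm (y - x)"
proof -
  obtain C where C: "C \<ge> 0" "\<And>x u. x \<in> K \<Longrightarrow> sqrt (g x u u) \<le> C * norm u"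
    using metric_upper_bound[OF assms(1,3)] by blast
  have "riem_dist g (vec.span {x}) (vec.span {y}) \<le> C * norm (y - x)" if "x \<in> K" "y \<in> K" for x y
  proof -
    have "closed_segment x y \<subseteq> K" using that assms(2) by (simp add: closed_segment_subset)
    then have "0 \<notin> closed_segment x y" "\<And>z u. z \<in> closed_segment x y \<Longrightarrow>
        sqrt (g z u u) \<le> C * norm u"
      using assms(3) C(2) by auto
    from riem_dist_INF_le[OF this] show ?thesis
      unfolding riem_dist_def using C(1) by (intro enn2real_leI) auto
  qed
  with C(1) show ?thesis by (rule that)
qed

text \<open>A null vector of a positive semidefinite form is orthogonal to everything: otherwise
  moving \<open>v\<close> along it by the chosen parameter would give the form the value -1.\<close>

lemma metric_kernel:
  assumes "x \<noteq> 0"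
  shows "g x (c *s x) v = 0"
proof -
  define w where "w = c *s x"
  have bl: "bilinear (g x)" by (rule metric_bilinear[OF assms])
  have ww: "g x w w = 0" using metric_zero_iff[OF assms, of w] by (auto simp: w_def vec.span_scale vec.span_base)
  have "0 \<le> g x v v + 2 * t * g x w v" for t
  proof -
    have "0 \<le> g x (v + t *\<^sub>R w) (v + t *\<^sub>R w)" by (rule metric_nonneg[OF assms])
    also have "\<dots> = g x v v + 2 * t * g x w v"
      using metric_sym[OF assms, of v w] ww
      by (simp add: bilinear_ladd[OF bl] bilinear_radd[OF bl] bilinear_lmul[OF bl] bilinear_rmul[OF bl])
    finally show ?thesis .
  qed
  from this[of "- (g x v v + 1) / (2 * g x w v)"] show ?thesis
    unfolding w_def[symmetric] by (cases "g x w v = 0") (auto simp: field_simps)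
qed

lemma metric_mod_kernel:
  assumes "x \<noteq> 0"
  shows "g x (u + c *s x) (u + c *s x) = g x u u"
  using metric_kernel[OF assms] metric_sym[OF assms, of u "c *s x"]
  by (simp add: bilinear_ladd[OF metric_bilinear[OF assms]] bilinear_radd[OF metric_bilinear[OF assms]])

end

text \<open>The Hermitian product, conjugate-linear in its second argument. Its orthogonality
  singles out the complement of a complex line, where the real inner product would give that of a
  real line.\<close>

definition herm :: "complex^'n \<Rightarrow> complex^'n \<Rightarrow> complex" where
  "herm u x = (\<Sum>i\<in>UNIV. u $ i * cnj (x $ i))"

lemma herm_self: "herm x x = complex_of_real ((norm x)\<^sup>2)"
  by (simp add: herm_def norm_vec_def L2_set_def complex_norm_square[symmetric] sum_nonneg)

lemma herm_diff_scale: "herm (u - c *s x) y = herm u y - c * herm x y"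
  by (simp add: herm_def left_diff_distrib sum_subtractf sum_distrib_left mult.assoc)

lemma continuous_on_herm: "continuous_on S (\<lambda>p. herm (snd p) (fst p))"
  unfolding herm_def by (intro continuous_intros)

text \<open>The derivative of a scale-invariant function kills the complex line through
  \<open>x\<close>, as the metric does. Removing the component along \<open>x\<close> and rescaling
  reduces the bound to pairs of Hermitian-orthogonal unit vectors, a compact set on which the metric
  has a positive lower bound.\<close>

lemma scale_invariant_derivative_bound:
  fixes h :: "complex^'n \<Rightarrow> real"
  assumes g: "proj_riemannian_metric g"
    and der: "\<And>x. x \<noteq> 0 \<Longrightarrow> (h has_derivative h' x) (at x)"
    and cont: "continuous_on ((- {0}) \<times> UNIV) (\<lambda>p. h' (fst p) (snd p))"
    and inv: "\<And>c x. c \<noteq> 0 \<Longrightarrow> h (c *s x) = h x"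
  obtains C where "C > 0" "\<And>x u. x \<noteq> 0 \<Longrightarrow> \<bar>h' x u\<bar> \<le> C * sqrt (g x u u)"
proof -
  have lin: "linear (h' x)" if "x \<noteq> 0" for x
    using der[OF that] has_derivative_bounded_linear bounded_linear.linear by blast
  have tang: "h' x (c *s x) = 0" if "x \<noteq> 0" for x c
  proof -
    have "((\<lambda>s::real. x + s *\<^sub>R (c *s x)) has_derivative (\<lambda>s. s *\<^sub>R (c *s x))) (at 0)"
      by (auto intro!: derivative_eq_intros)
    from diff_chain_at[OF this, of h "h' x"] der[OF that]
    have 1: "((\<lambda>s. h (x + s *\<^sub>R (c *s x))) has_derivative (\<lambda>s. h' x (s *\<^sub>R
        (c *s x)))) (at 0)"
      by (simp add: o_def)
    have "h (x + s *\<^sub>R (c *s x)) = h x" if "1 + of_real s * c \<noteq> 0" for s :: real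
    proof -
      have "x + s *\<^sub>R (c *s x) = (1 + of_real s * c) *s x"
        by (simp add: scaleR_eq_vector_scale vec.scale_left_distrib vec.scale_scale)
      then show ?thesis using inv[OF that] by simp
    qed
    moreover have "open {s::real. 1 + of_real s * c \<noteq> 0}"
      by (intro open_Collect_neq continuous_intros)
    ultimately have "((\<lambda>s. h (x + s *\<^sub>R (c *s x))) has_derivative (\<lambda>s. 0)) (at 0)"
      using has_derivative_transform_within_open[OF has_derivative_const[of "h x" "at 0"],
        of "{s::real. 1 + of_real s * c \<noteq> 0}" "\<lambda>s. h (x + s *\<^sub>R (c *s x))"] by simp
    with 1 have "(\<lambda>s. h' x (s *\<^sub>R (c *s x))) = (\<lambda>s. 0)" by (rule has_derivative_unique)
    from fun_cong[OF this, of 1] show ?thesis by simp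
  qed
  have scale: "h' (c *s x) (c *s u) = h' x u" if "x \<noteq> 0" "c \<noteq> 0" for x c u
  proof -
    have "bounded_linear (\<lambda>y::complex^'n. c *s y)"
      by (rule linear_conv_bounded_linear[THEN iffD1], rule linearI)
         (auto simp: vec.scale_right_distrib scaleR_eq_vector_scale vec.scale_scale mult.commute)
    from diff_chain_at[OF bounded_linear_imp_has_derivative[OF this] der[of "c *s x"]] that
    have "((\<lambda>y. h (c *s y)) has_derivative (\<lambda>u. h' (c *s x) (c *s u))) (at x)" by (simp add: o_def)
    moreover have "(\<lambda>y. h (c *s y)) = h" using inv[OF that(2)] by auto
    ultimately show ?thesis using has_derivative_unique der[OF that(1)] by metis
  qed
  define P where "P = {p::(complex^'n) \<times> (complex^'n). norm (fst p) = 1 \<and> norm (snd p) = 1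
      \<and> herm (snd p) (fst p) = 0}"
  have "compact P"
  proof -
    have "P = (sphere 0 1 \<times> sphere 0 1) \<inter> {p. herm (snd p) (fst p) = 0}" by (auto simp: P_def)
    moreover have "closed {p::(complex^'n) \<times> (complex^'n). herm (snd p) (fst p) = 0}"
      by (intro closed_Collect_eq continuous_on_herm continuous_on_const)
    ultimately show ?thesis by (simp add: compact_Int_closed compact_Times)
  qed
  have PS: "P \<subseteq> (- {0}) \<times> UNIV" by (auto simp: P_def)
  have pos: "g x u u > 0" if "(x, u) \<in> P" for x u
  proof -
    have x: "x \<noteq> 0" "norm x = 1" "norm u = 1" "herm u x = 0" using that by (auto simp: P_def)
    have "u \<notin> vec.span {x}"
    proof
      assume "u \<in> vec.span {x}"
      then obtain c where "u = c *s x" by (auto simp: vec.span_singleton)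
      then have "herm u x = c" using herm_self[of x] x(2) herm_diff_scale[of 0 "- c" x x] by (simp add: herm_def)
      with x \<open>u = c *s x\<close> show False by simp
    qed
    then show ?thesis using metric_zero_iff[OF g x(1)] metric_nonneg[OF g x(1)] by (metis less_eq_real_def)
  qed
  \<comment> \<open>In a one-dimensional ambient space \<open>P\<close> is empty, hence the case
    distinction.\<close>
  obtain m where m: "m > 0" "\<And>x u. (x, u) \<in> P \<Longrightarrow> m \<le> g x u u"
  proof (cases "P = {}")
    case True
    then show ?thesis using that[of 1] by auto
  next
    case False
    obtain p where p: "p \<in> P" "\<And>q. q \<in> P \<Longrightarrow> g (fst p) (snd p) (snd p) \<le>
        g (fst q) (snd q) (snd q)"
      using continuous_attains_inf[OF \<open>compact P\<close> False continuous_on_subset[OF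
          metric_continuous_joint[OF g] PS]] by blast
    show ?thesis
      using p pos[of "fst p" "snd p"] p(2)[of "(x, u)" for x u] by (intro that[of "g (fst p) (snd p)
          (snd p)"]) auto
  qed
  have "bounded ((\<lambda>p. h' (fst p) (snd p)) ` P)"
    by (intro compact_imp_bounded compact_continuous_image continuous_on_subset[OF cont PS]
        \<open>compact P\<close>)
  then obtain B where B: "B > 0" "\<And>x u. (x, u) \<in> P \<Longrightarrow> \<bar>h' x u\<bar> \<le> B"
    unfolding bounded_pos by force
  have unit: "\<bar>h' x u\<bar> \<le> B / sqrt m * sqrt (g x u u)" if x: "norm x = 1" for x u
  proof -
    have "x \<noteq> 0" using x by auto
    define v where "v = u - herm u x *s x"
    have u: "u = v + herm u x *s x" by (simp add: v_def)
    have hv: "herm v x = 0"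
    proof -
      have "herm v x = herm u x - herm u x * herm x x" unfolding v_def by (rule herm_diff_scale)
      then show ?thesis using herm_self[of x] x by simp
    qed
    have hu: "h' x u = h' x v"
      by (subst u) (simp add: linear_add[OF lin[OF \<open>x \<noteq> 0\<close>]] tang[OF \<open>x
          \<noteq> 0\<close>])
    have gu: "g x u u = g x v v" by (subst (1 2) u) (rule metric_mod_kernel[OF g \<open>x \<noteq> 0\<close>])
    show ?thesis
    proof (cases "v = 0")
      case True
      then show ?thesis
        unfolding hu using B m metric_nonneg[OF g \<open>x \<noteq> 0\<close>, of u] linear_0[OF lin[OF
            \<open>x \<noteq> 0\<close>]] by simp
    next
      case False
      define w where "w = v /\<^sub>R norm v"
      have "norm w = 1" and v: "v = norm v *\<^sub>R w" using False by (auto simp: w_def)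
      have "herm w x = 0"
        using hv herm_diff_scale[of 0 "- complex_of_real (inverse (norm v))" v x]
        unfolding w_def scaleR_eq_vector_scale by (simp add: herm_def del: of_real_inverse)
      then have P: "(x, w) \<in> P" using x \<open>norm w = 1\<close> by (simp add: P_def)
      have "g x v v = (norm v)\<^sup>2 * g x w w"
        by (subst (1 2) v) (simp add: bilinear_lmul[OF metric_bilinear[OF g \<open>x \<noteq>
            0\<close>]] bilinear_rmul[OF metric_bilinear[OF g \<open>x \<noteq> 0\<close>]] power2_eq_square)
      then have "sqrt (g x v v) = norm v * sqrt (g x w w)" by (simp add: real_sqrt_mult)
      moreover have "norm v * sqrt m \<le> norm v * sqrt (g x w w)" using m(2)[OF P] by (intro mult_left_mono) auto
      ultimately have "norm v \<le> sqrt (g x v v) / sqrt m" using m(1) by (simp add: field_simps)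
      then have "norm v * B \<le> sqrt (g x v v) / sqrt m * B" using B by (intro mult_right_mono) auto
      moreover have "\<bar>h' x v\<bar> = norm v * \<bar>h' x w\<bar>"
        by (subst v) (simp add: linear_scale[OF lin[OF \<open>x \<noteq> 0\<close>]] abs_mult)
      moreover have "norm v * \<bar>h' x w\<bar> \<le> norm v * B" using B(2)[OF P] by (intro mult_left_mono) auto
      ultimately show ?thesis unfolding hu gu by (simp add: mult_ac)
    qed
  qed
  have "\<bar>h' x u\<bar> \<le> B / sqrt m * sqrt (g x u u)" if x: "x \<noteq> 0" for x u
  proof -
    \<comment> \<open>Both sides are invariant under scaling point and vector together, so
      \<open>x\<close> may be normalised.\<close>
    define c where "c = complex_of_real (1 / norm x)"
    have "c \<noteq> 0" using x by (simp add: c_def)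
    have "norm (c *s x) = 1" using x by (simp add: norm_vector_scale c_def norm_divide)
    from unit[OF this, of "c *s u"] show ?thesis
      using scale[OF x \<open>c \<noteq> 0\<close>] metric_scale[OF g x \<open>c \<noteq> 0\<close>] by simp
  qed
  then show ?thesis using B m by (intro that[of "B / sqrt m"]) auto
qed

text \<open>The fundamental theorem of calculus with the derivative estimate inserted. A valid path
  has a continuous derivative only off a finite set, so the integrands are cut off to the complement
  \<open>D\<close> to make them measurable; for infinite length the bound is trivial.\<close>

lemma path_variation_le_riem_length:
  fixes h :: "complex^'n \<Rightarrow> real"
  assumes g: "proj_riemannian_metric g"
    and der: "\<And>x. x \<noteq> 0 \<Longrightarrow> (h has_derivative h' x) (at x)"
    and cont: "continuous_on ((- {0}) \<times> UNIV) (\<lambda>p. h' (fst p) (snd p))"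
    and C: "C > 0" "\<And>x u. x \<noteq> 0 \<Longrightarrow> \<bar>h' x u\<bar> \<le> C * sqrt (g x u u)"
    and \<gamma>: "valid_path \<gamma>" "0 \<notin> path_image \<gamma>"
  shows "ennreal \<bar>h (pathfinish \<gamma>) - h (pathstart \<gamma>)\<bar> \<le> ennreal C *
      riem_length g \<gamma>"
proof -
  obtain S where S: "continuous_on {0..1} \<gamma>" "finite S"
    "\<And>t. t \<in> {0..1} - S \<Longrightarrow> \<gamma> differentiable at t" "continuous_on ({0..1}
        - S) (\<lambda>t. vector_derivative \<gamma> (at t))"
    using \<gamma>(1) unfolding valid_path_def piecewise_C1_differentiable_on_def C1_differentiable_on_eq by blast
  define D where "D = {0..1::real} - S"
  have D: "D \<in> sets borel" using S(2) by (auto simp: D_def intro: borel_closed finite_imp_closed)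
  have nz: "\<gamma> t \<noteq> 0" if "t \<in> {0..1}" for t using that \<gamma>(2) by (auto simp: path_image_def)
  define v where "v t = vector_derivative \<gamma> (at t)" for t
  have contD: "continuous_on D (\<lambda>t. (\<gamma> t, v t))"
    using S nz by (auto simp: D_def v_def intro!: continuous_intros intro: continuous_on_subset)
  have imD: "(\<lambda>t. (\<gamma> t, v t)) ` D \<subseteq> (- {0}) \<times> UNIV" using nz by (auto simp: D_def)
  define f' where "f' t = h' (\<gamma> t) (v t)" for t
  define G where "G t = indicator D t *\<^sub>R sqrt (g (\<gamma> t) (v t) (v t))" for t
  define H where "H t = indicator D t *\<^sub>R f' t" for t
  have "continuous_on D f'"
    unfolding f'_def using continuous_on_compose2[OF cont contD imD] by simp
  then have Hm: "H \<in> borel_measurable borel" unfolding H_def by (rule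
      borel_measurable_continuous_on_indicator[OF D])
  have "continuous_on D (\<lambda>t. sqrt (g (\<gamma> t) (v t) (v t)))"
    using continuous_on_compose2[OF metric_continuous_joint[OF g] contD imD] by (intro continuous_intros) simp
  then have Gm: "G \<in> borel_measurable borel" unfolding G_def by (rule
      borel_measurable_continuous_on_indicator[OF D])
  \<comment> \<open>The finitely many exceptional parameters form a null set, so the cut-off
    preserves the length.\<close>
  have len: "riem_length g \<gamma> = (\<integral>\<^sup>+t. ennreal (G t) \<partial>lborel)"
    unfolding riem_length_def
  proof (rule nn_integral_cong_AE)
    have "AE t in lborel. t \<notin> S"
      using S(2) by (intro AE_not_in finite_imp_null_set_lborel)
    then show "AE t in lborel. ennreal (sqrt (g (\<gamma> t) (vector_derivative \<gamma> (at t))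
        (vector_derivative \<gamma> (at t)))) * indicator {0..1} t = ennreal (G t)"
      by eventually_elim (auto simp: G_def D_def v_def indicator_def)
  qed
  have bound: "(\<integral>\<^sup>+t. ennreal (norm (H t)) \<partial>lborel) \<le> ennreal C *
      riem_length g \<gamma>"
  proof -
    have "(\<integral>\<^sup>+t. ennreal (norm (H t)) \<partial>lborel) \<le> (\<integral>\<^sup>+t.
        ennreal C * ennreal (G t) \<partial>lborel)"
    proof (rule nn_integral_mono)
      fix t
      have "norm (H t) \<le> C * G t"
        using C(2)[of "\<gamma> t" "v t"] nz by (auto simp: H_def G_def f'_def D_def indicator_def)
      then show "ennreal (norm (H t)) \<le> ennreal C * ennreal (G t)"
        using C(1) by (simp add: ennreal_leI flip: ennreal_mult')
    qed
    also have "\<dots> = ennreal C * riem_length g \<gamma>" unfolding len using Gm by (intro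
        nn_integral_cmult) simp
    finally show ?thesis .
  qed
  show ?thesis
  proof (cases "riem_length g \<gamma> = top")
    case True
    then show ?thesis using C(1) by (simp add: ennreal_mult_top)
  next
    case False
    then have "(\<integral>\<^sup>+t. ennreal (norm (H t)) \<partial>lborel) < \<infinity>"
      using bound by (metis ennreal_mult_less_top ennreal_less_top infinity_ennreal_def less_top
          order_le_less_trans)
    then have int: "integrable lborel H" using Hm by (intro integrableI_bounded) auto
    have f: "(f' has_integral (h (\<gamma> 1) - h (\<gamma> 0))) {0..1}"
    proof (rule fundamental_theorem_of_calculus_interior_strong[OF S(2)])
      show "continuous_on {0..1} (\<lambda>t. h (\<gamma> t))"
      proof (rule continuous_on_compose2[OF _ S(1)])
        show "continuous_on (- {0}) h"
          using der by (auto intro!: continuous_at_imp_continuous_on has_derivative_continuous)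
      qed (use nz in auto)
      fix t assume t: "t \<in> {0<..<1} - S"
      then have "(\<gamma> has_vector_derivative v t) (at t)"
        using S(3) unfolding v_def by (intro vector_derivative_works[THEN iffD1]) auto
      from diff_chain_at[OF this[unfolded has_vector_derivative_def] der[OF nz]] t
      have "((\<lambda>t. h (\<gamma> t)) has_derivative (\<lambda>s. h' (\<gamma> t) (s *\<^sub>R v
          t))) (at t)" by (simp add: o_def)
      moreover have "linear (h' (\<gamma> t))"
        using der[OF nz, of t] t has_derivative_bounded_linear bounded_linear.linear by fastforce
      ultimately show "((\<lambda>t. h (\<gamma> t)) has_vector_derivative f' t) (at t)"
        unfolding has_vector_derivative_def f'_def by (simp add: linear_scale)
    qed simp
    have "((\<lambda>t. if t \<in> {0..1} then f' t else 0) has_integral (h (\<gamma> 1) - h (\<gamma> 0))) UNIV"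
      using f by (simp only: has_integral_restrict_UNIV)
    then have "(H has_integral (h (\<gamma> 1) - h (\<gamma> 0))) UNIV"
      by (rule has_integral_spike_finite[OF S(2), rotated]) (auto simp: H_def D_def indicator_def)
    with has_integral_integral_lborel[OF int] have "integral\<^sup>L lborel H = h (\<gamma> 1) - h (\<gamma> 0)"
      by (rule has_integral_unique)
    then show ?thesis
      using integral_norm_bound_ennreal[OF int] bound by (simp add: pathstart_def pathfinish_def)
  qed
qed

text \<open>The variation estimate holds for every admissible path whatever representatives it
  joins, since \<open>h\<close> is constant on punctured lines; so the infimum inherits it. Because
  \<open>riem_dist\<close> turns an infinite infimum into 0, a path of finite length has to be
  exhibited too.\<close>

lemma scale_invariant_riem_lipschitz:
  fixes h :: "complex^'n \<Rightarrow> real"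
  assumes g: "proj_riemannian_metric g"
    and der: "\<And>x. x \<noteq> 0 \<Longrightarrow> (h has_derivative h' x) (at x)"
    and cont: "continuous_on ((- {0}) \<times> UNIV) (\<lambda>p. h' (fst p) (snd p))"
    and inv: "\<And>c x. c \<noteq> 0 \<Longrightarrow> h (c *s x) = h x"
  obtains C where "C > 0"
    "\<And>x y. x \<noteq> 0 \<Longrightarrow> y \<noteq> 0 \<Longrightarrow> \<bar>h x - h y\<bar>
        \<le> C * riem_dist g (vec.span {x}) (vec.span {y})"
proof -
  obtain C where C: "C > 0" "\<And>x u. x \<noteq> 0 \<Longrightarrow> \<bar>h' x u\<bar> \<le> C * sqrt (g x u u)"
    using scale_invariant_derivative_bound[OF assms] by blast
  have "\<bar>h x - h y\<bar> \<le> C * riem_dist g (vec.span {x}) (vec.span {y})" if x: "x \<noteq> 0"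
      and y: "y \<noteq> 0" for x y
  proof -
    let ?\<Gamma> = "{\<gamma>. valid_path \<gamma> \<and> 0 \<notin> path_image \<gamma> \<and>
        pathstart \<gamma> \<in> vec.span {x} \<and> pathfinish \<gamma> \<in> vec.span {y}}"
    have const: "h z = h w" if "z \<in> vec.span {w}" "z \<noteq> 0" for z w
    proof -
      obtain c where "z = c *s w" using \<open>z \<in> vec.span {w}\<close> by (auto simp: vec.span_singleton)
      with \<open>z \<noteq> 0\<close> show ?thesis using inv[of c w] by auto
    qed
    show ?thesis
    proof (cases "0 \<in> closed_segment x y")
      case True
      \<comment> \<open>A segment through 0 means that both points span the same complex line, where
        \<open>h\<close> takes one value.\<close>
      then obtain t where t: "0 \<le> t" "t \<le> 1" "(1 - t) *\<^sub>R x + t *\<^sub>R y = 0" by (auto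
          simp: in_segment)
      have "t \<noteq> 1" using t(3) y by auto
      have "(1 - t) *\<^sub>R x = - (t *\<^sub>R y)" using t(3) by (simp add: eq_neg_iff_add_eq_0)
      then have "(1 / (1 - t)) *\<^sub>R ((1 - t) *\<^sub>R x) = (1 / (1 - t)) *\<^sub>R (- (t *\<^sub>R
          y))" by simp
      then have "x = (- t / (1 - t)) *\<^sub>R y" using \<open>t \<noteq> 1\<close> by simp
      then have "x \<in> vec.span {y}" by (metis scaleR_eq_vector_scale vec.span_singleton rangeI)
      then have "h x = h y" using const x by blast
      then show ?thesis using C(1) by (simp add: riem_dist_def)
    next
      case False
      obtain B where "B \<ge> 0" "\<And>z u. z \<in> closed_segment x y \<Longrightarrow> sqrt (g z u u)
          \<le> B * norm u"
        using metric_upper_bound[OF g _ False] by (metis compact_segment)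
      \<comment> \<open>The segment has finite length, which excludes the value
        \<open>top\<close>.\<close>
      from riem_dist_INF_le[OF g False this(2)]
      have fin: "(INF \<gamma>\<in>?\<Gamma>. riem_length g \<gamma>) \<noteq> top" by (metis
          ennreal_less_top less_top order_le_less_trans)
      have "ennreal (\<bar>h x - h y\<bar> / C) \<le> (INF \<gamma>\<in>?\<Gamma>. riem_length g \<gamma>)"
      proof (rule INF_greatest)
        fix \<gamma> assume "\<gamma> \<in> ?\<Gamma>"
        then have \<gamma>: "valid_path \<gamma>" "0 \<notin> path_image \<gamma>" "pathstart \<gamma>
            \<in> vec.span {x}" "pathfinish \<gamma> \<in> vec.span {y}" by auto
        have "pathstart \<gamma> \<noteq> 0" "pathfinish \<gamma> \<noteq> 0" using \<gamma>(2)
            pathstart_in_path_image pathfinish_in_path_image by metis+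
        then have "\<bar>h x - h y\<bar> = \<bar>h (pathfinish \<gamma>) - h (pathstart \<gamma>)\<bar>"
            using const[OF \<gamma>(3)] const[OF \<gamma>(4)] by simp
        then have le: "ennreal \<bar>h x - h y\<bar> \<le> ennreal C * riem_length g \<gamma>"
          using path_variation_le_riem_length[OF g der cont C \<gamma>(1,2)] by simp
        show "ennreal (\<bar>h x - h y\<bar> / C) \<le> riem_length g \<gamma>"
        proof (cases "riem_length g \<gamma>")
          case (real r)
          then show ?thesis using le C(1) by (auto simp: field_simps ennreal_le_iff simp flip: ennreal_mult')
        qed simp
      qed
      then have "\<bar>h x - h y\<bar> / C \<le> riem_dist g (vec.span {x}) (vec.span {y})"
        unfolding riem_dist_def using fin C(1)
        by (metis (no_types, lifting) abs_ge_zero divide_nonneg_pos enn2real_ennreal enn2real_mono less_top)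
      then show ?thesis using C(1) by (simp add: field_simps)
    qed
  qed
  with C(1) show ?thesis by (rule that)
qed

section \<open>Cones meeting every plane\<close>

text \<open>
  These quotients are smooth on all of projective space, so comparing them along a path does not
  require the path to stay inside an affine chart.
\<close>

lemma rayleigh_quotient_lipschitz:
  fixes \<Lambda> :: "complex^'n \<Rightarrow> complex^'k"
  assumes g: "proj_riemannian_metric g" and \<Lambda>: "Vector_Spaces.linear (*s) (*s) \<Lambda>"
  obtains C where "C > 0" "\<And>x y. x \<noteq> 0 \<Longrightarrow> y \<noteq> 0 \<Longrightarrow>
     \<bar>Re (c * (\<Lambda> x $ i * cnj (\<Lambda> x $ j))) / (x \<bullet> x) - Re (c * (\<Lambda> y $
         i * cnj (\<Lambda> y $ j))) / (y \<bullet> y)\<bar>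
       \<le> C * riem_dist g (vec.span {x}) (vec.span {y})"
proof -
  interpret \<Lambda>: Vector_Spaces.linear "(*s)" "(*s)" \<Lambda> by (rule \<Lambda>)
  have bl: "bounded_linear (\<lambda>x. \<Lambda> x $ i)" for i
    by (rule bounded_linear_compose[OF bounded_linear_vec_nth vec_linear_imp_bounded_linear[OF \<Lambda>]])
  have D: "((\<lambda>x. \<Lambda> x $ i) has_derivative (\<lambda>u. \<Lambda> u $ i)) (at x)" for i x
    by (rule bounded_linear_imp_has_derivative[OF bl])
  define q where "q x y = Re (c * (\<Lambda> x $ i * cnj (\<Lambda> y $ j)))" for x y
  have Dq: "((\<lambda>x. q x x) has_derivative (\<lambda>u. q x u + q u x)) (at x)" for x
    unfolding q_def by (auto intro!: derivative_eq_intros D simp: algebra_simps)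
  define h where "h x = q x x / (x \<bullet> x)" for x
  define h' where "h' x u = ((q x u + q u x) * (x \<bullet> x) - q x x * (2 * (x \<bullet> u))) / (x
      \<bullet> x)\<^sup>2" for x u
  have der: "(h has_derivative h' x) (at x)" if "x \<noteq> 0" for x
  proof -
    have "(h has_derivative (\<lambda>u. ((q x u + q u x) * (x \<bullet> x) - q x x * (x \<bullet> u + u
        \<bullet> x)) / ((x \<bullet> x) * (x \<bullet> x)))) (at x)"
      unfolding h_def
      by (rule has_derivative_divide'[OF Dq]) (use that in \<open>auto intro!: derivative_eq_intros\<close>)
    then show ?thesis by (simp add: h'_def[abs_def] inner_commute power2_eq_square)
  qed
  have contq: "continuous_on S a \<Longrightarrow> continuous_on S b \<Longrightarrow> continuous_on S
      (\<lambda>p. q (a p) (b p))"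
    for S :: "((complex^'n) \<times> (complex^'n)) set" and a b
    unfolding q_def by (intro continuous_intros bounded_linear.continuous_on[OF bl])
  have cont: "continuous_on ((- {0}) \<times> UNIV) (\<lambda>p. h' (fst p) (snd p))"
    unfolding h'_def by (intro continuous_intros contq) auto
  have inv: "h (s *s x) = h x" if "s \<noteq> 0" for s x
  proof -
    have "q (s *s x) (s *s x) = (norm s)\<^sup>2 * q x x"
    proof -
      have "c * (\<Lambda> (s *s x) $ i * cnj (\<Lambda> (s *s x) $ j)) = (s * cnj s) * (c * (\<Lambda>
          x $ i * cnj (\<Lambda> x $ j)))"
        by (simp add: \<Lambda>.scale mult_ac)
      also have "s * cnj s = complex_of_real ((norm s)\<^sup>2)" by (simp only: complex_norm_square)
      finally have eq: "c * (\<Lambda> (s *s x) $ i * cnj (\<Lambda> (s *s x) $ j)) =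
        complex_of_real ((norm s)\<^sup>2) * (c * (\<Lambda> x $ i * cnj (\<Lambda> x $ j)))" .
      have R: "Re (complex_of_real a * z) = a * Re z" for a z by simp
      show ?thesis unfolding q_def eq R ..
    qed
    moreover have "(s *s x) \<bullet> (s *s x) = (norm s)\<^sup>2 * (x \<bullet> x)"
      by (simp add: dot_square_norm norm_vector_scale power_mult_distrib)
    ultimately show ?thesis using that by (simp add: h_def)
  qed
  show ?thesis
    using scale_invariant_riem_lipschitz[OF g der cont inv] that unfolding h_def q_def by blast
qed

text \<open>The chart coordinate \<open>w $ i\<close> is the quotient of \<open>Q (Some i)\<close>
  by \<open>Q None\<close>, both Lipschitz on all of projective space. The constant \<kappa> keeps
  the denominator away from 0 at the two lines compared; nothing is asked of the lines between
  them.\<close>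

lemma quotient_coordinate_lipschitz:
  fixes \<Lambda> :: "complex^'n \<Rightarrow> complex^('d::finite option)"
  assumes g: "proj_riemannian_metric g" and \<Lambda>: "Vector_Spaces.linear (*s) (*s) \<Lambda>" and
      "\<kappa> > 0"
  obtains C where "C > 0" "\<And>x y w w'. x \<noteq> 0 \<Longrightarrow> y \<noteq> 0 \<Longrightarrow>
     \<kappa> * norm x \<le> norm (\<Lambda> x $ None) \<Longrightarrow> \<kappa> * norm y \<le> norm
         (\<Lambda> y $ None) \<Longrightarrow>
     (\<And>i. \<Lambda> x $ Some i = w $ i * \<Lambda> x $ None) \<Longrightarrow> (\<And>i. \<Lambda>
         y $ Some i = w' $ i * \<Lambda> y $ None) \<Longrightarrow>
     norm (w - w') \<le> C * riem_dist g (vec.span {x}) (vec.span {y})"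
proof -
  define \<rho> where "\<rho> x y = riem_dist g (vec.span {x}) (vec.span {y})" for x y
  have \<rho>0: "\<rho> x y \<ge> 0" for x y by (simp add: \<rho>_def riem_dist_def)
  define Q where "Q i x = \<Lambda> x $ i * cnj (\<Lambda> x $ None) / of_real (x \<bullet> x)" for i x
  have "\<exists>C>0. \<forall>x y. x \<noteq> 0 \<longrightarrow> y \<noteq> 0 \<longrightarrow> norm
      (Q i x - Q i y) \<le> C * \<rho> x y" for i
  proof -
    obtain C1 where C1: "C1 > 0" "\<And>x y. x \<noteq> 0 \<Longrightarrow> y \<noteq> 0 \<Longrightarrow>
     \<bar>Re (1 * (\<Lambda> x $ i * cnj (\<Lambda> x $ None))) / (x \<bullet> x) - Re (1 * (\<Lambda>
         y $ i * cnj (\<Lambda> y $ None))) / (y \<bullet> y)\<bar> \<le> C1 * \<rho> x y"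
      using rayleigh_quotient_lipschitz[OF g \<Lambda>, of 1 i None] unfolding \<rho>_def by blast
    \<comment> \<open>Multiplication by \<open>- \<i>\<close> turns the imaginary part into a real
      part.\<close>
    obtain C2 where C2: "C2 > 0" "\<And>x y. x \<noteq> 0 \<Longrightarrow> y \<noteq> 0 \<Longrightarrow>
     \<bar>Re (- \<i> * (\<Lambda> x $ i * cnj (\<Lambda> x $ None))) / (x \<bullet> x) - Re (- \<i> *
         (\<Lambda> y $ i * cnj (\<Lambda> y $ None))) / (y \<bullet> y)\<bar> \<le> C2 * \<rho> x y"
      using rayleigh_quotient_lipschitz[OF g \<Lambda>, of "- \<i>" i None] unfolding \<rho>_def by blast
    have "norm (Q i x - Q i y) \<le> (C1 + C2) * \<rho> x y" if "x \<noteq> 0" "y \<noteq> 0" for x y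
    proof -
      have R: "Re (Q i x) = Re (1 * (\<Lambda> x $ i * cnj (\<Lambda> x $ None))) / (x \<bullet> x)"
        "Im (Q i x) = Re (- \<i> * (\<Lambda> x $ i * cnj (\<Lambda> x $ None))) / (x \<bullet> x)" for x
        unfolding Q_def by (simp_all only: Re_divide_of_real Im_divide_of_real) (simp_all add: algebra_simps)
      have "norm (Q i x - Q i y) \<le> \<bar>Re (Q i x - Q i y)\<bar> + \<bar>Im (Q i x - Q i y)\<bar>"
          by (rule cmod_le)
      also have "\<dots> \<le> C1 * \<rho> x y + C2 * \<rho> x y"
        using C1(2)[OF that] C2(2)[OF that] unfolding minus_complex.sel R by (intro add_mono)
      finally show ?thesis by (simp add: algebra_simps)
    qed
    then show ?thesis using C1 C2 by (intro exI[of _ "C1 + C2"]) auto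
  qed
  then obtain K where K: "\<And>i. K i > 0" "\<And>i x y. x \<noteq> 0 \<Longrightarrow> y \<noteq> 0
      \<Longrightarrow> norm (Q i x - Q i y) \<le> K i * \<rho> x y"
    by metis
  obtain B where B: "\<And>x. norm (\<Lambda> x) \<le> norm x * B" "B > 0"
    using bounded_linear.pos_bounded[OF vec_linear_imp_bounded_linear[OF \<Lambda>]] by blast
  have QB: "norm (Q i x) \<le> B\<^sup>2" for i x
  proof (cases "x = 0")
    case False
    have "norm (\<Lambda> x $ i) * norm (\<Lambda> x $ None) \<le> (norm x * B) * (norm x * B)"
      using Finite_Cartesian_Product.norm_nth_le[of "\<Lambda> x"] B by (intro mult_mono) (auto intro: order_trans)
    also have "\<dots> = B\<^sup>2 * (x \<bullet> x)" by (simp add: dot_square_norm power2_eq_square)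
    finally show ?thesis using False by (simp add: Q_def norm_divide norm_mult divide_le_eq)
  qed (simp add: Q_def)
  have QN: "Q None x = of_real ((norm (\<Lambda> x $ None))\<^sup>2 / (x \<bullet> x))" for x
    unfolding Q_def of_real_divide complex_norm_square ..
  define C where "C = (\<Sum>i\<in>(UNIV::'d set). K (Some i) / \<kappa>\<^sup>2 + B\<^sup>2 * K None /
      (\<kappa>\<^sup>2 * \<kappa>\<^sup>2))"
  show ?thesis
  proof (rule that[of C])
    show "C > 0" unfolding C_def using K(1) B(2) \<open>\<kappa> > 0\<close> by (intro sum_pos add_pos_pos) auto
    fix x y w w'
    assume x: "x \<noteq> 0" "\<kappa> * norm x \<le> norm (\<Lambda> x $ None)" "\<And>i. \<Lambda> x $
        Some i = w $ i * \<Lambda> x $ None"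
      and y: "y \<noteq> 0" "\<kappa> * norm y \<le> norm (\<Lambda> y $ None)" "\<And>i. \<Lambda> y $
          Some i = w' $ i * \<Lambda> y $ None"
    have low: "\<kappa>\<^sup>2 \<le> norm (Q None z)" if "z \<noteq> 0" "\<kappa> * norm z \<le> norm
        (\<Lambda> z $ None)" for z
    proof -
      have "(\<kappa> * norm z)\<^sup>2 \<le> (norm (\<Lambda> z $ None))\<^sup>2" using that
          \<open>\<kappa> > 0\<close> by (intro power_mono) auto
      then have "\<kappa>\<^sup>2 \<le> (norm (\<Lambda> z $ None))\<^sup>2 / (z \<bullet> z)"
        using that by (simp add: dot_square_norm power_mult_distrib field_simps)
      then show ?thesis unfolding QN norm_of_real by (rule order_trans) simp
    qed
    have comp: "norm ((w - w') $ i) \<le> (K (Some i) / \<kappa>\<^sup>2 + B\<^sup>2 * K None /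
        (\<kappa>\<^sup>2 * \<kappa>\<^sup>2)) * \<rho> x y" for i
    proof -
      define a b a' b' where ab: "a = Q (Some i) x" "b = Q None x" "a' = Q (Some i) y" "b' = Q None y"
      have nb: "\<kappa>\<^sup>2 \<le> norm b" "\<kappa>\<^sup>2 \<le> norm b'" using low x y by (auto simp: ab)
      then have b0: "b \<noteq> 0" "b' \<noteq> 0" using \<open>\<kappa> > 0\<close> by auto
      have "a = w $ i * b" "a' = w' $ i * b'" using x(3) y(3) by (auto simp: ab Q_def)
      then have "(w - w') $ i = a / b - a' / b'" using b0 by simp
      also have "\<dots> = (a - a') / b + a' * (b' - b) / (b * b')" using b0 by (simp add: field_simps)
      finally have "norm ((w - w') $ i) \<le> norm (a - a') / norm b + norm a' * norm (b' - b) / (norm b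
          * norm b')"
        by (metis norm_divide norm_mult norm_triangle_ineq)
      also have "\<dots> \<le> (K (Some i) * \<rho> x y) / \<kappa>\<^sup>2 + B\<^sup>2 * (K None *
          \<rho> x y) / (\<kappa>\<^sup>2 * \<kappa>\<^sup>2)"
      proof (intro add_mono frac_le mult_mono)
        show "norm (a - a') \<le> K (Some i) * \<rho> x y" "norm (b' - b) \<le> K None * \<rho> x y"
            "norm a' \<le> B\<^sup>2"
          using K(2)[OF x(1) y(1)] QB by (auto simp: ab norm_minus_commute)
      qed (use nb \<open>\<kappa> > 0\<close> \<rho>0 K(1)[THEN less_imp_le] in \<open>auto intro!:
          mult_nonneg_nonneg\<close>)
      finally show ?thesis by (simp add: algebra_simps add_divide_distrib)
    qed
    have "norm (w - w') \<le> (\<Sum>i\<in>UNIV. norm ((w - w') $ i))" unfolding norm_vec_def by (rule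
        L2_set_le_sum) simp
    also have "\<dots> \<le> C * \<rho> x y" unfolding C_def sum_distrib_right by (intro sum_mono comp)
    finally show "norm (w - w') \<le> C * riem_dist g (vec.span {x}) (vec.span {y})" by (simp add: \<rho>_def)
  qed
qed

text \<open>Maximality of \<open>L0\<close> among the subspaces missing \<open>T\<close> means that
  adjoining any \<open>b\<close> outside \<open>L0\<close> produces a vector of \<open>T\<close>,
  necessarily with nonzero component along \<open>b\<close>. Taking \<open>b\<close> above the point
  with affine coordinates \<open>w\<close> shows that \<open>T\<close> covers the whole
  chart.\<close>

lemma projection_onto_affine_chart:
  fixes T :: "(complex^'n) set"
  assumes meets: "\<And>L. vec.subspace L \<Longrightarrow> vec.dim L + CARD('d::finite) = CARD('n)
      \<Longrightarrow> \<exists>v\<in>T. v \<noteq> 0 \<and> v \<in> L"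
    and d: "CARD('d::finite) < CARD('n)"
  obtains \<Lambda> :: "complex^'n \<Rightarrow> complex^('d::finite option)" where
      "Vector_Spaces.linear (*s) (*s) \<Lambda>"
    "\<And>w :: complex^'d. \<exists>v\<in>T. v \<noteq> 0 \<and> \<Lambda> v $ None \<noteq> 0 \<and>
        (\<forall>i. \<Lambda> v $ Some i = w $ i * \<Lambda> v $ None)"
proof -
  define missing where "missing L \<longleftrightarrow> vec.subspace L \<and> (\<forall>v\<in>T. v \<in>
      L \<longrightarrow> v = 0)" for L
  have "missing {0}" by (auto simp: missing_def)
  moreover have "vec.dim L < CARD('n) + 1" for L :: "(complex^'n) set"
    using dim_subset_UNIV_cart_gen[of L] by simp
  ultimately obtain L0 where L0: "missing L0" "\<And>L. missing L \<Longrightarrow> vec.dim L \<le> vec.dim L0"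
    using ex_has_greatest_nat[of missing "{0}" vec.dim "CARD('n) + 1"] by blast
  have sub0: "vec.subspace L0" using L0 by (simp add: missing_def)
  \<comment> \<open>Otherwise \<open>L0\<close> would contain a subspace of codimension CARD('d),
    which meets \<open>T\<close>. The strict inequality leaves room for the additional coordinate
    \<open>None\<close>.\<close>
  have "vec.dim L0 + CARD('d) < CARD('n)"
  proof (rule ccontr)
    assume "\<not> ?thesis"
    then have "CARD('n) - CARD('d) \<le> vec.dim L0" by simp
    then obtain L where L: "vec.subspace L" "L \<subseteq> vec.span L0" "vec.dim L = CARD('n) - CARD('d)"
      using vec.choose_subspace_of_subspace by blast
    have "vec.dim L + CARD('d) = CARD('n)" using L(3) d by simp
    from meets[OF L(1) this] obtain v where "v \<in> T" "v \<noteq> 0" "v \<in> L" by blast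
    moreover have "L \<subseteq> L0" using L(2) sub0 by (simp add: vec.span_eq_iff[THEN iffD2])
    ultimately show False using L0(1) unfolding missing_def by blast
  qed
  then have "vec.dim L0 + CARD('d option) \<le> CARD('n)" by (simp add: card_UNIV_option)
  then obtain \<Lambda> :: "complex^'n \<Rightarrow> complex^('d option)" and e where
    \<Lambda>: "Vector_Spaces.linear (*s) (*s) \<Lambda>" "\<And>x. x \<in> L0 \<Longrightarrow>
        \<Lambda> x = 0" "\<And>i. \<Lambda> (e i) = axis i 1"
    using linear_map_killing_subspace[OF sub0, where 'k="'d option"] by metis
  interpret \<Lambda>: Vector_Spaces.linear "(*s)" "(*s)" \<Lambda> by (rule \<Lambda>)
  have "\<exists>v\<in>T. v \<noteq> 0 \<and> \<Lambda> v $ None \<noteq> 0 \<and> (\<forall>i.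
      \<Lambda> v $ Some i = w $ i * \<Lambda> v $ None)" for w :: "complex^'d"
  proof -
    \<comment> \<open>A preimage under \<Lambda> of the vector with \<open>None\<close>-coordinate 1
      and remaining coordinates \<open>w\<close>.\<close>
    define b where "b = e None + (\<Sum>i\<in>UNIV. w $ i *s e (Some i))"
    have \<Lambda>b: "\<Lambda> b = axis None 1 + (\<Sum>i\<in>UNIV. w $ i *s axis (Some i) 1)"
      unfolding b_def by (simp only: \<Lambda>.add \<Lambda>.sum \<Lambda>.scale \<Lambda>(3))
    have b: "\<Lambda> b $ None = 1" "\<And>i. \<Lambda> b $ Some i = w $ i"
      unfolding \<Lambda>b by (auto simp: axis_def if_distrib[where f="\<lambda>x. _ * x"] cong: if_cong)
    then have "b \<notin> L0" using \<Lambda>(2)[of b] by auto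
    define L1 where "L1 = vec.span (insert b L0)"
    have "vec.dim L1 = vec.dim L0 + 1"
      unfolding L1_def using \<open>b \<notin> L0\<close>
      by (simp add: vec.dim_insert vec.span_eq_iff[THEN iffD2, OF sub0] del: vec.span_eq_iff)
    then have "\<not> missing L1" using L0(2)[of L1] by auto
    then obtain v where v: "v \<in> T" "v \<in> L1" "v \<noteq> 0" by (auto simp: missing_def L1_def)
    then obtain k where k: "v - k *s b \<in> L0"
      using vec.span_eq_iff[THEN iffD2, OF sub0] unfolding L1_def vec.span_breakdown_eq by metis
    have "k \<noteq> 0" using k v L0(1) by (auto simp: missing_def)
    have "\<Lambda> v = k *s \<Lambda> b" using \<Lambda>(2)[OF k] by (simp add: \<Lambda>.diff \<Lambda>.scale)
    then show ?thesis using v \<open>k \<noteq> 0\<close> b by (intro bexI[of _ v]) auto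
  qed
  then show ?thesis using that[OF \<Lambda>(1)] by blast
qed

text \<open>The chart is Lipschitz only where \<open>\<Lambda> v $ None\<close> is not small
  compared with \<open>v\<close>, hence the countable exhaustion by the sets \<open>W j\<close>.
  Null directions would put each \<open>W j\<close> into a set of volume at most 2^(-j-1), and all
  of complex \<open>d\<close>-space would have volume at most 1.\<close>

lemma hausdorff_nonnull_if_meets_planes:
  fixes A :: "(complex^'n) set"
  assumes g: "proj_riemannian_metric g"
    and meets: "\<And>L. vec.subspace L \<Longrightarrow> vec.dim L + CARD('d::finite) = CARD('n) \<Longrightarrow>
       \<exists>v\<in>tangent_cone_inf A. v \<noteq> 0 \<and> v \<in> L"
    and d: "CARD('d::finite) < CARD('n)"
  shows "hausdorff_measure proj_space (riem_dist g) (real (2 * CARD('d::finite))) (asymp_dirs A) \<noteq> 0"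
proof
  assume null: "hausdorff_measure proj_space (riem_dist g) (real (2 * CARD('d))) (asymp_dirs A) = 0"
  define n where "n = 2 * CARD('d)"
  have "n > 0" by (simp add: n_def)
  obtain \<Lambda> :: "complex^'n \<Rightarrow> complex^('d option)" where \<Lambda>:
      "Vector_Spaces.linear (*s) (*s) \<Lambda>"
    "\<And>w :: complex^'d. \<exists>v\<in>tangent_cone_inf A. v \<noteq> 0 \<and> \<Lambda> v $ None
        \<noteq> 0 \<and> (\<forall>i. \<Lambda> v $ Some i = w $ i * \<Lambda> v $ None)"
    using projection_onto_affine_chart[OF meets d] by metis
  define W where "W j = {w :: complex^'d. \<exists>v\<in>tangent_cone_inf A. v \<noteq> 0 \<and>
      (\<forall>i. \<Lambda> v $ Some i = w $ i * \<Lambda> v $ None) \<and>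
      1 / real (Suc j) * norm v \<le> norm (\<Lambda> v $ None)}" for j
  have W: "\<exists>j. w \<in> W j" for w
  proof -
    obtain v where v: "v \<in> tangent_cone_inf A" "v \<noteq> 0" "\<Lambda> v $ None \<noteq> 0"
        "\<forall>i. \<Lambda> v $ Some i = w $ i * \<Lambda> v $ None"
      using \<Lambda>(2) by blast
    have "norm (\<Lambda> v $ None) / norm v > 0" using v by simp
    then obtain j where "inverse (real (Suc j)) < norm (\<Lambda> v $ None) / norm v" using
        reals_Archimedean by blast
    then have "1 / real (Suc j) * norm v \<le> norm (\<Lambda> v $ None)" using v(2) by (simp add: field_simps)
    with v show ?thesis by (auto simp: W_def)
  qed
  have small: "\<exists>V. W j \<subseteq> V \<and> V \<in> sets lborel \<and> emeasure lborel V \<le>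
      ennreal ((1/2) ^ Suc j)" for j
  proof -
    obtain C where C: "C > 0" "\<And>x y w w'. x \<noteq> 0 \<Longrightarrow> y \<noteq> 0 \<Longrightarrow>
     1 / real (Suc j) * norm x \<le> norm (\<Lambda> x $ None) \<Longrightarrow> 1 / real (Suc j) * norm
         y \<le> norm (\<Lambda> y $ None) \<Longrightarrow>
     (\<And>i. \<Lambda> x $ Some i = w $ i * \<Lambda> x $ None) \<Longrightarrow> (\<And>i. \<Lambda>
         y $ Some i = w' $ i * \<Lambda> y $ None) \<Longrightarrow>
     norm (w - w') \<le> C * riem_dist g (vec.span {x}) (vec.span {y})"
      using quotient_coordinate_lipschitz[OF g \<Lambda>(1), of "1 / real (Suc j)"] by (metis
          of_nat_0_less_iff zero_less_Suc zero_less_divide_1_iff)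
    \<comment> \<open>A set of diameter \<open>t\<close> leads to a cube of side 2 C t in real
      dimension \<open>n\<close>, so volumes exceed diameter powers by the factor
      \<open>(2 * C) ^ n\<close>, which is divided out in advance.\<close>
    define \<eta> where "\<eta> = (1/2) ^ Suc j / (2 * C) ^ n"
    have "\<eta> > 0" using C by (simp add: \<eta>_def)
    then obtain U where U: "asymp_dirs A \<subseteq> (\<Union>l. U l)" "\<And>l. dist_diam (riem_dist g)
        (U l) \<le> ennreal 1"
      "(\<Sum>l. diam_power (riem_dist g) (real n) (U l)) < ennreal \<eta>"
      using null unfolding hausdorff_measure_eq_0_iff n_def by (metis zero_less_one)
    define S where "S l = {w :: complex^'d. \<exists>v\<in>tangent_cone_inf A. v \<noteq> 0 \<and>
        (\<forall>i. \<Lambda> v $ Some i = w $ i * \<Lambda> v $ None) \<and>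
      1 / real (Suc j) * norm v \<le> norm (\<Lambda> v $ None) \<and> vec.span {v} \<in> U l}" for l
    define r where "r l = C * enn2real (dist_diam (riem_dist g) (U l))" for l
    have r0: "r l \<ge> 0" for l using C by (simp add: r_def)
    have Sr: "norm (w - w') \<le> r l" if ww: "w \<in> S l" "w' \<in> S l" for w w' l
    proof -
      obtain x where x: "x \<noteq> 0" "\<And>i. \<Lambda> x $ Some i = w $ i * \<Lambda> x $ None"
        "1 / real (Suc j) * norm x \<le> norm (\<Lambda> x $ None)" "vec.span {x} \<in> U l"
        using ww(1) unfolding S_def mem_Collect_eq by auto
      obtain y where y: "y \<noteq> 0" "\<And>i. \<Lambda> y $ Some i = w' $ i * \<Lambda> y $ None"
        "1 / real (Suc j) * norm y \<le> norm (\<Lambda> y $ None)" "vec.span {y} \<in> U l"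
        using ww(2) unfolding S_def mem_Collect_eq by auto
      have "norm (w - w') \<le> C * riem_dist g (vec.span {x}) (vec.span {y})"
        by (rule C(2)[OF x(1) y(1) x(3) y(3) x(2) y(2)])
      also have "\<dots> \<le> r l" unfolding r_def
        using C(1) dist_le_dist_diam[OF U(2) x(4) y(4)] by (intro mult_left_mono) auto
      finally show ?thesis .
    qed
    \<comment> \<open>Measurability of \<open>S l\<close> is not known, so it is enclosed in a cube
      around one of its points; the pairwise bound makes the half-side \<open>r l\<close>
      sufficient.\<close>
    define X where "X l = (if S l = {} then {} else
        let w = (SOME w. w \<in> S l) in cbox (w - r l *\<^sub>R One) (w + r l *\<^sub>R One))" for l
    have SX: "S l \<subseteq> X l" for l
    proof
      fix w assume w: "w \<in> S l"
      define w0 where "w0 = (SOME w. w \<in> S l)"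
      have "w0 \<in> S l" unfolding w0_def using w by (metis someI)
      then have "norm (w - w0) \<le> r l" using Sr w by blast
      then have "\<bar>(w - w0) \<bullet> b\<bar> \<le> r l" if "b \<in> Basis" for b using
          Basis_le_norm[OF that, of "w - w0"] by linarith
      then have "w \<in> cbox (w0 - r l *\<^sub>R One) (w0 + r l *\<^sub>R One)"
        by (simp add: mem_box algebra_simps abs_le_iff)
      then show "w \<in> X l" using w by (auto simp: X_def w0_def Let_def)
    qed
    have em: "emeasure lborel (X l) \<le> ennreal ((2 * C) ^ n) * diam_power (riem_dist g) (real n) (U l)" for l
    proof (cases "S l = {}")
      case False
      define w0 where "w0 = (SOME w. w \<in> S l)"
      have X: "X l = cbox (w0 - r l *\<^sub>R One) (w0 + r l *\<^sub>R One)" using False by (simp add: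
          X_def w0_def Let_def)
      have "U l \<noteq> {}" using False by (auto simp: S_def)
      define t where "t = enn2real (dist_diam (riem_dist g) (U l))"
      have "t \<ge> 0" by (simp add: t_def)
      have pw: "t powr real n = t ^ n" using \<open>t \<ge> 0\<close> \<open>n > 0\<close> by (cases "t
          = 0") (auto simp: powr_realpow)
      have side: "(w0 + r l *\<^sub>R One - (w0 - r l *\<^sub>R One)) \<bullet> b = 2 * r l" if "b \<in>
          Basis" for b
        unfolding inner_diff_left inner_add_left inner_scaleR_left using that by simp
      have "emeasure lborel (X l) = ennreal (\<Prod>b\<in>(Basis::(complex^'d) set). (w0 + r l *\<^sub>R
          One - (w0 - r l *\<^sub>R One)) \<bullet> b)"
        unfolding X using r0[of l] by (intro emeasure_lborel_cbox) (simp add: inner_diff_left inner_add_left)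
      also have "\<dots> = ennreal (\<Prod>b\<in>(Basis::(complex^'d) set). 2 * r l)"
        by (intro arg_cong[where f=ennreal] prod.cong refl side)
      also have "\<dots> = ennreal ((2 * C) ^ n * t ^ n)"
        by (simp add: r_def t_def n_def power_mult_distrib mult_ac)
      also have "\<dots> = ennreal ((2 * C) ^ n) * diam_power (riem_dist g) (real n) (U l)"
        using \<open>U l \<noteq> {}\<close> \<open>n > 0\<close> C(1) \<open>t \<ge> 0\<close>
        by (simp add: diam_power_def t_def[symmetric] pw ennreal_mult[symmetric] power_mult_distrib)
      finally show ?thesis by simp
    qed (simp add: X_def)
    have "W j \<subseteq> (\<Union>l. X l)"
    proof
      fix w assume "w \<in> W j"
      then obtain v where v: "v \<in> tangent_cone_inf A" "v \<noteq> 0" "\<forall>i. \<Lambda> v $ Some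
          i = w $ i * \<Lambda> v $ None"
        "1 / real (Suc j) * norm v \<le> norm (\<Lambda> v $ None)" by (auto simp: W_def)
      then have "vec.span {v} \<in> asymp_dirs A" by (auto simp: asymp_dirs_def)
      then obtain l where "vec.span {v} \<in> U l" using U(1) by blast
      with v have "w \<in> S l" by (auto simp: S_def)
      then show "w \<in> (\<Union>l. X l)" using SX by blast
    qed
    moreover have Xs: "X l \<in> sets lborel" for l by (simp add: X_def Let_def)
    moreover have "emeasure lborel (\<Union>l. X l) \<le> ennreal ((1/2) ^ Suc j)"
    proof -
      have "emeasure lborel (\<Union>l. X l) \<le> (\<Sum>l. emeasure lborel (X l))"
        using Xs by (intro emeasure_subadditive_countably) auto
      also have "\<dots> \<le> (\<Sum>l. ennreal ((2 * C) ^ n) * diam_power (riem_dist g) (real n) (U l))"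
        by (intro suminf_le em) auto
      also have "\<dots> = ennreal ((2 * C) ^ n) * (\<Sum>l. diam_power (riem_dist g) (real n) (U l))" by simp
      also have "\<dots> \<le> ennreal ((2 * C) ^ n) * ennreal \<eta>" using U(3) by (intro mult_left_mono) auto
      also have "\<dots> = ennreal ((1/2) ^ Suc j)"
      proof -
        have "(2 * C) ^ n * \<eta> = (1/2) ^ Suc j" using C(1) by (simp add: \<eta>_def)
        moreover have "ennreal ((2 * C) ^ n) * ennreal \<eta> = ennreal ((2 * C) ^ n * \<eta>)"
          using C(1) \<open>\<eta> > 0\<close> by (intro ennreal_mult[symmetric]) auto
        ultimately show ?thesis by (simp only:)
      qed
      finally show ?thesis .
    qed
    ultimately show ?thesis by (intro exI[of _ "\<Union>l. X l"]) auto
  qed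
  obtain V where V': "\<forall>j. W j \<subseteq> V j \<and> V j \<in> sets lborel \<and> emeasure
      lborel (V j) \<le> ennreal ((1/2) ^ Suc j)"
    using choice[OF allI[OF small]] by (rule exE)
  then have V: "\<And>j. W j \<subseteq> V j" "\<And>j. V j \<in> sets lborel"
    "\<And>j. emeasure lborel (V j) \<le> ennreal ((1/2) ^ Suc j)"
    by simp_all
  have "(\<Union>j. V j) = UNIV"
  proof (rule UNIV_eq_I[symmetric])
    fix w
    obtain j where "w \<in> W j" using W[of w] by (rule exE)
    then show "w \<in> (\<Union>j. V j)" using V(1)[of j] by auto
  qed
  then have "emeasure lborel (UNIV :: (complex^'d) set) \<le> (\<Sum>j. emeasure lborel (V j))"
    using emeasure_subadditive_countably[of V lborel] V(2) by auto
  also have "\<dots> \<le> (\<Sum>j. ennreal ((1/2) ^ Suc j))" by (intro suminf_le V) auto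
  also have "\<dots> = ennreal 1" by (rule suminf_ennreal_eq) (use power_half_series in auto)
  finally show False by (simp add: top_unique)
qed

section \<open>Cones of polynomial graphs\<close>

text \<open>If the coordinates of the graph have coordinatewise degree at most \<open>D\<close>, the
  monomials have degree at most K = (d+1) k D, so vanishing on (K+1)^d grid points suffices. With k
  = c^d and c = (d+1)(D+1) there are at most k (k+1)^d of these, fewer than the (k+1)^(d+1)
  monomials.\<close>

lemma polynomial_graph_relation:
  fixes F :: "complex^'d \<Rightarrow> complex^'m" and S :: "('d + 'm) set"
  assumes F: "polynomial_map F" and S: "card S = CARD('d) + 1"
  obtains k and c :: "('d + 'm \<Rightarrow> nat) \<Rightarrow> complex" where "\<exists>\<beta>\<in>S
      \<rightarrow>\<^sub>E {..k}. c \<beta> \<noteq> 0"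
    "\<And>z. (\<Sum>\<beta>\<in>S \<rightarrow>\<^sub>E {..k}. c \<beta> * (\<Prod>i\<in>S. graph_point
        F z $ i ^ \<beta> i)) = 0"
proof -
  define d where "d = CARD('d)"
  have "\<exists>D. coordwise_poly D (\<lambda>z. graph_point F z $ q)" for q
  proof (cases q)
    case (Inl i)
    then show ?thesis using coordwise_poly_nth[of i] by (auto simp: graph_point_def)
  next
    case (Inr j)
    have "polynomial_fun (\<lambda>z. F z $ j)" using F by (simp add: polynomial_map_def)
    then show ?thesis using Inr polynomial_fun_imp_coordwise_poly by (fastforce simp: graph_point_def)
  qed
  then obtain D' where D': "\<And>q. coordwise_poly (D' q) (\<lambda>z. graph_point F z $ q)" by metis
  define D where "D = (\<Sum>q\<in>UNIV. D' q)"
  have D: "coordwise_poly D (\<lambda>z. graph_point F z $ q)" for q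
    by (rule coordwise_poly_mono[OF D']) (auto simp: D_def intro: member_le_sum)
  define c where "c = (d + 1) * (D + 1)"
  define k where "k = c ^ d"
  define K where "K = (d + 1) * (k * D)"
  define B where "B = S \<rightarrow>\<^sub>E {..k}"
  define G where "G = (UNIV :: 'd set) \<rightarrow>\<^sub>E {..K}"
  have "finite S" using S card.infinite by fastforce
  have "card G = (K + 1) ^ d" by (simp add: G_def card_PiE d_def)
  also have "\<dots> \<le> (c * (k + 1)) ^ d" by (intro power_mono) (auto simp: K_def c_def algebra_simps)
  also have "\<dots> = k * (k + 1) ^ d" by (simp only: power_mult_distrib k_def)
  also have "\<dots> < (k + 1) * (k + 1) ^ d" by simp
  also have "\<dots> = card B" using \<open>finite S\<close> S by (simp add: B_def card_PiE d_def)
  finally have card: "card G < card B" .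
  have fin: "finite G" "finite B" using \<open>finite S\<close> by (auto simp: G_def B_def intro: finite_PiE)
  obtain a where a: "\<exists>\<beta>\<in>B. a \<beta> \<noteq> 0"
    "\<And>\<nu>. \<nu> \<in> G \<Longrightarrow> (\<Sum>\<beta>\<in>B. a \<beta> * (\<Prod>i\<in>S.
        graph_point F (grid_point \<nu>) $ i ^ \<beta> i)) = 0"
    using homogeneous_system_nontrivial[OF fin card, of "\<lambda>\<beta> \<nu>. \<Prod>i\<in>S.
        graph_point F (grid_point \<nu>) $ i ^ \<beta> i"] by blast
  have "coordwise_poly K (\<lambda>z. \<Sum>\<beta>\<in>B. a \<beta> * (\<Prod>i\<in>S. graph_point F z
      $ i ^ \<beta> i))"
  proof (rule coordwise_poly_sum)
    fix \<beta> assume \<beta>: "\<beta> \<in> B"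
    have "coordwise_poly (0 + (\<Sum>i\<in>S. \<beta> i * D)) (\<lambda>z. a \<beta> * (\<Prod>i\<in>S.
        graph_point F z $ i ^ \<beta> i))"
      using \<open>finite S\<close> by (intro coordwise_poly_mult coordwise_poly_prod coordwise_poly_power D) auto
    moreover have "(\<Sum>i\<in>S. \<beta> i * D) \<le> (\<Sum>i\<in>S. k * D)"
      using \<beta> by (intro sum_mono mult_right_mono) (auto simp: B_def PiE_iff)
    then have "0 + (\<Sum>i\<in>S. \<beta> i * D) \<le> K" by (simp add: K_def S d_def)
    ultimately show "coordwise_poly K (\<lambda>z. a \<beta> * (\<Prod>i\<in>S. graph_point F z $ i ^ \<beta> i))"
      by (rule coordwise_poly_mono)
  qed
  from coordwise_poly_zero_on_grid[OF this] a
  show ?thesis by (intro that[of k a]) (auto simp: B_def G_def)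
qed

text \<open>Dividing the relation by t^e, with \<open>e\<close> the top degree, leaves only the
  leading form \<open>Gh\<close> in the limit. Setting coordinate \<open>p\<close> to 1 turns it
  into \<open>G\<close>, which is not identically zero: in a homogeneous form the exponent at
  \<open>p\<close> is determined by the others, so no two monomials merge.\<close>

lemma cone_relation_in_chart:
  fixes F :: "complex^'d \<Rightarrow> complex^'m" and p :: "'d + 'm"
  assumes F: "polynomial_map F" and S0: "card S0 = CARD('d)" "p \<notin> S0"
  obtains G where "entire_fun G" "\<exists>x. G x \<noteq> 0" "\<And>x y. (\<And>i. i \<in> S0
      \<Longrightarrow> x $ i = y $ i) \<Longrightarrow> G x = G y"
    "\<And>v. v \<in> tangent_cone_inf (graph_map F) \<Longrightarrow> v $ p \<noteq> 0
        \<Longrightarrow> G ((1 / v $ p) *s v) = 0"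
proof -
  have fS0: "finite S0" by simp
  define S where "S = insert p S0"
  have "card S = CARD('d) + 1" using S0 by (simp add: S_def)
  from polynomial_graph_relation[OF F this] obtain k and c :: "('d + 'm \<Rightarrow> nat) \<Rightarrow>
      complex" where
    c: "\<exists>\<beta>\<in>S \<rightarrow>\<^sub>E {..k}. c \<beta> \<noteq> 0"
    "\<And>z. (\<Sum>\<beta>\<in>S \<rightarrow>\<^sub>E {..k}. c \<beta> * (\<Prod>i\<in>S. graph_point
        F z $ i ^ \<beta> i)) = 0" by blast
  define B where "B = S \<rightarrow>\<^sub>E {..k}"
  have "finite B" by (simp add: B_def finite_PiE)
  define deg where "deg \<beta> = (\<Sum>i\<in>S. \<beta> i)" for \<beta> :: "'d + 'm \<Rightarrow> nat"
  define e where "e = Max (deg ` {\<beta> \<in> B. c \<beta> \<noteq> 0})"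
  have fin: "finite (deg ` {\<beta> \<in> B. c \<beta> \<noteq> 0})" using \<open>finite B\<close> by simp
  have dege: "deg \<beta> \<le> e" if "\<beta> \<in> B" "c \<beta> \<noteq> 0" for \<beta> unfolding
      e_def using that by (intro Max_ge[OF fin]) auto
  have "e \<in> deg ` {\<beta> \<in> B. c \<beta> \<noteq> 0}" unfolding e_def using c(1) by (intro
      Max_in[OF fin]) (auto simp: B_def)
  then obtain \<beta>0 where \<beta>0: "\<beta>0 \<in> B" "c \<beta>0 \<noteq> 0" "deg \<beta>0 = e" by auto
  define B' where "B' = {\<beta> \<in> B. deg \<beta> = e}"
  define Gh where "Gh x = (\<Sum>\<beta>\<in>B'. c \<beta> * (\<Prod>i\<in>S. x $ i ^ \<beta> i))" for x
      :: "complex^('d + 'm)"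
  define G where "G x = (\<Sum>\<beta>\<in>B'. c \<beta> * (\<Prod>i\<in>S0. x $ i ^ \<beta> i))" for x
      :: "complex^('d + 'm)"
  have Gh0: "Gh v = 0" if v: "v \<in> tangent_cone_inf (graph_map F)" for v
  proof -
    obtain x t where x: "\<And>j. x j \<in> graph_map F" "\<And>j. t j > 0" "filterlim t at_top sequentially"
      "(\<lambda>j. x j /\<^sub>R t j) \<longlonglongrightarrow> v"
      using v unfolding tangent_cone_inf_def by blast
    define y where "y j = x j /\<^sub>R t j" for j
    \<comment> \<open>Among the terms with nonzero coefficient, those of degree below
      \<open>e\<close> keep a positive power of 1/t and tend to 0; only the top degree retains
      \<open>0 ^ 0 = 1\<close>. For degrees above \<open>e\<close> the truncated subtraction is
      harmless since the coefficients vanish.\<close>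
    define T where "T \<beta> j = c \<beta> * (complex_of_real (inverse (t j)) ^ (e - deg \<beta>) *
        (\<Prod>i\<in>S. y j $ i ^ \<beta> i))" for \<beta> j
    have "(\<Sum>\<beta>\<in>B. T \<beta> j) = 0" for j
    proof -
      obtain z where z: "x j = graph_point F z" using x(1)[of j] by (auto simp: graph_map_eq)
      define \<tau> where "\<tau> = complex_of_real (inverse (t j))"
      have "T \<beta> j = \<tau> ^ e * (c \<beta> * (\<Prod>i\<in>S. graph_point F z $ i ^ \<beta> i))"
          if "\<beta> \<in> B" for \<beta>
      proof (cases "c \<beta> = 0")
        case False
        have "y j $ i = \<tau> * graph_point F z $ i" for i
          unfolding y_def z \<tau>_def scaleR_eq_vector_scale by simp
        then have "(\<Prod>i\<in>S. y j $ i ^ \<beta> i) = \<tau> ^ deg \<beta> * (\<Prod>i\<in>S.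
            graph_point F z $ i ^ \<beta> i)"
          by (simp add: power_mult_distrib prod.distrib deg_def power_sum)
        moreover have "\<tau> ^ e = \<tau> ^ (e - deg \<beta>) * \<tau> ^ deg \<beta>"
          using dege[OF that False] by (simp flip: power_add)
        ultimately show ?thesis by (simp add: T_def \<tau>_def)
      qed (simp add: T_def)
      then have "(\<Sum>\<beta>\<in>B. T \<beta> j) = \<tau> ^ e * (\<Sum>\<beta>\<in>B. c \<beta> *
          (\<Prod>i\<in>S. graph_point F z $ i ^ \<beta> i))"
        by (simp add: sum_distrib_left)
      then show ?thesis using c(2)[of z] by (simp add: B_def)
    qed
    moreover have "(\<lambda>j. \<Sum>\<beta>\<in>B. T \<beta> j) \<longlonglongrightarrow>
        (\<Sum>\<beta>\<in>B. c \<beta> * (0 ^ (e - deg \<beta>) * (\<Prod>i\<in>S. v $ i ^ \<beta> i)))"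
    proof -
      have "(\<lambda>j. complex_of_real (inverse (t j))) \<longlonglongrightarrow> complex_of_real 0"
        by (intro tendsto_of_real tendsto_inverse_0_at_top x)
      then have "(\<lambda>j. complex_of_real (inverse (t j))) \<longlonglongrightarrow> 0" by simp
      moreover have "y \<longlonglongrightarrow> v" using x(4) by (simp add: y_def[abs_def])
      ultimately show ?thesis unfolding T_def by (intro tendsto_intros)
    qed
    ultimately have "(\<Sum>\<beta>\<in>B. c \<beta> * (0 ^ (e - deg \<beta>) * (\<Prod>i\<in>S. v $ i ^
        \<beta> i))) = 0"
      by (simp add: LIMSEQ_const_iff)
    also have "(\<Sum>\<beta>\<in>B. c \<beta> * (0 ^ (e - deg \<beta>) * (\<Prod>i\<in>S. v $ i ^
        \<beta> i))) = Gh v"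
      unfolding Gh_def
    proof (rule sum.mono_neutral_cong_right)
      show "\<forall>\<beta>\<in>B - B'. c \<beta> * (0 ^ (e - deg \<beta>) * (\<Prod>i\<in>S. v $ i ^
          \<beta> i)) = 0"
      proof
        fix \<beta> assume "\<beta> \<in> B - B'"
        then have "\<beta> \<in> B" "deg \<beta> \<noteq> e" by (auto simp: B'_def)
        then have "c \<beta> = 0 \<or> deg \<beta> < e" using dege by force
        then show "c \<beta> * (0 ^ (e - deg \<beta>) * (\<Prod>i\<in>S. v $ i ^ \<beta> i)) = 0" by auto
      qed
    qed (use \<open>finite B\<close> in \<open>auto simp: B'_def\<close>)
    finally show ?thesis .
  qed
  show ?thesis
  proof (rule that[of G])
    show "entire_fun G" unfolding G_def by (intro entire_fun_sum entire_fun_mult entire_fun_prod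
        entire_fun_power) auto
    show "G x = G y" if "\<And>i. i \<in> S0 \<Longrightarrow> x $ i = y $ i" for x y using that by
        (simp add: G_def)
    show "\<exists>x. G x \<noteq> 0"
    proof (rule ccontr)
      assume *: "\<not> ?thesis"
      have "c \<beta>0 = 0"
      proof (rule monomials_independent[OF fS0, of B' c])
        show "(\<Sum>\<beta>\<in>B'. c \<beta> * (\<Prod>i\<in>S0. x $ i ^ \<beta> i)) = 0" for x using
            * by (simp add: G_def)
        show "\<beta> = \<gamma>" if "\<beta> \<in> B'" "\<gamma> \<in> B'" "\<forall>i\<in>S0. \<beta>
            i = \<gamma> i" for \<beta> \<gamma>
        proof (rule PiE_ext)
          show "\<beta> \<in> S \<rightarrow>\<^sub>E {..k}" "\<gamma> \<in> S \<rightarrow>\<^sub>E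
              {..k}" using that by (auto simp: B'_def B_def)
          have "\<beta> p + (\<Sum>i\<in>S0. \<beta> i) = \<gamma> p + (\<Sum>i\<in>S0. \<gamma> i)"
            using that S0 by (simp add: B'_def deg_def S_def)
          moreover have "(\<Sum>i\<in>S0. \<beta> i) = (\<Sum>i\<in>S0. \<gamma> i)" using that by
              (intro sum.cong) auto
          ultimately show "\<beta> i = \<gamma> i" if "i \<in> S" for i
            using that \<open>\<forall>i\<in>S0. \<beta> i = \<gamma> i\<close> by (auto simp: S_def)
        qed
      qed (use \<beta>0 \<open>finite B\<close> in \<open>auto simp: B'_def\<close>)
      with \<beta>0 show False by simp
    qed
    fix v assume v: "v \<in> tangent_cone_inf (graph_map F)" "v $ p \<noteq> 0"
    define x where "x = (1 / v $ p) *s v"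
    have xp: "x $ p = 1" using v by (simp add: x_def)
    have "Gh x = (1 / v $ p) ^ e * Gh v"
    proof -
      have "(\<Prod>i\<in>S. x $ i ^ \<beta> i) = (1 / v $ p) ^ e * (\<Prod>i\<in>S. v $ i ^ \<beta> i)"
          if "\<beta> \<in> B'" for \<beta>
      proof -
        have "(\<Prod>i\<in>S. x $ i ^ \<beta> i) = (\<Prod>i\<in>S. (1 / v $ p) ^ \<beta> i * v $ i ^ \<beta> i)"
          by (simp add: x_def power_divide)
        also have "\<dots> = (1 / v $ p) ^ deg \<beta> * (\<Prod>i\<in>S. v $ i ^ \<beta> i)"
          by (simp only: prod.distrib deg_def power_sum)
        finally show ?thesis using that by (simp add: B'_def)
      qed
      then show ?thesis by (simp add: Gh_def sum_distrib_left mult_ac)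
    qed
    moreover have "Gh x = G x"
      unfolding Gh_def G_def S_def using S0 xp by simp
    ultimately show "G ((1 / v $ p) *s v) = 0" using Gh0[OF v(1)] by (simp add: x_def)
  qed
qed

section \<open>Lipschitz pieces of zero sets\<close>

definition lipschitz_dependent :: "'n set \<Rightarrow> (complex^'n) set \<Rightarrow> bool" where
  "lipschitz_dependent S X \<longleftrightarrow>
     (\<exists>j\<in>S. \<exists>C\<ge>0. \<forall>x\<in>X. \<forall>y\<in>X. norm (x $ j - y $ j) \<le>
         C * (\<Sum>k\<in>S - {j}. norm (x $ k - y $ k)))"

text \<open>This is the benefit of a two-point inequality: no domain of an underlying Lipschitz
  function has to be carried along.\<close>

lemma lipschitz_dependent_subset: "lipschitz_dependent S X \<Longrightarrow> Y \<subseteq> X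
    \<Longrightarrow> lipschitz_dependent S Y"
  unfolding lipschitz_dependent_def by (meson subsetD)

definition depends_only_on :: "'n set \<Rightarrow> (complex^'n \<Rightarrow> complex) \<Rightarrow> bool" where
  "depends_only_on S f \<longleftrightarrow> (\<forall>x y. (\<forall>i\<in>S. x $ i = y $ i)
      \<longrightarrow> f x = f y)"



lemma depends_only_on_pderiv_fun:
  assumes f: "entire_fun f" "depends_only_on S f"
  shows "depends_only_on S (pderiv_fun i f)"
  unfolding depends_only_on_def
proof (intro allI impI)
  fix x y :: "complex^'a" assume "\<forall>i\<in>S. x $ i = y $ i"
  then have "(\<lambda>s. f (x + s *s axis i 1)) = (\<lambda>s. f (y + s *s axis i 1))"
    using f(2) unfolding depends_only_on_def by (intro ext) auto
  then show "pderiv_fun i f x = pderiv_fun i f y" by (simp add: pderiv_fun_along_axis[OF f(1)])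
qed

lemma pderiv_fun_eq_0_if_independent:
  assumes f: "entire_fun f" "depends_only_on S f" and "i \<notin> S"
  shows "pderiv_fun i f x = 0"
proof -
  have "f (x + s *s axis i 1) = f x" for s
  proof -
    have "\<forall>k\<in>S. (x + s *s axis i 1) $ k = x $ k" using \<open>i \<notin> S\<close> by (auto
        simp: axis_def)
    then show ?thesis using f(2) unfolding depends_only_on_def by blast
  qed
  then show ?thesis by (simp add: pderiv_fun_along_axis[OF f(1)])
qed

text \<open>Near \<open>x\<close> the function differs from the linear form with coefficients
  \<open>a\<close> by an error of small derivative. For two zeros the linear form of their
  difference is therefore at most \<epsilon> times the sum of the coordinate differences, and
  \<epsilon> being half of |a j| isolates coordinate \<open>j\<close>. No implicit function is
  constructed.\<close>

lemma regular_zero_lipschitz: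
  fixes f :: "complex^'n \<Rightarrow> complex"
  assumes f: "entire_fun f" "depends_only_on S f" and nz: "pderiv_fun j f x \<noteq> 0"
  obtains r where "r > 0" "lipschitz_dependent S (ball x r \<inter> {y. f y = 0})"
proof -
  have "j \<in> S" using pderiv_fun_eq_0_if_independent[OF f] nz by blast
  define a where "a i = pderiv_fun i f x" for i
  define \<epsilon> where "\<epsilon> = norm (a j) / 2"
  have "\<epsilon> > 0" using nz by (simp add: \<epsilon>_def a_def)
  have "\<forall>\<^sub>F y in nhds x. \<forall>i\<in>UNIV. norm (pderiv_fun i f y - a i) < \<epsilon>"
  proof (rule eventually_ball_finite)
    have "isCont (pderiv_fun i f) x" for i
      using pderiv_fun_continuous_on[OF f(1), of UNIV i] by (simp add: continuous_on_eq_continuous_at)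
    then show "\<forall>i\<in>UNIV. \<forall>\<^sub>F y in nhds x. norm (pderiv_fun i f y - a i) < \<epsilon>"
      using \<open>\<epsilon> > 0\<close> by (auto simp: a_def isCont_def tendsto_iff dist_norm
          eventually_nhds_conv_at)
  qed simp
  then obtain r where r: "r > 0" "\<And>y i. y \<in> ball x r \<Longrightarrow> norm (pderiv_fun i f y -
      a i) < \<epsilon>"
    unfolding eventually_nhds_metric by (auto simp: dist_commute)
  define C where "C = ((\<Sum>i\<in>S. norm (a i)) + \<epsilon>) / \<epsilon>"
  have "C \<ge> 0" unfolding C_def using \<open>\<epsilon> > 0\<close> by (intro divide_nonneg_pos
      add_nonneg_nonneg sum_nonneg) auto
  have "norm (y $ j - w $ j) \<le> C * (\<Sum>k\<in>S - {j}. norm (y $ k - w $ k))"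
    if y: "y \<in> ball x r" "f y = 0" and w: "w \<in> ball x r" "f w = 0" for y w
  proof -
    define v where "v = y - w"
    have b: "w + complex_of_real s *s v \<in> ball x r" if "s \<in> {0..1}" for s
    proof -
      have "w + complex_of_real s *s v = (1 - s) *\<^sub>R w + s *\<^sub>R y"
        unfolding v_def scaleR_eq_vector_scale by (simp add: vec_eq_iff algebra_simps)
      then show ?thesis using that y w convex_ball[of x r] by (auto simp: convex_alt)
    qed
    \<comment> \<open>With the linear part subtracted, the derivative of \<open>E\<close> measures
      only how much the partial derivatives vary over the ball.\<close>
    define E where "E s = f (w + complex_of_real s *s v) - complex_of_real s * (\<Sum>i\<in>S. v $ i * a i)" for s
    have derE: "(E has_vector_derivative (\<Sum>i\<in>S. v $ i * (pderiv_fun i f (w + complex_of_real s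
        *s v) - a i))) (at s within {0..1})" for s
    proof -
      have "((\<lambda>s. f (w + s *s v)) has_field_derivative (\<Sum>i\<in>S. v $ i * pderiv_fun i f (w
          + complex_of_real s *s v))) (at (complex_of_real s))"
      proof -
        have "(\<Sum>i\<in>UNIV. v $ i * pderiv_fun i f (w + complex_of_real s *s v)) = (\<Sum>i\<in>S.
            v $ i * pderiv_fun i f (w + complex_of_real s *s v))"
          by (rule sum.mono_neutral_right) (auto simp: pderiv_fun_eq_0_if_independent[OF f])
        then show ?thesis using entire_fun_along_line[OF f(1), of w v "complex_of_real s"] by simp
      qed
      from has_vector_derivative_real_field[OF this]
      have "((\<lambda>s. f (w + complex_of_real s *s v)) has_vector_derivative (\<Sum>i\<in>S. v $ i *
          pderiv_fun i f (w + complex_of_real s *s v))) (at s within {0..1})"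
        by (rule has_vector_derivative_at_within)
      moreover have "((\<lambda>s. complex_of_real s * (\<Sum>i\<in>S. v $ i * a i))
          has_vector_derivative (\<Sum>i\<in>S. v $ i * a i)) (at s within {0..1})"
        by (auto intro!: derivative_eq_intros)
      ultimately show ?thesis
        unfolding E_def by (rule has_vector_derivative_eq_rhs[OF has_vector_derivative_diff])
          (simp add: right_diff_distrib sum_subtractf)
    qed
    define V where "V = (\<Sum>i\<in>S. norm (v $ i))"
    have "norm (E 1 - E 0) \<le> (\<epsilon> * V) * norm (1 - 0 :: real)"
    proof (rule differentiable_bound[of "{0..1}" E "\<lambda>s h. h *\<^sub>R (\<Sum>i\<in>S. v $ i *
        (pderiv_fun i f (w + complex_of_real s *s v) - a i))"])
      fix s :: real assume s: "s \<in> {0..1}"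
      show "(E has_derivative (\<lambda>h. h *\<^sub>R (\<Sum>i\<in>S. v $ i * (pderiv_fun i f (w +
          complex_of_real s *s v) - a i)))) (at s within {0..1})"
        using derE by (simp add: has_vector_derivative_def)
      have "norm (\<Sum>i\<in>S. v $ i * (pderiv_fun i f (w + complex_of_real s *s v) - a i)) \<le>
          (\<Sum>i\<in>S. norm (v $ i) * \<epsilon>)"
        by (rule order_trans[OF norm_sum], rule sum_mono)
           (use less_imp_le[OF r(2)[OF b[OF s]]] in \<open>auto simp: norm_mult intro!: mult_left_mono\<close>)
      also have "\<dots> = \<epsilon> * V" by (simp add: V_def sum_distrib_left mult.commute)
      finally show "onorm (\<lambda>h. h *\<^sub>R (\<Sum>i\<in>S. v $ i * (pderiv_fun i f (w +
          complex_of_real s *s v) - a i))) \<le> \<epsilon> * V"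
        by (intro onorm_le) (auto simp: mult.commute intro!: mult_left_mono)
    qed auto
    moreover have "E 1 - E 0 = - (\<Sum>i\<in>S. v $ i * a i)" using y w by (simp add: E_def v_def)
    ultimately have main: "norm (\<Sum>i\<in>S. v $ i * a i) \<le> \<epsilon> * V" by simp
    define V' where "V' = (\<Sum>k\<in>S - {j}. norm (v $ k))"
    have V: "V = norm (v $ j) + V'" unfolding V_def V'_def using \<open>j \<in> S\<close> by (simp add: sum.remove)
    have "v $ j * a j = (\<Sum>i\<in>S. v $ i * a i) - (\<Sum>i\<in>S - {j}. v $ i * a i)"
      using \<open>j \<in> S\<close> by (simp add: sum.remove[of S j])
    then have "norm (v $ j) * norm (a j) = norm ((\<Sum>i\<in>S. v $ i * a i) - (\<Sum>i\<in>S - {j}. v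
        $ i * a i))"
      by (metis norm_mult)
    also have "\<dots> \<le> norm (\<Sum>i\<in>S. v $ i * a i) + norm (\<Sum>i\<in>S - {j}. v $ i * a
        i)" by (rule norm_triangle_ineq4)
    also have "\<dots> \<le> \<epsilon> * V + (\<Sum>i\<in>S - {j}. norm (v $ i) * norm (a i))"
      using norm_sum[of "\<lambda>i. v $ i * a i" "S - {j}"] by (intro add_mono main) (simp add: norm_mult)
    also have "(\<Sum>i\<in>S - {j}. norm (v $ i) * norm (a i)) \<le> (\<Sum>i\<in>S - {j}. norm (v $ i)
        * (\<Sum>i\<in>S. norm (a i)))"
      by (intro sum_mono mult_left_mono member_le_sum) auto
    also have "(\<Sum>i\<in>S - {j}. norm (v $ i) * (\<Sum>i\<in>S. norm (a i))) = V' * (\<Sum>i\<in>S.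
        norm (a i))"
      by (simp add: V'_def sum_distrib_right)
    finally have "norm (v $ j) * (2 * \<epsilon>) \<le> \<epsilon> * (norm (v $ j) + V') + V' *
        (\<Sum>i\<in>S. norm (a i))"
      by (simp add: V \<epsilon>_def)
    then have "\<epsilon> * norm (v $ j) \<le> ((\<Sum>i\<in>S. norm (a i)) + \<epsilon>) * V'" by (simp
        add: algebra_simps)
    then show ?thesis using \<open>\<epsilon> > 0\<close> by (simp add: C_def V'_def v_def field_simps)
  qed
  then have "lipschitz_dependent S (ball x r \<inter> {y. f y = 0})"
    unfolding lipschitz_dependent_def using \<open>j \<in> S\<close> \<open>C \<ge> 0\<close> by blast
  with r(1) show ?thesis by (rule that)
qed

text \<open>Directional derivatives of every order are combinations of iterated partial derivatives,
  so the Taylor series along the line from \<open>x\<close> to \<open>z\<close> is zero.\<close>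

lemma entire_fun_eq_0_if_all_derivatives_vanish:
  assumes f: "entire_fun f" and van: "\<And>w. fold pderiv_fun w f x = 0"
  shows "f z = 0"
proof -
  have D: "(dir_deriv b ^^ j) f x = 0" for b j
    using f van
  proof (induction j arbitrary: f)
    case 0
    from "0.prems"(2)[of "[]"] show ?case by simp
  next
    case (Suc j)
    have "(dir_deriv b ^^ j) (pderiv_fun i f) x = 0" for i
      by (rule Suc.IH[OF entire_fun_pderiv_fun[OF Suc.prems(1)]]) (use Suc.prems(2)[of "i # w" for w] in simp)
    then show ?case by (simp add: dir_deriv_funpow_Suc[OF Suc.prems(1)] del: funpow.simps)
  qed
  define h where "h s = f (x + s *s (z - x))" for s
  have hol: "h holomorphic_on ball 0 2" unfolding h_def by (rule entire_fun_along_line_holomorphic[OF f])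
  have "(deriv ^^ j) h 0 = 0" for j
  proof -
    have "(deriv ^^ j) h = (\<lambda>s. (dir_deriv (z - x) ^^ j) f (x + s *s (z - x)))"
      unfolding h_def by (rule higher_deriv_along_line[OF f])
    then show ?thesis using D by simp
  qed
  then have "(\<lambda>n::nat. 0) sums h 1" using holomorphic_power_series[OF hol, of 1] by simp
  then have "h 1 = 0" using sums_unique2 sums_zero by blast
  then show ?thesis by (simp add: h_def)
qed

text \<open>Dropping the outermost derivative from a shortest word that is nonzero at
  \<open>x\<close> leaves a function with a regular zero at \<open>x\<close>. Restricting to basic
  open sets makes the pieces countable, since there are only countably many words.\<close>

lemma zero_set_lipschitz_cover:
  fixes f :: "complex^'n \<Rightarrow> complex"
  assumes f: "entire_fun f" "depends_only_on S f" "f z \<noteq> 0"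
  obtains \<A> where "countable \<A>" "{x. f x = 0} \<subseteq> \<Union>\<A>" "\<And>X. X \<in> \<A>
      \<Longrightarrow> lipschitz_dependent S X"
proof -
  obtain \<B> :: "(complex^'n) set set" where \<B>: "countable \<B>" "topological_basis \<B>"
    using ex_countable_basis by blast
  have der: "entire_fun (fold pderiv_fun w f) \<and> depends_only_on S (fold pderiv_fun w f)" for w
    using f(1,2) by (induction w arbitrary: f) (auto simp: entire_fun_pderiv_fun depends_only_on_pderiv_fun)
  define \<A> where "\<A> = {X \<in> (\<lambda>(b, w). b \<inter> {y. fold pderiv_fun w f y = 0}) `
      (\<B> \<times> lists (UNIV::'n set)). lipschitz_dependent S X}"
  have "countable \<A>"
    unfolding \<A>_def using \<B>(1) countable_finite[of "UNIV::'n set"]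
    by (intro countable_Collect countable_image countable_SIGMA countable_lists) auto
  moreover have "x \<in> \<Union>\<A>" if fx: "f x = 0" for x
  proof -
    have "\<exists>w. fold pderiv_fun w f x \<noteq> 0" using
        entire_fun_eq_0_if_all_derivatives_vanish[OF f(1)] f(3) by blast
    then obtain w where w: "fold pderiv_fun w f x \<noteq> 0" "\<And>w'. length w' < length w
        \<Longrightarrow> fold pderiv_fun w' f x = 0"
      using ex_has_least_nat[of "\<lambda>w. fold pderiv_fun w f x \<noteq> 0" _ length] by (metis not_le)
    then have "w \<noteq> []" using fx by auto
    \<comment> \<open>\<open>fold\<close> applies the letters from left to right, so the last letter
      is the outermost derivative.\<close>
    then obtain w1 j where wj: "w = w1 @ [j]" by (metis rev_exhaust)
    have 0: "fold pderiv_fun w1 f x = 0" by (rule w(2)) (simp add: wj)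
    have "pderiv_fun j (fold pderiv_fun w1 f) x \<noteq> 0" using w(1) by (simp add: wj)
    then obtain r where r: "r > 0" "lipschitz_dependent S (ball x r \<inter> {y. fold pderiv_fun w1 f y = 0})"
      using regular_zero_lipschitz der by blast
    obtain b where b: "b \<in> \<B>" "x \<in> b" "b \<subseteq> ball x r"
      using topological_basisE[OF \<B>(2), of "ball x r" x] r(1) by auto
    have "lipschitz_dependent S (b \<inter> {y. fold pderiv_fun w1 f y = 0})"
      by (rule lipschitz_dependent_subset[OF r(2)]) (use b in auto)
    then have "b \<inter> {y. fold pderiv_fun w1 f y = 0} \<in> \<A>" using b by (auto simp: \<A>_def)
    then show ?thesis using b 0 by blast
  qed
  ultimately show ?thesis by (intro that[of \<A>]) (auto simp: \<A>_def)
qed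

text \<open>An exchange argument as for bases: among the coordinate sets that control all others,
  take one of least size. If it had \<open>d\<close> elements, dependence within a
  \<open>d\<close>-subset would allow one of them to be dropped. All coordinates except the constant
  one form a starting set.\<close>

lemma lipschitz_spanning_coordinates:
  fixes X :: "(complex^'n) set"
  assumes p: "\<And>x. x \<in> X \<Longrightarrow> x $ p = 1"
    and dep: "\<And>S. card S = d \<Longrightarrow> p \<notin> S \<Longrightarrow> lipschitz_dependent S X"
  obtains T C where "card T < d" "C \<ge> 0"
    "\<And>x y i. x \<in> X \<Longrightarrow> y \<in> X \<Longrightarrow> norm (x $ i - y $ i) \<le> C *
        (\<Sum>k\<in>T. norm (x $ k - y $ k))"
proof -
  define spans where "spans T \<longleftrightarrow> p \<notin> T \<and>
    (\<exists>C\<ge>0. \<forall>x\<in>X. \<forall>y\<in>X. \<forall>i. norm (x $ i - y $ i) \<le> C *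
        (\<Sum>k\<in>T. norm (x $ k - y $ k)))" for T
  have "spans (UNIV - {p})"
    unfolding spans_def
  proof (intro conjI exI[of _ "1::real"] ballI allI)
    fix x y i assume "x \<in> X" "y \<in> X"
    then show "norm (x $ i - y $ i) \<le> 1 * (\<Sum>k\<in>UNIV - {p}. norm (x $ k - y $ k))"
      using p by (cases "i = p") (auto intro!: sum_nonneg member_le_sum)
  qed auto
  then obtain T where T: "spans T" "\<And>T'. spans T' \<Longrightarrow> card T \<le> card T'"
    using ex_has_least_nat[of spans _ card] by metis
  then obtain C where C: "C \<ge> 0"
    "\<And>x y i. x \<in> X \<Longrightarrow> y \<in> X \<Longrightarrow> norm (x $ i - y $ i) \<le> C *
        (\<Sum>k\<in>T. norm (x $ k - y $ k))"
    and pT: "p \<notin> T" unfolding spans_def by blast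
  have "card T < d"
  proof (rule ccontr)
    assume "\<not> card T < d"
    then obtain S where S: "S \<subseteq> T" "card S = d" using obtain_subset_with_card_n by (metis not_less)
    then obtain j K where j: "j \<in> S" "K \<ge> 0"
      "\<And>x y. x \<in> X \<Longrightarrow> y \<in> X \<Longrightarrow> norm (x $ j - y $ j) \<le> K *
          (\<Sum>k\<in>S - {j}. norm (x $ k - y $ k))"
      using dep[of S] pT unfolding lipschitz_dependent_def by blast
    have "spans (T - {j})"
      unfolding spans_def
    proof (intro conjI exI[of _ "C * (K + 1)"] ballI allI)
      fix x y i assume xy: "x \<in> X" "y \<in> X"
      define s where "s = (\<Sum>k\<in>T - {j}. norm (x $ k - y $ k))"
      have "(\<Sum>k\<in>S - {j}. norm (x $ k - y $ k)) \<le> s" unfolding s_def using S by (intro sum_mono2) auto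
      then have "K * (\<Sum>k\<in>S - {j}. norm (x $ k - y $ k)) \<le> K * s" using j(2) by (rule mult_left_mono)
      then have "norm (x $ j - y $ j) \<le> K * s" using j(3)[OF xy] by linarith
      moreover have "(\<Sum>k\<in>T. norm (x $ k - y $ k)) = norm (x $ j - y $ j) + s"
        unfolding s_def using j(1) S by (intro sum.remove) auto
      ultimately have "(\<Sum>k\<in>T. norm (x $ k - y $ k)) \<le> (K + 1) * s" by (simp add: algebra_simps)
      then have "C * (\<Sum>k\<in>T. norm (x $ k - y $ k)) \<le> C * ((K + 1) * s)" using C(1) by (rule
          mult_left_mono)
      then show "norm (x $ i - y $ i) \<le> C * (K + 1) * (\<Sum>k\<in>T - {j}. norm (x $ k - y $ k))"
        using C(2)[OF xy, of i] by (simp add: s_def mult.assoc)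
    qed (use C(1) j(2) pT in auto)
    then have "card T \<le> card (T - {j})" by (rule T)
    moreover have "card (T - {j}) < card T" using j(1) S(1) by (intro psubset_card_mono) auto
    ultimately show False by simp
  qed
  with C show ?thesis by (intro that)
qed

section \<open>Covering estimates in affine charts\<close>

lemma span_singleton_in_proj_space:
  assumes "x \<noteq> 0"
  shows "vec.span {x} \<in> proj_space"
proof -
  have "vec.dim (vec.span {x}) = 1"
    using assms vec.dim_eq_card_independent[of "{x}"] by (simp add: vec.dependent_single)
  then show ?thesis by (simp add: proj_of_def)
qed

lemma floor_cell_bound:
  fixes a b :: real
  assumes "\<lfloor>real N * a\<rfloor> = \<lfloor>real N * b\<rfloor>" "N > 0"
  shows "\<bar>a - b\<bar> \<le> 1 / real N"
proof -
  have "\<bar>real N * a - real N * b\<bar> \<le> 1" using assms(1) by linarith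
  then have "real N * \<bar>a - b\<bar> \<le> 1" by (simp add: abs_mult flip: right_diff_distrib)
  then show ?thesis using assms(2) by (simp add: field_simps)
qed

text \<open>The coordinates in \<open>T\<close> range over a bounded region of real dimension 2 card
  T. Cells of side 1/N number O(N^(2 card T)) and give sets of diameter O(1/N), so the sums are
  O(N^(2 card T - s)).\<close>

lemma chart_piece_null:
  fixes X :: "(complex^'n) set"
  assumes g: "proj_riemannian_metric g"
    and p: "\<And>x. x \<in> X \<Longrightarrow> x $ p = 1" and R: "\<And>x. x \<in> X \<Longrightarrow>
        norm x \<le> R"
    and C: "C \<ge> 0" "\<And>x y i. x \<in> X \<Longrightarrow> y \<in> X \<Longrightarrow> norm (x $ i
        - y $ i) \<le> C * (\<Sum>k\<in>T. norm (x $ k - y $ k))"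
    and s: "s > 0" "s > 2 * real (card T)"
  shows "hausdorff_measure proj_space (riem_dist g) s ((\<lambda>x. vec.span {x}) ` X) = 0"
proof -
  define K where "K = {x :: complex^'n. x $ p = 1} \<inter> cball 0 R"
  have "compact K"
    unfolding K_def by (intro closed_Int_compact closed_Collect_eq continuous_intros) auto
  moreover have "convex K"
  proof -
    have "convex {x :: complex^'n. x $ p = 1}"
      by (auto simp: convex_def simp flip: scaleR_add_left)
    then show ?thesis unfolding K_def by (intro convex_Int) auto
  qed
  moreover have "0 \<notin> K" by (simp add: K_def)
  ultimately obtain C1 where C1: "C1 \<ge> 0"
    "\<And>x y. x \<in> K \<Longrightarrow> y \<in> K \<Longrightarrow> riem_dist g (vec.span {x})
        (vec.span {y}) \<le> C1 * norm (y - x)"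
    using riem_dist_le[OF g] by metis
  have XK: "x \<in> K" if "x \<in> X" for x using that p R by (auto simp: K_def)
  define C2 where "C2 = C1 * (real CARD('n) * C)"
  have "C2 \<ge> 0" using C C1 by (simp add: C2_def)
  have dist: "riem_dist g (vec.span {x}) (vec.span {y}) \<le> C2 * (\<Sum>k\<in>T. norm (x $ k - y $ k))"
    if xy: "x \<in> X" "y \<in> X" for x y
  proof -
    have "norm (y - x) = norm (x - y)" by (rule norm_minus_commute)
    also have "\<dots> \<le> (\<Sum>i\<in>UNIV. norm ((x - y) $ i))" unfolding norm_vec_def by (rule
        L2_set_le_sum) simp
    also have "\<dots> \<le> (\<Sum>i\<in>(UNIV::'n set). C * (\<Sum>k\<in>T. norm (x $ k - y $ k)))"
      using C(2)[OF xy] by (intro sum_mono) simp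
    finally have "C1 * norm (y - x) \<le> C1 * (real CARD('n) * (C * (\<Sum>k\<in>T. norm (x $ k - y $ k))))"
      using C1(1) by (intro mult_left_mono) auto
    then show ?thesis using C1(2)[OF XK XK, OF xy] by (simp add: C2_def mult.assoc)
  qed
  define t where "t = card T"
  \<comment> \<open>Within a cell each controlling coordinate varies by at most 2/N, one 1/N for
    each of its real and imaginary parts.\<close>
  define C3 where "C3 = C2 * (real t * 2)"
  have "C3 \<ge> 0" using \<open>C2 \<ge> 0\<close> by (simp add: C3_def)
  obtain R' :: nat where R': "R \<le> real R'" "R' > 0"
    using real_arch_simple[of "max R 1"] by (metis le_max_iff_disj max.boundedE not_gr0 of_nat_0 not_one_le_zero)
  show ?thesis
  proof (rule hausdorff_nullI_finite_cover[OF s(1)])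
    fix \<delta> \<eta> :: real assume "\<delta> > 0" "\<eta> > 0"
    define A where "A = (3 * real R') ^ (2 * t) * C3 powr s"
    have "(\<lambda>N. A * real N powr (- (s - 2 * real t))) \<longlonglongrightarrow> A * 0"
      using s(2) by (intro tendsto_mult tendsto_const tendsto_neg_powr filterlim_real_sequentially)
          (simp add: t_def)
    then have "\<forall>\<^sub>F N in sequentially. A * real N powr (- (s - 2 * real t)) < \<eta>"
      using \<open>\<eta> > 0\<close> by (intro order_tendstoD(2)) auto
    moreover have "(\<lambda>N. C3 * (1 / real N)) \<longlonglongrightarrow> C3 * 0"
      by (intro tendsto_mult tendsto_const lim_1_over_n)
    then have "\<forall>\<^sub>F N in sequentially. C3 * (1 / real N) < \<delta>"
      using \<open>\<delta> > 0\<close> by (intro order_tendstoD(2)) auto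
    moreover have "\<forall>\<^sub>F N::nat in sequentially. N > 0" by (rule eventually_gt_at_top)
    ultimately have "\<forall>\<^sub>F N in sequentially. A * real N powr (- (s - 2 * real t)) < \<eta>
        \<and> C3 * (1 / real N) < \<delta> \<and> N > 0"
      by eventually_elim auto
    then obtain N where N: "A * real N powr (- (s - 2 * real t)) < \<eta>" "C3 * (1 / real N) < \<delta>" "N > 0"
      using eventually_happens by force
    define \<rho> where "\<rho> = C3 / real N"
    define I where "I = {- int (N * R')..int (N * R')}"
    define cell where "cell x = restrict (\<lambda>k. (\<lfloor>real N * Re (x $ k)\<rfloor>,
        \<lfloor>real N * Im (x $ k)\<rfloor>)) T" for x :: "complex^'n"
    define P where "P = T \<rightarrow>\<^sub>E (I \<times> I)"
    define U where "U c = (\<lambda>x. vec.span {x}) ` {x \<in> X. cell x = c}" for c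
    have finP: "finite P" by (auto simp: P_def I_def intro!: finite_PiE)
    have cellP: "cell x \<in> P" if "x \<in> X" for x
    proof -
      have fl: "\<lfloor>real N * a\<rfloor> \<in> I" if "\<bar>a\<bar> \<le> real R'" for a
      proof -
        have "\<bar>real N * a\<bar> \<le> real N * real R'" using that by (simp add: abs_mult mult_left_mono)
        then have "- real (N * R') \<le> real N * a" "real N * a \<le> real (N * R')" by auto
        then show ?thesis unfolding I_def by (auto simp: le_floor_iff floor_le_iff)
      qed
      have "\<bar>Re (x $ k)\<bar> \<le> real R'" "\<bar>Im (x $ k)\<bar> \<le> real R'" for k
        using abs_Re_le_cmod[of "x $ k"] abs_Im_le_cmod[of "x $ k"]
            Finite_Cartesian_Product.norm_nth_le[of x k] R[OF that] R'(1)
        by linarith+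
      then show ?thesis unfolding cell_def P_def using fl by auto
    qed
    have small: "riem_dist g (vec.span {x}) (vec.span {y}) \<le> \<rho>" if "x \<in> X" "y \<in> X"
        "cell x = cell y" for x y
    proof -
      have "norm (x $ k - y $ k) \<le> 2 / real N" if "k \<in> T" for k
      proof -
        have "\<lfloor>real N * Re (x $ k)\<rfloor> = \<lfloor>real N * Re (y $ k)\<rfloor>"
            "\<lfloor>real N * Im (x $ k)\<rfloor> = \<lfloor>real N * Im (y $ k)\<rfloor>"
          using fun_cong[OF \<open>cell x = cell y\<close>, of k] that by (auto simp: cell_def)
        from floor_cell_bound[OF this(1) N(3)] floor_cell_bound[OF this(2) N(3)] cmod_le[of "x $ k - y $ k"]
        show ?thesis by simp
      qed
      then have "(\<Sum>k\<in>T. norm (x $ k - y $ k)) \<le> (\<Sum>k\<in>T. 2 / real N)" by (rule sum_mono)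
      then have "C2 * (\<Sum>k\<in>T. norm (x $ k - y $ k)) \<le> C2 * (real t * (2 / real N))"
        using \<open>C2 \<ge> 0\<close> by (intro mult_left_mono) (auto simp: t_def)
      then show ?thesis using dist[OF that(1,2)] by (simp add: \<rho>_def C3_def)
    qed
    show "\<exists>\<U> \<rho>. finite \<U> \<and> (\<lambda>x. vec.span {x}) ` X \<subseteq>
        \<Union>\<U> \<and> 0 \<le> \<rho> \<and> \<rho> \<le> \<delta> \<and> real (card \<U>) * \<rho>
            powr s < \<eta> \<and>
        (\<forall>U\<in>\<U>. U \<subseteq> proj_space \<and> (\<forall>x\<in>U. \<forall>y\<in>U.
            riem_dist g x y \<le> \<rho>))"
    proof (intro exI[of _ "U ` P"] exI[of _ \<rho>] conjI ballI)
      show "finite (U ` P)" using finP by simp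
      show "(\<lambda>x. vec.span {x}) ` X \<subseteq> \<Union> (U ` P)" using cellP by (auto simp: U_def)
      show "0 \<le> \<rho>" "\<rho> \<le> \<delta>" using \<open>C3 \<ge> 0\<close> N by (auto simp: \<rho>_def)
      have "real (card (U ` P)) \<le> real (card P)" using card_image_le[OF finP, of U] by simp
      also have "card P = (2 * N * R' + 1) ^ (2 * t)"
      proof -
        have "card {- int M..int M} = 2 * M + 1" for M by simp
        from this[of "N * R'"] have "card I = 2 * N * R' + 1" by (simp only: I_def mult.assoc)
        then show ?thesis by (simp add: P_def card_PiE card_cartesian_product t_def power_mult power2_eq_square)
      qed
      also have "real ((2 * N * R' + 1) ^ (2 * t)) \<le> (3 * real R' * real N) ^ (2 * t)"
      proof -
        have "2 * N * R' + 1 \<le> 3 * R' * N" using N(3) R'(2) by (simp add: Suc_le_eq)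
        then have "real (2 * N * R' + 1) \<le> real (3 * R' * N)" by (simp only: of_nat_le_iff)
        then show ?thesis unfolding of_nat_power by (intro power_mono) auto
      qed
      finally have "real (card (U ` P)) * \<rho> powr s \<le> (3 * real R' * real N) ^ (2 * t) * \<rho> powr s"
        by (rule mult_right_mono) simp
      also have "\<dots> = A * real N powr (- (s - 2 * real t))"
      proof -
        have "real N ^ (2 * t) = real N powr (2 * real t)" using N(3) by (simp add: powr_realpow[symmetric])
        moreover have "\<rho> powr s = C3 powr s / real N powr s" using \<open>C3 \<ge> 0\<close> by
            (simp add: \<rho>_def powr_divide)
        moreover have "real N powr (- (s - 2 * real t)) = real N powr (2 * real t) / real N powr s"
          by (simp flip: powr_diff)
        ultimately show ?thesis by (simp add: A_def power_mult_distrib)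
      qed
      finally show "real (card (U ` P)) * \<rho> powr s < \<eta>" using N(1) by linarith
      fix V assume "V \<in> U ` P"
      then obtain c where V: "V = U c" by auto
      show "V \<subseteq> proj_space"
      proof
        fix q assume "q \<in> V"
        then obtain x where x: "x \<in> X" "q = vec.span {x}" by (auto simp: V U_def)
        then have "x \<noteq> 0" using p[of x] by auto
        then show "q \<in> proj_space" using span_singleton_in_proj_space x(2) by blast
      qed
      show "riem_dist g x y \<le> \<rho>" if "x \<in> V" "y \<in> V" for x y using that small by (auto
          simp: V U_def)
    qed
  qed
qed

text \<open>Each set of \<open>d\<close> chart coordinates has its own cover by Lipschitz pieces. A
  choice function selects one piece per set, and on the intersection all dependences hold at once.
  There are finitely many coordinate sets, so the choices stay countable. Exponents below 2 d are
  included because the dimension criterion needs one.\<close>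

lemma polynomial_graph_dirs_null:
  fixes F :: "complex^'d \<Rightarrow> complex^'m"
  assumes F: "polynomial_map F" and g: "proj_riemannian_metric g" and s: "s > 0" "s > 2 * (real CARD('d) - 1)"
  shows "hausdorff_measure proj_space (riem_dist g) s (asymp_dirs (graph_map F)) = 0"
proof -
  define E where "E p = {x. \<exists>v\<in>tangent_cone_inf (graph_map F). v $ p \<noteq> 0 \<and> x =
      (1 / v $ p) *s v}" for p
  have Ep: "x $ p = 1" if "x \<in> E p" for x p using that by (auto simp: E_def)
  have chart: "hausdorff_measure proj_space (riem_dist g) s ((\<lambda>x. vec.span {x}) ` E p) = 0" for p
  proof -
    define \<S> where "\<S> = {S. card S = CARD('d) \<and> p \<notin> S}"
    have "\<exists>\<A>. countable \<A> \<and> E p \<subseteq> \<Union>\<A> \<and> (\<forall>X\<in>\<A>.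
        lipschitz_dependent S X)" if "S \<in> \<S>" for S
    proof -
      have S: "card S = CARD('d)" "p \<notin> S" using that by (auto simp: \<S>_def)
      obtain G z where G: "entire_fun G" "G z \<noteq> 0" "\<And>x y. (\<And>i. i \<in> S
          \<Longrightarrow> x $ i = y $ i) \<Longrightarrow> G x = G y"
        "\<And>v. v \<in> tangent_cone_inf (graph_map F) \<Longrightarrow> v $ p \<noteq> 0
            \<Longrightarrow> G ((1 / v $ p) *s v) = 0"
        using cone_relation_in_chart[OF F S, of thesis] by blast
      have "depends_only_on S G" unfolding depends_only_on_def by (intro allI impI G(3)) blast
      then obtain \<A> where "countable \<A>" "{x. G x = 0} \<subseteq> \<Union>\<A>" "\<And>X. X \<in>
          \<A> \<Longrightarrow> lipschitz_dependent S X"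
        using zero_set_lipschitz_cover[OF G(1) _ G(2)] by metis
      moreover have "E p \<subseteq> {x. G x = 0}" using G(4) by (auto simp: E_def)
      ultimately show ?thesis by (meson order_trans)
    qed
    then obtain \<A> where \<A>: "\<And>S. S \<in> \<S> \<Longrightarrow> countable (\<A> S)" "\<And>S.
        S \<in> \<S> \<Longrightarrow> E p \<subseteq> \<Union>(\<A> S)"
      "\<And>S X. S \<in> \<S> \<Longrightarrow> X \<in> \<A> S \<Longrightarrow> lipschitz_dependent S X"
      by metis
    \<comment> \<open>The radius \<open>n\<close> supplies the boundedness required by the covering
      estimate.\<close>
    define Y where "Y f n = {x \<in> E p. (\<forall>S\<in>\<S>. x \<in> f S) \<and> norm x \<le> real
        n}" for f and n :: nat
    define Ix where "Ix = (\<Pi>\<^sub>E S\<in>\<S>. \<A> S) \<times> (UNIV :: nat set)"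
    have "countable Ix"
      unfolding Ix_def using \<A>(1) by (intro countable_SIGMA countable_PiE) (auto simp: \<S>_def)
    moreover have "hausdorff_measure proj_space (riem_dist g) s ((\<lambda>x. vec.span {x}) ` (case i of
        (f, n) \<Rightarrow> Y f n)) = 0" if iI: "i \<in> Ix" for i
    proof -
      obtain f n where i: "i = (f, n)" "f \<in> (\<Pi>\<^sub>E S\<in>\<S>. \<A> S)" using iI by (auto simp: Ix_def)
      have dep: "lipschitz_dependent S (Y f n)" if "card S = CARD('d)" "p \<notin> S" for S
      proof (rule lipschitz_dependent_subset)
        have "S \<in> \<S>" using that by (simp add: \<S>_def)
        then show "lipschitz_dependent S (f S)" using \<A>(3) i(2) by (auto simp: PiE_iff)
        show "Y f n \<subseteq> f S" using \<open>S \<in> \<S>\<close> by (auto simp: Y_def)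
      qed
      have Y1: "x $ p = 1" if "x \<in> Y f n" for x using that Ep by (simp add: Y_def)
      obtain T C where T: "card T < CARD('d)" "C \<ge> 0"
        "\<And>x y i. x \<in> Y f n \<Longrightarrow> y \<in> Y f n \<Longrightarrow> norm (x $ i - y $
            i) \<le> C * (\<Sum>k\<in>T. norm (x $ k - y $ k))"
        by (rule lipschitz_spanning_coordinates[of "Y f n" p "CARD('d)"])
           (erule Y1, erule dep, assumption, rule that)
      have "real (card T) + 1 \<le> real CARD('d)" using T(1) by linarith
      then have "s > 2 * real (card T)" using s(2) by (simp add: algebra_simps)
      moreover have Yn: "norm x \<le> real n" if "x \<in> Y f n" for x using that by (simp add: Y_def)
      ultimately have "hausdorff_measure proj_space (riem_dist g) s ((\<lambda>x. vec.span {x}) ` Y f n) = 0"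
        using chart_piece_null[of g "Y f n" p "real n" C T s] g Y1 T(2,3) s(1) by blast
      then show ?thesis by (simp add: i)
    qed
    ultimately have "hausdorff_measure proj_space (riem_dist g) s (\<Union>i\<in>Ix. (\<lambda>x.
        vec.span {x}) ` (case i of (f, n) \<Rightarrow> Y f n)) = 0"
      by (rule hausdorff_null_UN)
    moreover have "(\<lambda>x. vec.span {x}) ` E p \<subseteq> (\<Union>i\<in>Ix. (\<lambda>x. vec.span
        {x}) ` (case i of (f, n) \<Rightarrow> Y f n))"
    proof
      fix q assume "q \<in> (\<lambda>x. vec.span {x}) ` E p"
      then obtain x where x: "x \<in> E p" "q = vec.span {x}" by auto
      define f where "f = restrict (\<lambda>S. SOME X. X \<in> \<A> S \<and> x \<in> X) \<S>"
      have f: "f S \<in> \<A> S \<and> x \<in> f S" if "S \<in> \<S>" for S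
      proof -
        have "\<exists>X. X \<in> \<A> S \<and> x \<in> X" using \<A>(2)[OF that] x(1) by blast
        then have "(SOME X. X \<in> \<A> S \<and> x \<in> X) \<in> \<A> S \<and> x \<in> (SOME X. X
            \<in> \<A> S \<and> x \<in> X)" by (rule someI_ex)
        then show ?thesis using that by (simp add: f_def)
      qed
      obtain n where "norm x \<le> real n" using real_arch_simple by blast
      then have "x \<in> Y f n" using x f by (auto simp: Y_def)
      moreover have "(f, n) \<in> Ix" using f by (auto simp: Ix_def PiE_iff f_def)
      ultimately show "q \<in> (\<Union>i\<in>Ix. (\<lambda>x. vec.span {x}) ` (case i of (f, n)
          \<Rightarrow> Y f n))" using x(2) by force
    qed
    ultimately show ?thesis by (rule hausdorff_null_subset)
  qed
  have "hausdorff_measure proj_space (riem_dist g) s (\<Union>p\<in>UNIV. (\<lambda>x. vec.span {x}) ` E p) = 0"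
    using chart by (intro hausdorff_null_UN countable_finite) auto
  moreover have "asymp_dirs (graph_map F) \<subseteq> (\<Union>p\<in>UNIV. (\<lambda>x. vec.span {x}) ` E p)"
  proof
    fix q assume "q \<in> asymp_dirs (graph_map F)"
    then obtain v where v: "v \<in> tangent_cone_inf (graph_map F)" "v \<noteq> 0" "q = vec.span {v}" by
        (auto simp: asymp_dirs_def)
    then obtain p where p: "v $ p \<noteq> 0" by (auto simp: vec_eq_iff)
    define x where "x = (1 / v $ p) *s v"
    have "x \<in> E p" using v p by (auto simp: E_def x_def)
    moreover have "q = vec.span {x}"
      unfolding v(3) x_def
    proof (rule vec.span_eq[THEN iffD2], intro conjI)
      show "{v} \<subseteq> vec.span {(1 / v $ p) *s v}"
        using p vec.span_scale[OF vec.span_base, of "(1 / v $ p) *s v" "{(1 / v $ p) *s v}" "v $ p"] by simp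
      show "{(1 / v $ p) *s v} \<subseteq> vec.span {v}" by (simp add: vec.span_scale vec.span_base)
    qed
    ultimately show "q \<in> (\<Union>p\<in>UNIV. (\<lambda>x. vec.span {x}) ` E p)" by blast
  qed
  ultimately show ?thesis by (rule hausdorff_null_subset)
qed

section \<open>From cones to asymptotic directions and the equivalences\<close>

lemma asymp_dirs_meets_plane:
  fixes F :: "complex^'d \<Rightarrow> complex^'m"
  assumes F: "entire_map F" "\<not> polynomial_map F" and L: "vec.subspace L" "vec.dim L = CARD('m)"
  obtains v where "v \<in> tangent_cone_inf (graph_map F)" "v \<noteq> 0" "v \<in> L"
  using polynomial_map_if_avoids_plane[OF F(1) L] F(2) by blast

text \<open>With a single component the subspaces of dimension \<open>m\<close> are the complex
  lines themselves, so meeting each of them amounts to containing every point of projective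
  space.\<close>

lemma asymp_dirs_graph_fun:
  fixes f :: "complex^'d \<Rightarrow> complex"
  assumes f: "entire_fun f" "\<not> polynomial_fun f"
  shows "asymp_dirs (graph_fun f) = proj_space"
proof
  define F :: "complex^'d \<Rightarrow> complex^1" where "F z = (\<chi> j. f z)" for z
  have F: "entire_map F" "\<not> polynomial_map F"
    using f by (auto simp: F_def entire_map_def polynomial_map_def)
  have eq: "graph_fun f = graph_map F"
  proof -
    have "($) (F z) = (\<lambda>_. f z)" for z by (rule ext) (simp add: F_def)
    then show ?thesis unfolding graph_fun_def graph_map_def by simp
  qed
  show "asymp_dirs (graph_fun f) \<subseteq> proj_space"
    using span_singleton_in_proj_space by (auto simp: asymp_dirs_def)
  show "proj_space \<subseteq> asymp_dirs (graph_fun f)"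
  proof
    fix l :: "(complex^('d + 1)) set" assume "l \<in> proj_space"
    then have l: "vec.subspace l" "vec.dim l = 1" by (auto simp: proj_of_def)
    obtain v where v: "v \<in> tangent_cone_inf (graph_map F)" "v \<noteq> 0" "v \<in> l"
      by (rule asymp_dirs_meets_plane[OF F l(1)]) (use l(2) in auto)
    have "vec.span {v} = l"
    proof (rule vec.subspace_dim_equal)
      show "vec.span {v} \<subseteq> l" using v(3) l(1) by (simp add: vec.span_minimal)
      show "vec.dim l \<le> vec.dim (vec.span {v})"
        using span_singleton_in_proj_space[OF v(2)] l(2) by (simp add: proj_of_def)
    qed (use l in auto)
    then show "l \<in> asymp_dirs (graph_fun f)" using v by (auto simp: asymp_dirs_def eq)
  qed
qed

text \<open>A strict bound on the infimum yields a null exponent below \<open>t\<close>, which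
  monotonicity in the exponent can then raise.\<close>

lemma hausdorff_dim_less_iff:
  "hausdorff_dim M d A < ennreal t \<longleftrightarrow> (\<exists>s\<ge>0. s < t \<and>
      hausdorff_measure M d s A = 0)"
  unfolding hausdorff_dim_def INF_less_iff by (auto simp: ennreal_less_iff)

theorem corollary3p5:
  fixes F :: "complex^'d \<Rightarrow> complex^'m"
    and g :: "complex^('d + 'm) \<Rightarrow> complex^('d + 'm) \<Rightarrow> complex^('d + 'm) \<Rightarrow> real"
  assumes "entire_map F"
    and "proj_riemannian_metric g"
  shows "(polynomial_map F \<longleftrightarrow>
            hausdorff_measure proj_space (riem_dist g) (real (2 * CARD('d)))
              (asymp_dirs (graph_map F)) = 0)
       \<and> (polynomial_map F \<longleftrightarrow>
            hausdorff_dim proj_space (riem_dist g) (asymp_dirs (graph_map F))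
              < of_nat (2 * CARD('d)))
       \<and> (\<not> polynomial_map F \<longrightarrow>
            (\<forall>Q. proj_plane (CARD('m) - 1) Q \<longrightarrow> asymp_dirs (graph_map F) \<inter> Q \<noteq> {})
            \<and> hausdorff_measure proj_space (riem_dist g) (real (2 * CARD('d)))
                (asymp_dirs (graph_map F)) > 0)
       \<and> (\<forall>f :: complex^'d \<Rightarrow> complex. entire_fun f \<and> \<not> polynomial_fun f \<longrightarrow>
            asymp_dirs (graph_fun f) = proj_space)"
proof -
  let ?H = "\<lambda>s. hausdorff_measure proj_space (riem_dist g) s (asymp_dirs (graph_map F))"
  let ?n = "real (2 * CARD('d))"
  have "CARD('d) > 0" "CARD('m) > 0" by simp_all
  then have n1: "?n > 1" by linarith
  have poly: "?H s = 0" if "polynomial_map F" "s > ?n - 2" "s > 0" for s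
    using polynomial_graph_dirs_null[OF that(1) assms(2) that(3)] that(2) by simp
  have nonpoly: "?H ?n \<noteq> 0" if np: "\<not> polynomial_map F"
  proof (rule hausdorff_nonnull_if_meets_planes[OF assms(2)])
    fix L :: "(complex^('d + 'm)) set"
    assume "vec.subspace L" "vec.dim L + CARD('d) = CARD('d + 'm)"
    then have L: "vec.subspace L" "vec.dim L = CARD('m)" by simp_all
    show "\<exists>v\<in>tangent_cone_inf (graph_map F). v \<noteq> 0 \<and> v \<in> L"
      using asymp_dirs_meets_plane[OF assms(1) np L] by blast
  qed (use \<open>CARD('m) > 0\<close> in simp)
  have plane: "asymp_dirs (graph_map F) \<inter> Q \<noteq> {}" if np: "\<not> polynomial_map F" and Q:
      "proj_plane (CARD('m) - 1) Q" for Q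
  proof -
    obtain L where L: "vec.subspace L" "vec.dim L = CARD('m)" "Q = proj_of L"
      using Q \<open>CARD('m) > 0\<close> by (auto simp: proj_plane_def)
    obtain v where v: "v \<in> tangent_cone_inf (graph_map F)" "v \<noteq> 0" "v \<in> L"
      by (rule asymp_dirs_meets_plane[OF assms(1) np L(1,2)])
    have "vec.span {v} \<in> Q"
      using span_singleton_in_proj_space[OF v(2)] v(3) L by (simp add: proj_of_def vec.span_minimal)
    moreover have "vec.span {v} \<in> asymp_dirs (graph_map F)" using v by (auto simp: asymp_dirs_def)
    ultimately show ?thesis by blast
  qed
  have dim: "hausdorff_dim proj_space (riem_dist g) (asymp_dirs (graph_map F)) < of_nat (2 * CARD('d))
      \<longleftrightarrow>
      (\<exists>s\<ge>0. s < ?n \<and> ?H s = 0)"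
    unfolding ennreal_of_nat_eq_real_of_nat by (rule hausdorff_dim_less_iff)
  \<comment> \<open>The exponent 2 d - 1 lies strictly between 2 d - 2 and 2 d and is positive even
    for d = 1.\<close>
  have "?H (?n - 1) = 0" if "polynomial_map F"
    using poly[OF that, of "?n - 1"] n1 by simp
  then have dim1: "\<exists>s\<ge>0. s < ?n \<and> ?H s = 0" if "polynomial_map F"
    using that n1 by (intro exI[of _ "?n - 1"]) auto
  \<comment> \<open>A null exponent below 2 d makes 2 d itself null, which is impossible for a
    nonpolynomial map.\<close>
  have dim2: "polynomial_map F" if "\<exists>s\<ge>0. s < ?n \<and> ?H s = 0"
    using that nonpoly hausdorff_null_mono_exponent by metis
  have "?H ?n = 0" if "polynomial_map F" using poly[OF that, of ?n] \<open>CARD('d) > 0\<close> by simp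
  then show ?thesis
    unfolding dim using dim1 dim2 nonpoly plane asymp_dirs_graph_fun by (auto simp: zero_less_iff_neq_zero)
qed

end
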